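(* For every $d \in \mathbb{N}_0$, let $\mathfrak{N}_d^{\mathrm{VT}}$ (resp. $\mathfrak{N}_d^{\mathrm{Cay}}$) denote the set of all $n \in \mathbb{N}$ for which there exists a $d$-regular vertex-transitive (resp. Cayley) nut graph of order $n$. Then \[ \mathfrak{N}_d^{\mathrm{VT}} = \mathfrak{N}_d^{\mathrm{Cay}} = \begin{cases} \varnothing, & \text{if $d$ is odd or $d < 4$},\\ \{ n \in \mathbb{N} : n \text{ even},\ n \ge d+4\}, & \text{if } 4 \mid d \text{ and } d \ge 4,\\ \{ n \in \mathbb{N} : 4 \mid n,\ n \ge d+6\}, & \text{if } d \equiv 2 \pmod 4 \text{ and } d \ge 6. \end{cases} \]
   Context: All graphs are finite, simple and undirected. A nut graph is a graph with at least two vertices whose adjacency matrix has eigenvalue $0$ with multiplicity exactly one, such that the corresponding eigenvector (spanning the kernel) has no zero entries. A graph is vertex-transitive if its automorphism group acts transitively on its vertices. For a finite group $\Gamma$ with identity $e$ and a subset $C \subseteq \Gamma\setminus\{e\}$ closed under inversion, $\mathrm{Cay}(\Gamma, C)$ is the graph with vertex set $\Gamma$ in which $u,v$ are adjacent iff $vu^{-1} \in C$; a Cayley graph is a graph isomorphic to some $\mathrm{Cay}(\Gamma,C)$. *)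

theory Defs
  imports "Jordan_Normal_Form.Determinant" "Jordan_Normal_Form.Char_Poly" "HOL-Algebra.Group"
begin

definition simple_graph :: "nat \<Rightarrow> (nat \<Rightarrow> nat \<Rightarrow> bool) \<Rightarrow> bool" where
  "simple_graph n E \<longleftrightarrow> (\<forall>u<n. \<forall>v<n. E u v \<longleftrightarrow> E v u) \<and> (\<forall>u<n. \<not> E u u)"

definition regular_graph :: "nat \<Rightarrow> (nat \<Rightarrow> nat \<Rightarrow> bool) \<Rightarrow> nat \<Rightarrow> bool" where
  "regular_graph n E d \<longleftrightarrow> (\<forall>u<n. card {v. v < n \<and> E u v} = d)"

definition adj_matrix :: "nat \<Rightarrow> (nat \<Rightarrow> nat \<Rightarrow> bool) \<Rightarrow> real mat" where
  "adj_matrix n E = mat n n (\<lambda>(i, j). if E i j then 1 else 0)"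

definition nut_graph :: "nat \<Rightarrow> (nat \<Rightarrow> nat \<Rightarrow> bool) \<Rightarrow> bool" where
  "nut_graph n E \<longleftrightarrow> simple_graph n E \<and> n \<ge> 2 \<and>
     Polynomial.order 0 (char_poly (adj_matrix n E)) = 1 \<and>
     (\<exists>x \<in> carrier_vec n. adj_matrix n E *\<^sub>v x = 0\<^sub>v n \<and> (\<forall>i<n. x $ i \<noteq> 0))"

definition vertex_transitive :: "nat \<Rightarrow> (nat \<Rightarrow> nat \<Rightarrow> bool) \<Rightarrow> bool" where
  "vertex_transitive n E \<longleftrightarrow>
     (\<forall>u<n. \<forall>v<n. \<exists>\<sigma>. bij_betw \<sigma> {0..<n} {0..<n} \<and>
        (\<forall>x<n. \<forall>y<n. E x y \<longleftrightarrow> E (\<sigma> x) (\<sigma> y)) \<and> \<sigma> u = v)"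

definition cayley_graph :: "nat \<Rightarrow> (nat \<Rightarrow> nat \<Rightarrow> bool) \<Rightarrow> bool" where
  "cayley_graph n E \<longleftrightarrow>
     (\<exists>(\<Gamma> :: nat monoid) C f. group \<Gamma> \<and> finite (carrier \<Gamma>) \<and>
        C \<subseteq> carrier \<Gamma> - {\<one>\<^bsub>\<Gamma>\<^esub>} \<and> (\<forall>c\<in>C. inv\<^bsub>\<Gamma>\<^esub> c \<in> C) \<and>
        bij_betw f (carrier \<Gamma>) {0..<n} \<and>
        (\<forall>u\<in>carrier \<Gamma>. \<forall>v\<in>carrier \<Gamma>. E (f u) (f v) \<longleftrightarrow> v \<otimes>\<^bsub>\<Gamma>\<^esub> inv\<^bsub>\<Gamma>\<^esub> u \<in> C))"

definition NVT :: "nat \<Rightarrow> nat set" where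
  "NVT d = {n. n \<ge> 1 \<and> (\<exists>E. simple_graph n E \<and> regular_graph n E d \<and>
                            vertex_transitive n E \<and> nut_graph n E)}"

definition NCay :: "nat \<Rightarrow> nat set" where
  "NCay d = {n. n \<ge> 1 \<and> (\<exists>E. simple_graph n E \<and> regular_graph n E d \<and>
                            cayley_graph n E \<and> nut_graph n E)}"

end

(*
Necessity. As the kernel is a line, every automorphism maps the kernel vector x to x or -x, so by
transitivity x may be taken with entries 1 and -1. Every neighbourhood is then balanced, which gives
d even and n even; if d/2 is odd, the graph induced on the vertices of sign 1 is regular of odd
degree, so 4 divides n. If n = d + 2, two non-adjacent vertices are twins, and d = 2 is excluded by
looking at the two perfect matchings formed by the edges with equal and with opposite signs.

Sufficiency. With m = n/2, take the Cayley graph of the dihedral group of order 2m with connection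
set consisting of rotations R = -R and reflections S, where |R| + |S| = d. Writing
R^(w) = sum of w^r over r in R, the adjacency matrix splits over the m-th roots of unity w into
2 x 2 blocks of determinant R^(w)^2 - S^(w) S^(1/w). It is enough to have a single singular block, of
rank one, at some w = kappa in {1, -1}. The sets R and S share a symmetric set C that can be chosen
freely to adjust the degree, and differ only in a few elements. Since C enters the determinant only
through multiples of 2 and through terms that vanish modulo the primes above 2, the determinant can
be controlled in Z[w] modulo the radical of the ideal (2). If the order of w is not a power of 2, the
determinant is a unit modulo this radical; if it is a power of 2, it becomes one after division by
the square of a uniformizer.
*)

theory Submission
  imports Defs "HOL-Number_Theory.Number_Theory"
begin

section \<open>The ring generated by a root of unity, modulo 2\<close>

text \<open>Let c be the character sum of the shared part, b the offset of R and g, g' the offsets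
  of S at w and 1/w. The determinant is, up to sign, (c + g)(c + g') - (c + b)^2 = c (g + g' - 2 b)
  + g g' - b^2: the square of c, which is beyond control, cancels. Many offsets are multiples of l,
  the odd part of m, because w^l always has 2-power order, so that 1 + w^l lies in the radical
  whatever w is, while w + 1/w is invertible modulo the radical unless w has 2-power order. Using
  the radical instead of a prime above 2 keeps the algebra elementary: it only needs that squaring
  is additive modulo 2 and that 1/2 is not an algebraic integer. The value kappa = 1 forces |R| =
  |S|, so when this size is odd R must contain the self-inverse residue m/2. The value kappa = -1
  permits unequal even sizes; it is used when half the degree is odd and 8 divides m.\<close>

definition zring :: "complex \<Rightarrow> complex set" where
  "zring w = range (\<lambda>p. poly (of_int_poly p) w)"

lemma zring_add: "x \<in> zring w \<Longrightarrow> y \<in> zring w \<Longrightarrow> x + y \<in> zring w"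
  unfolding zring_def by (auto simp flip: poly_add of_int_poly_hom.hom_add)

lemma zring_mult: "x \<in> zring w \<Longrightarrow> y \<in> zring w \<Longrightarrow> x * y \<in> zring w"
  unfolding zring_def by (auto simp flip: poly_mult of_int_poly_hom.hom_mult)

lemma zring_of_int: "of_int k \<in> zring w"
  unfolding zring_def by (rule range_eqI[of _ _ "[:k:]"]) (simp add: of_int_hom.map_poly_pCons_hom)

lemma zring_self: "w \<in> zring w"
  unfolding zring_def by (rule range_eqI[of _ _ "[:0, 1:]"]) (simp add: map_poly_pCons)

lemma zring_0: "0 \<in> zring w" and zring_1: "1 \<in> zring w" and zring_numeral: "numeral n \<in> zring w"
  using zring_of_int[of 0 w] zring_of_int[of 1 w] zring_of_int[of "numeral n" w] by simp_all

lemma zring_minus: "x \<in> zring w \<Longrightarrow> - x \<in> zring w"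
  using zring_mult[OF zring_of_int[of "-1"]] by fastforce

lemma zring_diff: "x \<in> zring w \<Longrightarrow> y \<in> zring w \<Longrightarrow> x - y \<in> zring w"
  using zring_add[OF _ zring_minus] by fastforce

lemma zring_power: "x \<in> zring w \<Longrightarrow> x ^ n \<in> zring w"
  by (induction n) (auto intro: zring_1 zring_mult)

lemma zring_sum: "(\<And>i. i \<in> A \<Longrightarrow> f i \<in> zring w) \<Longrightarrow> sum f A \<in> zring w"
  by (induction A rule: infinite_finite_induct) (auto intro: zring_0 zring_add)

lemmas zring_intros = zring_0 zring_1 zring_numeral zring_self zring_add zring_diff zring_mult
  zring_minus zring_power zring_sum

lemma inverse_root_of_unity:
  assumes "w ^ m = (1 :: complex)" "m > 0"
  shows "inverse w = w ^ (m - 1)"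
proof -
  have "w * w ^ (m - 1) = 1" using assms by (simp flip: power_Suc)
  then show ?thesis by (rule inverse_unique)
qed

lemma zring_inverse_self: "w ^ m = 1 \<Longrightarrow> m > 0 \<Longrightarrow> inverse w \<in> zring w"
  by (simp add: inverse_root_of_unity zring_power zring_self)

lemma power_mod_root: "w ^ m = (1 :: 'a :: monoid_mult) \<Longrightarrow> w ^ (k mod m) = w ^ k"
  by (metis mod_mult_div_eq mult_1_right power_add power_mult power_one)

text \<open>Multiplication by an element of \<open>\<int>[w]\<close> acts on the powers of \<open>w\<close> through an integer matrix,
  whose characteristic polynomial is monic.\<close>

lemma zring_algebraic_int:
  assumes w: "w ^ m = 1" "m > 0" and x: "x \<in> zring w"
  shows "algebraic_int x"
proof -
  obtain p :: "int poly" where p: "x = poly (of_int_poly p) w" using x by (auto simp: zring_def)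
  define A :: "int mat" where "A = mat m m (\<lambda>(i, j). \<Sum>k\<le>degree p. if (i + k) mod m = j then Polynomial.coeff p k else 0)"
  define B :: "complex mat" where "B = map_mat of_int A"
  define v where "v = vec m (\<lambda>i. w ^ i)"
  have AB: "A \<in> carrier_mat m m" "B \<in> carrier_mat m m" by (auto simp: A_def B_def)
  have "B *\<^sub>v v = x \<cdot>\<^sub>v v"
  proof (rule eq_vecI)
    fix i assume i: "i < dim_vec (x \<cdot>\<^sub>v v)"
    then have i: "i < m" by (simp add: v_def)
    have "(B *\<^sub>v v) $ i = (\<Sum>j<m. of_int (\<Sum>k\<le>degree p. if (i + k) mod m = j then Polynomial.coeff p k else 0) * w ^ j)"
      using i by (simp add: A_def B_def v_def scalar_prod_def lessThan_atLeast0)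
    also have "\<dots> = (\<Sum>j<m. \<Sum>k\<le>degree p. if (i + k) mod m = j then of_int (Polynomial.coeff p k) * w ^ j else 0)"
      by (auto simp: sum_distrib_right intro!: sum.cong)
    also have "\<dots> = (\<Sum>k\<le>degree p. \<Sum>j<m. if (i + k) mod m = j then of_int (Polynomial.coeff p k) * w ^ j else 0)"
      by (rule sum.swap)
    also have "\<dots> = (\<Sum>k\<le>degree p. of_int (Polynomial.coeff p k) * w ^ ((i + k) mod m))"
      using w(2) by (auto intro!: sum.cong)
    also have "\<dots> = x * w ^ i"
      by (simp add: p poly_altdef power_mod_root[OF w(1)] power_add sum_distrib_left algebra_simps)
    finally show "(B *\<^sub>v v) $ i = (x \<cdot>\<^sub>v v) $ i" using i by (simp add: v_def)
  qed (use AB in \<open>auto simp: v_def\<close>)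
  moreover have "v \<noteq> 0\<^sub>v m"
  proof
    assume "v = 0\<^sub>v m"
    then have "v $ 0 = 0\<^sub>v m $ 0" by simp
    then show False using w(2) by (simp add: v_def)
  qed
  ultimately have "eigenvalue B x"
    unfolding eigenvalue_def eigenvector_def using AB by (auto intro!: exI[of _ v] simp: v_def)
  then have "poly (char_poly B) x = 0" using eigenvalue_root_char_poly[OF AB(2)] by simp
  then have "poly (of_int_poly (char_poly A)) x = 0"
    using AB(1) by (simp add: B_def of_int_hom.char_poly_hom)
  then show ?thesis
    unfolding algebraic_int_altdef_ipoly
    using degree_monic_char_poly[OF AB(1)] by (intro exI[of _ "char_poly A"]) auto
qed

text \<open>Rational algebraic integers are integers, so 2 is not invertible in Z[w]. This keeps
  \<open>rad2 w\<close> from being the whole ring.\<close>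

lemma half_notin_zring:
  assumes "w ^ m = 1" "m > 0"
  shows "1 / 2 \<notin> zring w"
proof
  assume "1 / 2 \<in> zring w"
  then have "algebraic_int (1 / 2 :: complex)" by (rule zring_algebraic_int[OF assms])
  moreover have "(1 / 2 :: complex) \<in> \<rat>" by simp
  ultimately have "(1 / 2 :: complex) \<in> \<int>" by (rule rational_algebraic_int_is_int)
  then obtain k :: int where "(1 / 2 :: complex) = of_int k" by (auto elim: Ints_cases)
  then have "(of_int (2 * k) :: complex) = of_int 1" by (simp add: field_simps)
  then have "2 * k = 1" by (simp only: of_int_eq_iff)
  then show False by presburger
qed

text \<open>The radical of the ideal (2) of Z[w]. Admitting only exponents \<open>2 ^ n\<close>
  gives the same set, since multiples of 2 remain so in higher powers, and it lets closure under
  sums follow from the Frobenius identity.\<close>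

definition rad2 :: "complex \<Rightarrow> complex set" where
  "rad2 w = {x \<in> zring w. \<exists>n. \<exists>y \<in> zring w. x ^ (2 ^ n) = 2 * y}"

lemma rad2_zring: "x \<in> rad2 w \<Longrightarrow> x \<in> zring w"
  by (simp add: rad2_def)

lemma rad2_mult: "x \<in> zring w \<Longrightarrow> y \<in> rad2 w \<Longrightarrow> x * y \<in> rad2 w"
  unfolding rad2_def
  by (auto simp: power_mult_distrib intro!: zring_mult)
     (metis mult.left_commute zring_mult zring_power)

lemma rad2_mult': "x \<in> rad2 w \<Longrightarrow> y \<in> zring w \<Longrightarrow> x * y \<in> rad2 w"
  using rad2_mult by (metis mult.commute)

lemma rad2_2: "2 \<in> rad2 w"
  unfolding rad2_def by (auto intro!: exI[of _ 0] bexI[of _ 1] zring_intros)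

lemma rad2_0: "0 \<in> rad2 w"
  using rad2_mult[OF zring_0 rad2_2] by simp

lemma rad2_powerD: "x ^ (2 ^ n) \<in> rad2 w \<Longrightarrow> x \<in> zring w \<Longrightarrow> x \<in> rad2 w"
  unfolding rad2_def by (auto simp: power_mult[symmetric] power_add[symmetric])

lemma rad2_not_1:
  assumes "w ^ m = 1" "m > 0"
  shows "1 \<notin> rad2 w"
proof
  assume "1 \<in> rad2 w"
  then obtain y where "y \<in> zring w" "1 = 2 * y" by (auto simp: rad2_def)
  moreover have "y = 1 / 2" using \<open>1 = 2 * y\<close> by (simp add: field_simps)
  ultimately show False using half_notin_zring[OF assms] by simp
qed

text \<open>Each squaring produces cross terms with a factor 2. The error is kept as an explicit
  multiple of 2, which is what closure of the radical under sums and the unit criterion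
  consume.\<close>

lemma frobenius_mod_2:
  assumes "x \<in> zring w" "y \<in> zring w"
  shows "\<exists>z \<in> zring w. (x + y) ^ (2 ^ n) = x ^ (2 ^ n) + y ^ (2 ^ n) + 2 * z"
proof (induction n)
  case 0
  then show ?case by (auto intro!: bexI[of _ 0] zring_intros)
next
  case (Suc n)
  then obtain z where z: "z \<in> zring w" "(x + y) ^ (2 ^ n) = x ^ (2 ^ n) + y ^ (2 ^ n) + 2 * z" by blast
  define X Y where "X = x ^ (2 ^ n)" and "Y = y ^ (2 ^ n)"
  have XY: "X \<in> zring w" "Y \<in> zring w" by (auto simp: X_def Y_def intro!: zring_intros assms)
  have "(x + y) ^ (2 ^ Suc n) = (X + Y + 2 * z)\<^sup>2"
    unfolding X_def Y_def z(2)[symmetric] by (simp add: power_mult[symmetric] mult.commute)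
  also have "\<dots> = X\<^sup>2 + Y\<^sup>2 + 2 * (X * Y + 2 * z * (X + Y) + 2 * z\<^sup>2)"
    by (simp add: power2_eq_square algebra_simps)
  finally show ?case
    using XY z by (auto intro!: bexI[of _ "X * Y + 2 * z * (X + Y) + 2 * z\<^sup>2"] zring_intros
      simp: X_def Y_def power_mult[symmetric] mult.commute)
qed

lemma rad2_add:
  assumes "x \<in> rad2 w" "y \<in> rad2 w"
  shows "x + y \<in> rad2 w"
proof -
  \<comment> \<open>Further squaring keeps a factor 2, so both elements can be brought to the common
    exponent \<open>2 ^ (a + b)\<close>.\<close>
  have lift: "\<exists>y\<in>zring w. x ^ (2 ^ (a + b)) = 2 * y"
    if "x ^ (2 ^ a) = 2 * y" "y \<in> zring w" for x y a b
  proof -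
    have "x ^ (2 ^ (a + b)) = (2 * y) ^ (2 ^ b)" by (simp add: power_add power_mult that)
    also have "\<dots> = 2 * (2 ^ (2 ^ b - 1) * y ^ (2 ^ b))"
      by (simp add: power_mult_distrib mult.assoc[symmetric] flip: power_Suc)
    finally show ?thesis using that by (auto intro!: bexI[of _ "2 ^ (2 ^ b - 1) * y ^ (2 ^ b)"] zring_intros)
  qed
  obtain a x' where x': "x' \<in> zring w" "x ^ (2 ^ a) = 2 * x'" using assms by (auto simp: rad2_def)
  obtain b y' where y': "y' \<in> zring w" "y ^ (2 ^ b) = 2 * y'" using assms by (auto simp: rad2_def)
  have xy: "x \<in> zring w" "y \<in> zring w" using assms by (auto simp: rad2_def)
  obtain x1 where x1: "x1 \<in> zring w" "x ^ (2 ^ (a + b)) = 2 * x1" using lift[OF x'(2,1)] by blast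
  obtain y1 where y1: "y1 \<in> zring w" "y ^ (2 ^ (a + b)) = 2 * y1"
    using lift[OF y'(2,1), of a] by (auto simp: add.commute)
  obtain z where "z \<in> zring w" "(x + y) ^ (2 ^ (a + b)) = x ^ (2 ^ (a + b)) + y ^ (2 ^ (a + b)) + 2 * z"
    using frobenius_mod_2[OF xy] by blast
  then have "(x + y) ^ (2 ^ (a + b)) = 2 * (x1 + y1 + z)" "x1 + y1 + z \<in> zring w"
    using x1 y1 by (auto simp: algebra_simps intro!: zring_intros)
  then show ?thesis unfolding rad2_def using xy by (blast intro: zring_add)
qed

lemma rad2_minus: "x \<in> rad2 w \<Longrightarrow> - x \<in> rad2 w"
  using rad2_mult[OF zring_of_int[of "-1"]] by fastforce

lemma rad2_diff: "x \<in> rad2 w \<Longrightarrow> y \<in> rad2 w \<Longrightarrow> x - y \<in> rad2 w"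
  using rad2_add[OF _ rad2_minus] by fastforce

lemma rad2_sum: "(\<And>i. i \<in> A \<Longrightarrow> f i \<in> rad2 w) \<Longrightarrow> sum f A \<in> rad2 w"
  by (induction A rule: infinite_finite_induct) (auto intro: rad2_0 rad2_add)

section \<open>Divisibility among the elements 1 + x^s for roots of unity x\<close>

lemma geometric_factor: "\<exists>K \<in> zring x. 1 - x ^ n = (1 - x) * K"
  by (rule bexI[of _ "\<Sum>i<n. x ^ i"]) (auto simp: one_diff_power_eq intro!: zring_intros)

lemma zring_trans:
  assumes "x \<in> zring y" "y \<in> zring w"
  shows "x \<in> zring w"
proof -
  obtain p :: "int poly" where "x = poly (of_int_poly p) y" using assms(1) by (auto simp: zring_def)
  then have "x = (\<Sum>i\<le>degree p. of_int (Polynomial.coeff p i) * y ^ i)" by (simp add: poly_altdef)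
  then show ?thesis using assms(2) by (auto intro!: zring_intros zring_of_int)
qed

lemma one_plus_odd_power_factor:
  assumes "odd n"
  shows "\<exists>K \<in> zring x. 1 + x ^ n = (1 + x) * K"
proof -
  obtain K where "K \<in> zring (- x)" "1 - (- x) ^ n = (1 - (- x)) * K" using geometric_factor by blast
  then show ?thesis using assms zring_trans[of K "- x" x]
    by (auto intro!: bexI[of _ K] zring_intros)
qed

text \<open>An odd t is invertible modulo \<open>2 ^ n\<close>, so x^t generates the same group as
  x. The exponent j has to be odd so that 1 + y divides 1 + y^j.\<close>

lemma two_power_odd_exponent:
  fixes x :: "'a :: monoid_mult"
  assumes "x ^ (2 ^ n) = 1" "odd s" "odd t"
  shows "\<exists>j. odd j \<and> x ^ s = (x ^ t) ^ j"
\<comment> \<open>The parity of j is read off from a congruence modulo \<open>2 ^ n\<close>, which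
  says nothing when n = 0.\<close>
proof (cases "n = 0")
  case True
  then show ?thesis using assms by (auto intro!: exI[of _ 1])
next
  case False
  have "coprime t (2 ^ n)" using assms by simp
  then obtain i where "[t * i = 1] (mod 2 ^ n)" using cong_solve_coprime_nat[of t "2 ^ n"] by auto
  then have "[t * i * s = 1 * s] (mod 2 ^ n)" by (rule cong_scalar_right)
  moreover define j where "j = i * s"
  ultimately have j: "[t * j = s] (mod 2 ^ n)" by (simp add: mult.assoc)
  then have "[t * j = s] (mod 2)" by (rule cong_dvd_modulus_nat) (use False in simp)
  then have "odd j" using assms by (auto simp: cong_def even_iff_mod_2_eq_zero[symmetric] odd_iff_mod_2_eq_one[symmetric] mod_2_eq_odd split: if_splits)
  moreover have "x ^ s = x ^ (t * j)"
    using j assms(1) by (metis cong_def power_mod_root)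
  ultimately show ?thesis by (auto simp: power_mult)
qed

text \<open>The roles of s and t are interchangeable, so all these elements are associates and any
  odd exponent may serve as reference.\<close>

lemma one_plus_odd_powers_factor:
  assumes "x ^ (2 ^ n) = 1" "odd s" "odd t"
  shows "\<exists>K \<in> zring x. 1 + x ^ s = (1 + x ^ t) * K"
proof -
  obtain j where j: "odd j" "x ^ s = (x ^ t) ^ j" using two_power_odd_exponent[OF assms] by blast
  obtain K where "K \<in> zring (x ^ t)" "1 + (x ^ t) ^ j = (1 + x ^ t) * K"
    using one_plus_odd_power_factor[OF j(1)] by blast
  then show ?thesis using j zring_trans[of K "x ^ t" x] by (auto intro!: bexI[of _ K] zring_intros)
qed

text \<open>For x of order at least 4, both factors of 1 - x^2 are multiples of 1 + x, and 1 - x^2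
  divides 2. For x = 1 and x = -1 the element 1 + x is 2 or 0 and the claim fails.\<close>

lemma two_eq_square_factor:
  fixes x :: complex
  assumes "x ^ (2 ^ n) = 1" "x \<noteq> 1" "x \<noteq> -1"
  shows "\<exists>K \<in> zring x. 2 = (1 + x)\<^sup>2 * K"
proof -
  define j where "j = (LEAST j. x ^ (2 ^ j) = 1)"
  have j: "x ^ (2 ^ j) = 1" unfolding j_def by (rule LeastI[of _ n]) (rule assms)
  have min: "x ^ (2 ^ i) \<noteq> 1" if "i < j" for i using that not_less_Least unfolding j_def by blast
  have "j \<noteq> 0" using j assms by (auto intro: ccontr)
  moreover have "j \<noteq> 1" using j assms by (auto simp: power2_eq_1_iff)
  ultimately obtain i where i: "j = Suc (Suc i)" by (metis One_nat_def not0_implies_Suc)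
  \<comment> \<open>N is a quarter of the order of x, so x^(2N) = -1; this turns 1 - x^(2N) into 2
    and makes -x an odd power of x.\<close>
  define N where "N = (2 :: nat) ^ i"
  have "(x ^ (2 * N))\<^sup>2 = 1" using j by (simp add: i N_def power_mult[symmetric] mult.commute)
  moreover have "x ^ (2 * N) \<noteq> 1" using min[of "Suc i"] by (simp add: i N_def)
  ultimately have N: "x ^ (2 * N) = -1" by (simp add: power2_eq_1_iff)
  obtain K1 where K1: "K1 \<in> zring (x\<^sup>2)" "1 - (x\<^sup>2) ^ N = (1 - x\<^sup>2) * K1" using geometric_factor by blast
  obtain K2 where K2: "K2 \<in> zring x" "1 + x ^ Suc (2 * N) = (1 + x) * K2"
    using one_plus_odd_power_factor[of "Suc (2 * N)" x] by auto
  have "2 = (1 - x\<^sup>2) * K1" using K1(2) N by (simp add: power_mult[symmetric])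
  also have "1 - x\<^sup>2 = (1 + x) * (1 - x)" by (simp add: power2_eq_square algebra_simps)
  also have "1 - x = (1 + x) * K2" using K2(2) N by simp
  finally have "2 = (1 + x)\<^sup>2 * (K2 * K1)" by (simp add: power2_eq_square algebra_simps)
  moreover have "K1 \<in> zring x" using zring_trans[OF K1(1)] by (simp add: zring_intros)
  ultimately show ?thesis using K2(1) by (blast intro: zring_mult)
qed

text \<open>(1 + x)^2 and 1 + x^2 differ by 2 x, and passing from x to x^2 lowers n by one.\<close>

lemma one_plus_two_power_rad2:
  assumes "x ^ (2 ^ n) = 1" "x \<in> zring w"
  shows "1 + x \<in> rad2 w"
  using assms
proof (induction n arbitrary: x)
  case 0
  then show ?case using rad2_2 by simp
next
  case (Suc n)
  have "1 + x\<^sup>2 \<in> rad2 w" using Suc.prems by (intro Suc.IH) (auto simp: power_mult[symmetric] intro: zring_power)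
  then have "(1 + x\<^sup>2) + x * 2 \<in> rad2 w" using Suc.prems rad2_add rad2_mult rad2_2 by blast
  then have "(1 + x) ^ (2 ^ 1) \<in> rad2 w" by (simp add: power2_eq_square algebra_simps)
  then show ?case by (rule rad2_powerD) (intro zring_intros Suc.prems)
qed

text \<open>For odd l, x is itself a power of x^2, so 1 - x is in turn a multiple of 1 - x^2; the
  quotient inverts 1 + x.\<close>

lemma one_plus_odd_order_unit:
  fixes x :: complex
  assumes "x ^ l = 1" "odd l" "x \<noteq> 1"
  shows "\<exists>K \<in> zring x. K * (1 + x) = 1"
proof -
  obtain j where j: "l = 2 * j + 1" using assms by (auto elim: oddE)
  obtain K where K: "K \<in> zring (x\<^sup>2)" "1 - (x\<^sup>2) ^ Suc j = (1 - x\<^sup>2) * K" using geometric_factor by blast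
  \<comment> \<open>\<open>Suc j\<close> is (l + 1) / 2, the inverse of 2 modulo l.\<close>
  have "(x\<^sup>2) ^ Suc j = x ^ (l + 1)" unfolding power_mult[symmetric] by (simp add: j)
  then have "(x\<^sup>2) ^ Suc j = x ^ l * x" by simp
  moreover have "1 - x\<^sup>2 = (1 - x) * (1 + x)" by (simp add: power2_eq_square algebra_simps)
  ultimately have "1 - x = (1 - x) * (K * (1 + x))" using K(2) assms(1) by (simp add: algebra_simps)
  then have "K * (1 + x) = 1" using assms(3) by simp
  moreover have "K \<in> zring x" using zring_trans[OF K(1)] by (simp add: zring_intros)
  ultimately show ?thesis by blast
qed

section \<open>Units modulo the radical\<close>

definition unit_mod :: "complex \<Rightarrow> complex \<Rightarrow> bool" where
  "unit_mod w x \<longleftrightarrow> x \<in> zring w \<and> (\<exists>K \<in> zring w. K * x - 1 \<in> rad2 w)"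

lemma unit_mod_mult:
  assumes "unit_mod w x" "unit_mod w y"
  shows "unit_mod w (x * y)"
proof -
  obtain K L where KL: "x \<in> zring w" "y \<in> zring w" "K \<in> zring w" "L \<in> zring w" "K * x - 1 \<in> rad2 w" "L * y - 1 \<in> rad2 w"
    using assms by (auto simp: unit_mod_def)
  have "(L * y) * (K * x - 1) + (L * y - 1) \<in> rad2 w" using KL by (intro rad2_add rad2_mult zring_intros)
  moreover have "(L * y) * (K * x - 1) + (L * y - 1) = (K * L) * (x * y) - 1" by (simp add: algebra_simps)
  ultimately show ?thesis using KL unfolding unit_mod_def by (metis zring_mult)
qed

lemma unit_mod_cong:
  assumes "unit_mod w x" "y - x \<in> rad2 w"
  shows "unit_mod w y"
proof -
  obtain K where K: "x \<in> zring w" "K \<in> zring w" "K * x - 1 \<in> rad2 w"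
    using assms by (auto simp: unit_mod_def)
  have "K * (y - x) + (K * x - 1) \<in> rad2 w" using K assms by (intro rad2_add rad2_mult)
  then have "K * y - 1 \<in> rad2 w" by (simp add: algebra_simps)
  moreover have "(y - x) + x \<in> zring w" using K(1) rad2_zring[OF assms(2)] by (rule zring_add[rotated])
  ultimately show ?thesis using K by (auto simp: unit_mod_def)
qed

lemma unit_mod_1_plus: "x \<in> rad2 w \<Longrightarrow> unit_mod w (1 + x)"
  by (rule unit_mod_cong[of _ 1]) (auto simp: unit_mod_def intro!: zring_intros bexI[of _ 1] rad2_0)

text \<open>The product form lets invertibility be tested on 1 + w^(r+s) and 1 + w^(r-s)
  separately.\<close>

lemma pair_sum_factor:
  fixes w :: complex
  assumes "w \<noteq> 0" "s \<le> r"
  shows "w ^ r + inverse w ^ r + (w ^ s + inverse w ^ s) = inverse w ^ r * ((1 + w ^ (r + s)) * (1 + w ^ (r - s)))"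
proof -
  obtain q where "r = s + q" using assms by (auto simp: le_iff_add)
  then show ?thesis using assms(1) by (simp add: field_simps power_add)
qed

text \<open>In the applications \<open>2 ^ e * l\<close> is m, not the exact order of w. As l is
  odd, w has 2-power order exactly when \<open>w ^ (2 ^ e) = 1\<close>, which is the case split of
  the determinant inequalities.\<close>

locale root_of_unity =
  fixes w :: complex and e l :: nat
  assumes root: "w ^ (2 ^ e * l) = 1" and odd_l: "odd l"
begin

abbreviation Z where "Z \<equiv> zring w"
abbreviation J where "J \<equiv> rad2 w"
abbreviation unit where "unit \<equiv> unit_mod w"
definition pair_sum where "pair_sum p = w ^ p + inverse w ^ p"

lemma order_pos: "2 ^ e * l > 0" using odd_l by (cases l) auto

lemma w_nonzero: "w \<noteq> 0" using root order_pos by (metis power_0_left zero_neq_one neq0_conv)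

lemma inverse_Z: "inverse w \<in> Z" using zring_inverse_self[OF root order_pos] .

lemma pair_sum_Z: "pair_sum p \<in> Z" unfolding pair_sum_def by (intro zring_intros inverse_Z)

lemma one_notin_J: "1 \<notin> J" using rad2_not_1[OF root order_pos] .

lemma unit_notin_J: "unit x \<Longrightarrow> x \<notin> J"
proof
  assume "unit x" "x \<in> J"
  then obtain K where K: "K \<in> Z" "K * x - 1 \<in> J" by (auto simp: unit_mod_def)
  have "K * x - (K * x - 1) \<in> J" using K \<open>x \<in> J\<close> rad2_diff rad2_mult by blast
  then show False using one_notin_J by simp
qed

lemma unit_nonzero: "unit x \<Longrightarrow> x \<noteq> 0"
  using unit_notin_J rad2_0 by blast

lemma w_l_cong: "1 + w ^ l \<in> J" "1 + inverse w ^ l \<in> J"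
proof -
  have "(w ^ l) ^ (2 ^ e) = 1" using root by (simp add: power_mult[symmetric] mult.commute)
  then have "(inverse w ^ l) ^ (2 ^ e) = 1" by (simp add: power_inverse)
  then show "1 + inverse w ^ l \<in> J" by (rule one_plus_two_power_rad2) (intro zring_intros inverse_Z)
  show "1 + w ^ l \<in> J" by (rule one_plus_two_power_rad2[OF \<open>(w ^ l) ^ (2 ^ e) = 1\<close>]) (intro zring_intros)
qed

lemma pair_sum_l_J: "pair_sum l \<in> J"
proof -
  have "(1 + w ^ l) + (1 + inverse w ^ l) - 2 \<in> J" by (intro rad2_add rad2_diff w_l_cong rad2_2)
  then show ?thesis by (simp add: pair_sum_def)
qed

text \<open>Raising to the power \<open>2 ^ e\<close> strips the 2-part: y = w^(u 2^e) has odd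
  order, and y is not 1 because u is prime to l. Hence 1 + y is a genuine unit, and it agrees with
  (1 + w^u)^(2^e) modulo 2.\<close>

lemma unit_one_plus:
  assumes "w ^ (2 ^ e) \<noteq> 1" "coprime u l"
  shows "unit (1 + w ^ u)"
proof -
  define y where "y = (w ^ u) ^ (2 ^ e)"
  have y: "y ^ l = 1"
    unfolding y_def using root by (metis mult.commute mult.left_commute power_mult power_one)
  have "y \<noteq> 1"
  proof
    assume *: "y = 1"
    define v where "v = w ^ (2 ^ e)"
    have v: "v ^ u = 1" "v ^ l = 1" using * root by (simp_all add: v_def y_def power_mult[symmetric] mult.commute)
    obtain a where a: "[u * a = 1] (mod l)" using cong_solve_coprime_nat[OF assms(2)] by auto
    have "v = v ^ (u * a)" using a v(2) by (metis cong_def power_mod_root power_one_right)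
    then show False using v(1) assms(1) by (simp add: power_mult v_def)
  qed
  then obtain K where K: "K \<in> zring y" "K * (1 + y) = 1" using one_plus_odd_order_unit[OF y odd_l] by blast
  have "y \<in> Z" unfolding y_def by (intro zring_intros)
  then have KZ: "K \<in> Z" using K zring_trans by blast
  obtain z where z: "z \<in> Z" "(1 + w ^ u) ^ (2 ^ e) = 1 + y + 2 * z"
    using frobenius_mod_2[of 1 w "w ^ u" e] by (auto simp: y_def intro: zring_intros)
  have "(K * (1 + w ^ u) ^ (2 ^ e - 1)) * (1 + w ^ u) = K * (1 + w ^ u) ^ (2 ^ e)"
    by (simp add: mult.assoc flip: power_Suc2)
  also have "\<dots> = 1 + (K * z) * 2" using K(2) by (simp add: z(2) algebra_simps)
  finally have "(K * (1 + w ^ u) ^ (2 ^ e - 1)) * (1 + w ^ u) - 1 \<in> J"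
    using KZ z(1) by (auto intro!: rad2_mult zring_intros rad2_2)
  moreover have "K * (1 + w ^ u) ^ (2 ^ e - 1) \<in> Z" using KZ by (intro zring_intros)
  ultimately show ?thesis unfolding unit_mod_def by (auto intro: zring_intros)
qed

lemma unit_inverse_power: "unit (inverse w ^ p)"
  unfolding unit_mod_def using w_nonzero
  by (auto intro!: zring_intros zring_power[OF inverse_Z] bexI[of _ "w ^ p"] simp del: power_inverse
      simp: rad2_0 power_mult_distrib[symmetric])

lemma unit_pair_sum:
  assumes "w ^ (2 ^ e) \<noteq> 1" "coprime (2 * p) l"
  shows "unit (pair_sum p)"
proof -
  have "pair_sum p = inverse w ^ p * (1 + w ^ (2 * p))"
    using w_nonzero by (simp add: pair_sum_def mult_2 power_add distrib_left mult.assoc[symmetric] power_mult_distrib[symmetric] del: power_inverse)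
  then show ?thesis using unit_mod_mult[OF unit_inverse_power unit_one_plus] assms by simp
qed

lemma unit_pair_sum_add:
  assumes "w ^ (2 ^ e) \<noteq> 1" "s \<le> r" "coprime (r + s) l" "coprime (r - s) l"
  shows "unit (pair_sum r + pair_sum s)"
  unfolding pair_sum_def pair_sum_factor[OF w_nonzero assms(2)]
  using assms by (intro unit_mod_mult unit_inverse_power unit_one_plus)

lemma pair_sum_J:
  assumes "w ^ (2 ^ e) = 1"
  shows "pair_sum p \<in> J"
proof -
  have "(w ^ p) ^ (2 ^ e) = 1" using assms by (metis mult.commute power_mult power_one)
  moreover have "(inverse w ^ p) ^ (2 ^ e) = 1" using calculation by (simp add: power_inverse)
  ultimately have "(1 + w ^ p) + (1 + inverse w ^ p) - 2 \<in> J"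
    by (intro rad2_add rad2_diff one_plus_two_power_rad2 rad2_2 zring_intros inverse_Z)
  then show ?thesis by (simp add: pair_sum_def)
qed

end

section \<open>Nonvanishing of the block determinants\<close>

context root_of_unity
begin

text \<open>If x = y or x = -y, then x + y is 2 y or 0, in either case an element of the
  radical.\<close>

lemma square_neq:
  assumes "y \<in> Z" "unit (x + y)"
  shows "x\<^sup>2 \<noteq> y\<^sup>2"
proof
  assume "x\<^sup>2 = y\<^sup>2"
  then have "x + y = 0 \<or> x + y = y * 2" by (auto simp: power2_eq_iff)
  then have "x + y \<in> J" using assms(1) rad2_0 rad2_mult rad2_2 by metis
  then show False using unit_notin_J assms(2) by blast
qed

lemma shifted_square_neq:
  assumes "c \<in> Z" "b \<in> Z" "unit (g + b)"
  shows "(c + g)\<^sup>2 \<noteq> (c + b)\<^sup>2"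
proof (rule square_neq)
  have "(c + g) + (c + b) - (g + b) = c * 2" by simp
  then have "(c + g) + (c + b) - (g + b) \<in> J" using assms(1) rad2_mult rad2_2 by metis
  then show "unit (c + g + (c + b))" by (rule unit_mod_cong[OF assms(3)])
qed (use assms in \<open>auto intro: zring_add\<close>)

text \<open>After expansion c^2 cancels, and every remaining term except b^2 has a factor 2, g or
  g'.\<close>

lemma disc_neq_unit:
  assumes "c \<in> Z" "b \<in> Z" "g \<in> J" "g' \<in> J" "unit b"
  shows "(c + g) * (c + g') \<noteq> (c + b)\<^sup>2"
proof
  assume eq: "(c + g) * (c + g') = (c + b)\<^sup>2"
  have "b * b = (c * g + c * g') + g' * g - (b * c) * 2"
    using eq by (simp add: power2_eq_square algebra_simps)
  also have "\<dots> \<in> J"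
    by (intro rad2_diff rad2_add rad2_mult assms rad2_2 zring_mult rad2_zring)
  finally show False using unit_notin_J[OF unit_mod_mult[OF assms(5,5)]] by blast
qed

lemma odd_factor:
  assumes "w ^ (2 ^ e) = 1" "odd s"
  shows "\<exists>K \<in> Z. 1 + w ^ s = (1 + w ^ l) * K"
  using one_plus_odd_powers_factor[OF assms odd_l] .

lemma one_plus_l_nonzero:
  assumes "w ^ (2 ^ e) = 1" "w \<noteq> -1"
  shows "1 + w ^ l \<noteq> 0"
  using odd_factor[OF assms(1), of 1] assms(2) by (auto simp: add_eq_0_iff)

lemma w_l_neq_one:
  assumes "w ^ (2 ^ e) = 1" "w \<noteq> 1"
  shows "w ^ l \<noteq> 1"
proof
  assume "w ^ l = 1"
  then show False using two_power_odd_exponent[of w e 1 l] assms odd_l by auto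
qed

text \<open>When \<open>w\<close> has order a power of 2 other than 1 and 2, the element \<open>1 + w ^ l\<close> is a
  uniformizer above 2, and \<open>H\<close> is the exact power of it dividing the block determinants below.\<close>

definition H where "H = (1 + w ^ l) * (1 + inverse w ^ l)"

lemma H_alt: "H = inverse w ^ l * (1 + w ^ l)\<^sup>2"
  using w_nonzero by (simp add: H_def power2_eq_square field_simps)

lemma H_nonzero: "w ^ (2 ^ e) = 1 \<Longrightarrow> w \<noteq> -1 \<Longrightarrow> H \<noteq> 0"
  using one_plus_l_nonzero w_nonzero by (simp add: H_alt)

lemma square_H: "(1 + w ^ l)\<^sup>2 = H * w ^ l"
  using w_nonzero by (simp add: H_alt field_simps)

lemma two_H_factor:
  assumes "w ^ (2 ^ e) = 1" "w \<noteq> 1" "w \<noteq> -1"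
  shows "\<exists>K \<in> Z. 2 = (1 + w ^ l)\<^sup>2 * K"
proof -
  have "(w ^ l) ^ (2 ^ e) = 1" using assms(1) by (metis mult.commute power_mult power_one)
  moreover have "w ^ l \<noteq> -1" using one_plus_l_nonzero assms by (metis add.right_inverse)
  ultimately obtain K where "K \<in> zring (w ^ l)" "2 = (1 + w ^ l)\<^sup>2 * K"
    using two_eq_square_factor[of "w ^ l" e] w_l_neq_one[OF assms(1,2)] by blast
  then show ?thesis using zring_trans[of K "w ^ l" w] by (blast intro: zring_intros)
qed

text \<open>Up to the unit 1/w, the pair sum is (1 + w)^2 - 2 w, and both terms are multiples of (1
  + w^l)^2.\<close>

lemma pair_sum_1_factor:
  assumes "w ^ (2 ^ e) = 1" "w \<noteq> 1" "w \<noteq> -1"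
  shows "\<exists>K \<in> Z. pair_sum 1 = H * K"
proof -
  obtain K1 where K1: "K1 \<in> Z" "1 + w = (1 + w ^ l) * K1" using odd_factor[OF assms(1), of 1] by auto
  obtain K2 where K2: "K2 \<in> Z" "2 = (1 + w ^ l)\<^sup>2 * K2" using two_H_factor[OF assms] by blast
  have "pair_sum 1 = inverse w * ((1 + w)\<^sup>2 - 2 * w)"
    using w_nonzero by (simp add: pair_sum_def power2_eq_square field_simps)
  also have "(1 + w)\<^sup>2 - 2 * w = (1 + w ^ l)\<^sup>2 * (K1\<^sup>2 - K2 * w)"
    by (simp only: K1(2) power_mult_distrib) (subst K2(2), simp add: algebra_simps)
  also have "\<dots> = H * (w ^ l * (K1\<^sup>2 - K2 * w))" by (simp add: square_H)
  finally have "pair_sum 1 = H * (inverse w * (w ^ l * (K1\<^sup>2 - K2 * w)))" by simp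
  then show ?thesis using K1 K2 by (blast intro: zring_intros inverse_Z)
qed

text \<open>The sum equals w^(-l-2) (1 + w^(l+2)) (w^2 + w^l), and w^2 + w^l = w^2 (1 + w^(l-2));
  both odd exponents give multiples of 1 + w^l. Unlike \<open>pair_sum_1_factor\<close> this
  includes w = 1, as required when the singular block sits at -1.\<close>

lemma pair_sum_2_l_factor:
  assumes "w ^ (2 ^ e) = 1"
  shows "\<exists>K \<in> Z. pair_sum 2 + pair_sum l = H * K"
proof -
  obtain K1 where K1: "K1 \<in> Z" "1 + w ^ (l + 2) = (1 + w ^ l) * K1" using odd_factor[OF assms, of "l + 2"] odd_l by auto
  \<comment> \<open>A natural number congruent to l - 2 modulo \<open>2 ^ e\<close>; the added term
    prevents truncation at l = 1.\<close>
  define s where "s = l + 2 ^ e * 2 - 2"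
  have "(1 :: nat) \<le> 2 ^ e" by simp
  then have s: "s + 2 = l + 2 ^ e * 2" unfolding s_def by linarith
  then have "odd (s + 2)" using odd_l by simp
  then have "odd s" by simp
  then obtain K2 where K2: "K2 \<in> Z" "1 + w ^ s = (1 + w ^ l) * K2" using odd_factor[OF assms] by blast
  have "w ^ (s + 2) = w ^ l" unfolding s by (simp add: power_add power_mult assms)
  then have "w\<^sup>2 + w ^ l = w\<^sup>2 * (1 + w ^ s)" by (simp add: power_add power2_eq_square algebra_simps)
  moreover have "pair_sum 2 + pair_sum l = inverse w ^ l * (inverse w ^ 2 * ((1 + w ^ (l + 2)) * (w\<^sup>2 + w ^ l)))"
    using w_nonzero by (simp add: pair_sum_def field_simps power_add power2_eq_square power4_eq_xxxx)
  ultimately have "pair_sum 2 + pair_sum l = inverse w ^ l * ((1 + w ^ (l + 2)) * (1 + w ^ s))"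
    using w_nonzero by (simp add: power_mult_distrib[symmetric])
  also have "\<dots> = H * (K1 * K2)" unfolding K1(2) K2(2) by (simp add: H_alt power2_eq_square)
  finally show ?thesis using K1 K2 by (blast intro: zring_intros)
qed

text \<open>The offsets 1 + w^l and 1 + w^(-l) have H both as product and as sum, so for 2-power
  order the two sides differ by H times 1 plus an element of the radical. At w = -1 the factor H is
  zero, hence the exclusion.\<close>

lemma disc_two_neq:
  assumes c: "c \<in> Z" and b: "b \<in> Z"
  assumes "w ^ (2 ^ e) \<noteq> 1 \<Longrightarrow> unit b"
  assumes "w ^ (2 ^ e) = 1 \<Longrightarrow> w \<noteq> -1 \<and> c \<in> J \<and> b \<in> J \<and> (\<exists>K \<in> Z. b = H * K)"
  shows "(c + (1 + w ^ l)) * (c + (1 + inverse w ^ l)) \<noteq> (c + b)\<^sup>2"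
proof (cases "w ^ (2 ^ e) = 1")
  case False
  then show ?thesis using assms w_l_cong by (intro disc_neq_unit) auto
next
  case True
  then obtain K where K: "K \<in> Z" "b = H * K" and cb: "w \<noteq> -1" "c \<in> J" "b \<in> J" using assms by blast
  have "(1 + w ^ l) + (1 + inverse w ^ l) = H"
    using w_nonzero by (simp add: H_def power_mult_distrib[symmetric] algebra_simps)
  then have "(c + (1 + w ^ l)) * (c + (1 + inverse w ^ l)) = c * c + c * H + H"
    by (simp add: H_def) (simp add: algebra_simps)
  then have eq: "(c + (1 + w ^ l)) * (c + (1 + inverse w ^ l)) - (c + b)\<^sup>2 = H * (1 + (c - K * (c * 2 + b)))"
    by (simp add: power2_eq_square algebra_simps) (simp add: K(2))
  have "c - K * (c * 2 + b) \<in> J"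
    by (intro rad2_diff rad2_mult rad2_add rad2_2 K cb c)
  then have "1 + (c - K * (c * 2 + b)) \<noteq> 0" using unit_nonzero[OF unit_mod_1_plus] by blast
  then show ?thesis using eq H_nonzero[OF True cb(1)] by auto
qed

text \<open>Counterpart for the offsets 0, l, -l, 3l of S against 1, -1 of R. For 2-power order the
  offsets g and g' are 1 + w^l and 1 + w^(-l), each times a unit modulo the radical, so g g' is H
  times such a unit, while g + g' and \<open>pair_sum 1\<close> are multiples of H.\<close>

lemma disc_four_neq:
  assumes c: "c \<in> Z" and "w \<noteq> 1" "w \<noteq> -1"
  assumes cJ: "w ^ (2 ^ e) = 1 \<Longrightarrow> c \<in> J"
  shows "(c + (1 + w ^ l + inverse w ^ l + w ^ (3 * l))) * (c + (1 + inverse w ^ l + w ^ l + inverse w ^ (3 * l)))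
         \<noteq> (c + pair_sum 1)\<^sup>2"
proof -
  define x y where "x = w ^ l" and "y = inverse w ^ l"
  have xy: "x \<in> Z" "y \<in> Z" unfolding x_def y_def by (intro zring_intros inverse_Z)+
  have xy1: "x * y = 1" using w_nonzero by (simp add: x_def y_def power_mult_distrib[symmetric])
  have J: "1 + x \<in> J" "1 + y \<in> J" using w_l_cong by (simp_all add: x_def y_def)
  have [simp]: "w ^ (3 * l) = x ^ 3" "inverse w ^ (3 * l) = y ^ 3"
    by (simp_all add: x_def y_def power_mult[symmetric] mult.commute)
  define g g' where "g = 1 + x + y + x ^ 3" and "g' = 1 + y + x + y ^ 3"
  show ?thesis
  proof (cases "w ^ (2 ^ e) = 1")
    case False
    \<comment> \<open>All four summands are 2-power roots of unity, hence congruent to 1; the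
      identities exhibit their sum as an element of the radical.\<close>
    have eq: "g = ((1 + x) + (1 + y)) + (1 + x) * (x\<^sup>2 - x + 1) - 2"
         "g' = ((1 + y) + (1 + x)) + (1 + y) * (y\<^sup>2 - y + 1) - 2"
      by (simp_all add: g_def g'_def power2_eq_square power3_eq_cube algebra_simps)
    have "g \<in> J"
      unfolding eq by (intro rad2_diff[OF rad2_add[OF rad2_add[OF J] rad2_mult'[OF J(1)]] rad2_2] zring_intros xy)
    moreover have "g' \<in> J"
      unfolding eq by (intro rad2_diff[OF rad2_add[OF rad2_add[OF J(2,1)] rad2_mult'[OF J(2)]] rad2_2] zring_intros xy)
    ultimately have "(c + g) * (c + g') \<noteq> (c + pair_sum 1)\<^sup>2"
      using False odd_l by (intro disc_neq_unit c pair_sum_Z unit_pair_sum) auto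
    then show ?thesis by (simp add: g_def g'_def flip: x_def y_def)
  next
    case True
    obtain K where K: "K \<in> Z" "pair_sum 1 = H * K" using pair_sum_1_factor[OF True] assms by blast
    obtain L where L: "L \<in> Z" "2 = (1 + x)\<^sup>2 * L" using two_H_factor[OF True] assms unfolding x_def by blast
    have two: "2 = H * (x * L)" using L(2) square_H by (simp add: x_def mult.assoc)
    \<comment> \<open>Take x g = (1 + x) + (1 + x)^2 x^2 - 2 x^3, substitute (1 + x)^2 L for 2 and
      divide by x (1 + x). The bracket is 1 plus a multiple of 1 + x, hence a unit modulo the
      radical. U' is the conjugate, rewritten with the same L.\<close>
    define U where "U = y * (1 + (1 + x) * (x\<^sup>2 - x ^ 3 * L))"
    define U' where "U' = x * (1 + (1 + y) * (y\<^sup>2 - y * L))"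
    have H: "H = (1 + x) * (1 + y)" by (simp add: H_def x_def y_def)
    have "(1 + x) * U = y * ((1 + x) + (1 + x)\<^sup>2 * x\<^sup>2 - (1 + x)\<^sup>2 * L * x ^ 3)"
      by (simp add: U_def power2_eq_square algebra_simps)
    also have "\<dots> = y * ((1 + x) + (1 + x)\<^sup>2 * x\<^sup>2 - 2 * x ^ 3)" by (simp add: L(2)[symmetric])
    also have "\<dots> = (x * y) * (x + x ^ 3) + y + (x * y)"
      by (simp add: power2_eq_square power3_eq_cube algebra_simps)
    also have "\<dots> = g" by (simp add: xy1 g_def)
    finally have gU: "g = (1 + x) * U" by simp
    have yx: "(1 + x)\<^sup>2 * y\<^sup>2 = (1 + y)\<^sup>2"
    proof -
      have "(1 + x)\<^sup>2 * y\<^sup>2 = (y + x * y)\<^sup>2" by (simp add: power2_eq_square algebra_simps)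
      then show ?thesis by (simp add: xy1 add.commute)
    qed
    have "(1 + y)\<^sup>2 * L = y\<^sup>2 * 2" using L(2) yx by (metis mult.assoc mult.commute)
    then have L': "(1 + y)\<^sup>2 * L = 2 * y\<^sup>2" by simp
    have "(1 + y) * U' = x * ((1 + y) + (1 + y)\<^sup>2 * y\<^sup>2 - (1 + y)\<^sup>2 * L * y)"
      by (simp add: U'_def power2_eq_square algebra_simps)
    also have "\<dots> = x * ((1 + y) + (1 + y)\<^sup>2 * y\<^sup>2 - 2 * y\<^sup>2 * y)" by (simp add: L')
    also have "\<dots> = (x * y) * (y + y ^ 3) + x + (x * y)"
      by (simp add: power2_eq_square power3_eq_cube algebra_simps)
    also have "\<dots> = g'" by (simp add: xy1 g'_def)
    finally have gU': "g' = (1 + y) * U'" by simp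
    have uy: "unit x" "unit y"
      using unit_inverse_power[of l] xy xy1
      by (auto simp: y_def[symmetric] unit_mod_def rad2_0 mult.commute intro!: bexI[of _ y])
    have UU: "unit (U * U')"
      unfolding U_def U'_def using J xy L(1)
      by (intro unit_mod_mult uy unit_mod_1_plus rad2_mult' zring_intros)
    have gg: "g + g' = 2 * (1 + x + y) + (x ^ 3 + y ^ 3)" by (simp add: g_def g'_def)
    \<comment> \<open>From x^3 + y^3 = y^3 (1 + x^2) (1 - x^2 + x^4) and 1 + x^2 = (1 + x)^2 - 2 x =
      H x (1 - L x).\<close>
    define N where "N = y ^ 3 * (x * (1 - L * x)) * (1 - x\<^sup>2 + x ^ 4)"
    have xy3: "x ^ 3 + y ^ 3 = H * N"
    proof -
      have "y ^ 3 * x ^ 6 = (x * y) ^ 3 * x ^ 3" by (simp add: power_mult_distrib algebra_simps flip: power_add)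
      then have "x ^ 3 + y ^ 3 = y ^ 3 * (1 + x ^ 6)" by (simp add: xy1 algebra_simps)
      also have "1 + x ^ 6 = (1 + x\<^sup>2) * (1 - x\<^sup>2 + x ^ 4)"
        by (simp add: algebra_simps flip: power_add)
      also have "1 + x\<^sup>2 = (1 + x)\<^sup>2 - 2 * x" by (simp add: power2_eq_square algebra_simps)
      also have "2 * x = (1 + x)\<^sup>2 * (L * x)" by (simp add: L(2)[symmetric] mult.assoc[symmetric])
      also have "(1 + x)\<^sup>2 - (1 + x)\<^sup>2 * (L * x) = (1 + x)\<^sup>2 * (1 - L * x)" by (simp add: algebra_simps)
      also have "(1 + x)\<^sup>2 = H * x" using square_H by (simp add: x_def)
      finally show ?thesis by (simp add: N_def)
    qed
    have "g + g' = H * (x * L * (1 + x + y) + N)"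
      unfolding gg xy3 by (subst two) (simp only: distrib_left mult.assoc)
    moreover have "x * L * (1 + x + y) + N \<in> Z" unfolding N_def by (intro zring_intros xy L(1))
    ultimately have ggM: "\<exists>M \<in> Z. g + g' = H * M" by blast
    then obtain M where M: "M \<in> Z" "g + g' = H * M" by blast
    have gg2: "g * g' = H * (U * U')" by (simp add: gU gU' H)
    have "(c + g) * (c + g') - (c + pair_sum 1)\<^sup>2 = c * (g + g') + g * g' - pair_sum 1 * (c * 2 + pair_sum 1)"
      by (simp add: power2_eq_square algebra_simps)
    also have "\<dots> = c * (H * M) + H * (U * U') - (H * K) * (c * 2 + pair_sum 1)"
      by (simp only: M(2) gg2 K(2)[symmetric])
    also have "\<dots> = H * (U * U' + (c * M - K * (c * 2 + pair_sum 1)))"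
      by (simp add: algebra_simps)
    finally have eq: "(c + g) * (c + g') - (c + pair_sum 1)\<^sup>2 = H * (U * U' + (c * M - K * (c * 2 + pair_sum 1)))" .
    have "c * M - K * (c * 2 + pair_sum 1) \<in> J"
      by (intro rad2_diff rad2_mult rad2_mult' rad2_add rad2_2 K M c cJ[OF True] pair_sum_J[OF True])
    then have "unit (U * U' + (c * M - K * (c * 2 + pair_sum 1)))" by (intro unit_mod_cong[OF UU]) simp
    then have "(c + g) * (c + g') - (c + pair_sum 1)\<^sup>2 \<noteq> 0"
      unfolding eq using H_nonzero[OF True assms(3)] unit_nonzero by simp
    then show ?thesis by (simp add: g_def g'_def flip: x_def y_def)
  qed
qed

end

section \<open>Connection sets with a single singular block\<close>

definition hat :: "nat set \<Rightarrow> complex \<Rightarrow> complex" where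
  "hat A w = (\<Sum>a\<in>A. w ^ a)"

text \<open>The last condition makes every block away from kappa invertible. At kappa, which is its
  own inverse, all four entries of the block equal \<open>hat R \<kappa>\<close>, and this being
  nonzero gives rank one. A real kappa yields a real kernel vector with entries 1 and -1. S needs no
  symmetry because reflections are involutions.\<close>

definition spectral_pair :: "nat \<Rightarrow> nat set \<Rightarrow> nat set \<Rightarrow> complex \<Rightarrow> bool" where
  "spectral_pair m R S \<kappa> \<longleftrightarrow> R \<subseteq> {0<..<m} \<and> (\<forall>r\<in>R. m - r \<in> R) \<and> S \<subseteq> {..<m} \<and>
     (\<kappa> = 1 \<or> \<kappa> = -1) \<and> \<kappa> ^ m = 1 \<and> hat R \<kappa> = hat S \<kappa> \<and> hat R \<kappa> \<noteq> 0 \<and>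
     (\<forall>w. w ^ m = 1 \<and> w \<noteq> \<kappa> \<longrightarrow> hat S w * hat S (inverse w) \<noteq> (hat R w)\<^sup>2)"

section \<open>Symmetric sets of residues and their character sums\<close>

definition half :: "nat \<Rightarrow> nat set" where
  "half m = {p. 0 < p \<and> 2 * p < m}"

text \<open>As \<open>half m\<close> omits the self-inverse residues 0 and m/2, P and its reflection
  are disjoint, and a self-inverse residue can be added separately when an odd size is
  wanted.\<close>

definition mirror :: "nat \<Rightarrow> nat set \<Rightarrow> nat set" where
  "mirror m P = P \<union> (\<lambda>p. m - p) ` P"

definition csum :: "nat set \<Rightarrow> complex \<Rightarrow> complex" where
  "csum P w = (\<Sum>p\<in>P. w ^ p + inverse w ^ p)"

lemma half_eq: "half m = {1..(m - 1) div 2}"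
  by (auto simp: half_def)

lemma finite_half [simp]: "finite (half m)"
  by (simp add: half_eq)

lemma finite_subset_half: "P \<subseteq> half m \<Longrightarrow> finite P"
  using finite_subset finite_half by blast

text \<open>Provides the shared part P of size q; F lists the residues reserved for the
  offsets.\<close>

lemma exists_subset_half:
  assumes "finite F" "q + card F \<le> (m - 1) div 2"
  obtains P where "P \<subseteq> half m" "P \<inter> F = {}" "card P = q"
proof -
  have "card (half m) - card F \<le> card (half m - F)" using assms(1) by (rule diff_card_le_card_Diff)
  then have "q \<le> card (half m - F)" using assms(2) by (simp add: half_eq)
  then obtain P where "P \<subseteq> half m - F" "card P = q" by (meson obtain_subset_with_card_n)
  then show ?thesis using that by blast
qed

lemma mirror_iff: "P \<subseteq> half m \<Longrightarrow> x \<in> mirror m P \<longleftrightarrow> x \<in> P \<or> (x < m \<and> m - x \<in> P)"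
  unfolding mirror_def half_def by (auto simp: image_iff) (metis diff_diff_cancel less_imp_le)

lemma mirror_subset: "P \<subseteq> half m \<Longrightarrow> mirror m P \<subseteq> {0<..<m}"
  unfolding mirror_def half_def by auto

lemma mirror_closed: "P \<subseteq> half m \<Longrightarrow> r \<in> mirror m P \<Longrightarrow> m - r \<in> mirror m P"
  by (auto simp: mirror_def half_def)

lemma mirror_half_notin: "P \<subseteq> half m \<Longrightarrow> 2 * x = m \<Longrightarrow> x \<notin> mirror m P"
  by (auto simp: mirror_iff half_def)

lemma mirror_disjoint:
  assumes "P \<subseteq> half m"
  shows "P \<inter> (\<lambda>p. m - p) ` P = {}"
proof -
  have "m - p \<notin> P" if "p \<in> P" for p
  proof
    assume "m - p \<in> P"
    then have "2 * p < m" "2 * (m - p) < m" using that assms by (auto simp: half_def subset_iff)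
    then show False by linarith
  qed
  then show ?thesis by auto
qed

lemma mirror_inj: "P \<subseteq> half m \<Longrightarrow> inj_on (\<lambda>p. m - p) P"
  by (auto simp: half_def inj_on_def subset_iff)

lemma finite_mirror: "P \<subseteq> half m \<Longrightarrow> finite (mirror m P)"
  using finite_subset_half by (auto simp: mirror_def)

lemma card_mirror:
  assumes "P \<subseteq> half m"
  shows "card (mirror m P) = 2 * card P"
  unfolding mirror_def using finite_subset_half[OF assms] mirror_disjoint[OF assms]
  by (simp add: card_Un_disjoint card_image mirror_inj[OF assms])

lemma hat_mirror:
  assumes "P \<subseteq> half m" "w ^ m = 1"
  shows "hat (mirror m P) w = csum P w"
proof -
  have "w ^ (m - p) = inverse w ^ p" if "p \<in> P" for p
  proof -
    have "m - p + p = m" using that assms(1) by (auto simp: half_def)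
    then have "w ^ (m - p) * w ^ p = 1" using assms(2) by (metis power_add)
    then show ?thesis by (metis inverse_unique mult.commute power_inverse)
  qed
  then show ?thesis
    unfolding mirror_def hat_def csum_def
    using finite_subset_half[OF assms(1)] mirror_disjoint[OF assms(1)]
    by (simp add: sum.union_disjoint sum.reindex[OF mirror_inj[OF assms(1)]] sum.distrib)
qed

lemma hat_Un: "finite A \<Longrightarrow> finite B \<Longrightarrow> A \<inter> B = {} \<Longrightarrow> hat (A \<union> B) w = hat A w + hat B w"
  by (simp add: hat_def sum.union_disjoint)

lemma hat_insert: "finite A \<Longrightarrow> x \<notin> A \<Longrightarrow> hat (insert x A) w = w ^ x + hat A w"
  by (simp add: hat_def)

lemma hat_one: "hat A 1 = of_nat (card A)"
  by (simp add: hat_def)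

lemma csum_insert: "P \<subseteq> half m \<Longrightarrow> p \<notin> P \<Longrightarrow> csum (insert p P) w = w ^ p + inverse w ^ p + csum P w"
  using finite_subset_half by (simp add: csum_def)

lemma csum_inverse: "csum P (inverse w) = csum P w"
  by (simp add: csum_def add.commute)

text \<open>Every pair contributes 2 or -2. So the value is not 0 if \<open>card P\<close> is odd
  and not 2 if \<open>card P\<close> is even, which secures \<open>hat R \<kappa> \<noteq> 0\<close>
  at kappa = -1.\<close>

lemma csum_minus_one: "finite P \<Longrightarrow> \<exists>s :: int. csum P (-1) = 2 * of_int s \<and> (even s \<longleftrightarrow> even (card P))"
proof (induction P rule: finite_induct)
  case empty
  then show ?case by (auto simp: csum_def intro!: exI[of _ 0])
next
  case (insert p P)
  then obtain s :: int where s: "csum P (-1) = 2 * of_int s" "even s \<longleftrightarrow> even (card P)" by blast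
  have "inverse (-1 :: complex) = -1" by simp
  then have "csum (insert p P) (-1) = 2 * of_int (s + (-1) ^ p)"
    using insert.hyps s(1) by (simp add: csum_def)
  moreover have "even (s + (-1) ^ p) \<longleftrightarrow> even (card (insert p P))" using insert.hyps s(2) by simp
  ultimately show ?case by blast
qed

context root_of_unity
begin

lemma csum_Z: "csum P w \<in> Z"
  unfolding csum_def by (intro zring_sum) (use pair_sum_Z in \<open>simp add: pair_sum_def\<close>)

lemma csum_J: "w ^ (2 ^ e) = 1 \<Longrightarrow> csum P w \<in> J"
  unfolding csum_def by (intro rad2_sum) (use pair_sum_J in \<open>simp add: pair_sum_def\<close>)

end

section \<open>Families of connection sets, by the power of 2 in m and the residue of k\<close>

lemma spectral_pair_oneI:
  assumes "odd l" "m = 2 ^ e * l"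
    "R \<subseteq> {0<..<m}" "\<And>r. r \<in> R \<Longrightarrow> m - r \<in> R" "S \<subseteq> {..<m}" "card R = card S" "R \<noteq> {}"
    "\<And>w. root_of_unity w e l \<Longrightarrow> w ^ m = 1 \<Longrightarrow> w \<noteq> 1 \<Longrightarrow> hat S w * hat S (inverse w) \<noteq> (hat R w)\<^sup>2"
  shows "spectral_pair m R S 1"
proof -
  have "finite R" using assms(3) finite_subset by blast
  then have "card R \<noteq> 0" using assms(7) by simp
  then show ?thesis using assms by (auto simp: spectral_pair_def hat_one root_of_unity_def)
qed

text \<open>Here S is symmetric too, so the determinant is a difference of squares. The exchanged
  pairs satisfy r + s = l - 2 and r - s = 1, both prime to l, so
  \<open>pair_sum r + pair_sum s\<close> is a unit unless w has 2-power order. With e at most 1 the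
  only such w other than 1 is -1. The bound on l makes s positive.\<close>

lemma spectral_pair_symmetric:
  assumes l: "odd l" "l \<ge> 5" and e: "e \<le> 1" and m: "m = 2 ^ e * l"
    and k: "k \<ge> 2" "k + 2 \<le> m" "odd k \<longleftrightarrow> e = 1"
  shows "\<exists>R S. spectral_pair m R S 1 \<and> card R = k \<and> card S = k"
proof -
  define r s where "r = (l - 1) div 2" and "s = (l - 3) div 2"
  have rs: "r = s + 1" "r + s = l - 2" "0 < s" "2 * r < l" using l by (auto simp: r_def s_def elim!: oddE)
  \<comment> \<open>For e = 1 the residue l is m/2, which supplies the odd cardinality.\<close>
  define M where "M = (if e = 1 then {l} else {})"
  have lm: "l \<le> m" using m by simp
  have em: "e = 0 \<and> m = l \<or> e = 1 \<and> m = 2 * l" using e m by (cases e) auto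
  have "(k - 2) div 2 + card {r, s} \<le> (m - 1) div 2"
  proof -
    have "2 * ((k - 2) div 2 + 2) + 1 \<le> m"
    proof (cases "e = 1")
      case True
      then obtain a where "k = 2 * a + 1" using k(3) by (auto elim: oddE)
      then have "(k - 2) div 2 = a - 1" "a \<ge> 1" using k(1) by auto
      then show ?thesis using k(2) \<open>k = 2 * a + 1\<close> by simp
    next
      case False
      then obtain a b where "k = 2 * a" "m = 2 * b + 1" using k(3) em l(1) by (auto elim!: oddE evenE)
      moreover have "a \<ge> 1" using \<open>k = 2 * a\<close> k(1) by auto
      moreover have "a + 1 \<le> b" using k(2) \<open>k = 2 * a\<close> \<open>m = 2 * b + 1\<close> by presburger
      ultimately show ?thesis by simp
    qed
    then have "(k - 2) div 2 + 2 \<le> (m - 1) div 2" by (simp add: less_eq_div_iff_mult_less_eq)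
    then show ?thesis using rs by simp
  qed
  then obtain P where P: "P \<subseteq> half m" "P \<inter> {r, s} = {}" "card P = (k - 2) div 2"
    using exists_subset_half[of "{r, s}"] by blast
  have rsm: "insert r P \<subseteq> half m" "insert s P \<subseteq> half m" using P rs lm by (auto simp: half_def)
  have fin: "finite P" "finite M" using P(1) finite_subset_half by (auto simp: M_def)
  have Mdisj: "M \<inter> mirror m Q = {}" if "Q \<subseteq> half m" for Q
    using mirror_half_notin[OF that] em by (auto simp: M_def)
  have Msub: "M \<subseteq> {0<..<m}" "\<And>r. r \<in> M \<Longrightarrow> m - r \<in> M" using em l by (auto simp: M_def)
  define R S where "R = M \<union> mirror m (insert r P)" and "S = M \<union> mirror m (insert s P)"
  have card: "card R = k" "card S = k"
  proof -
    have "card M + 2 * (card P + 1) = k" using P(3) k em by (auto simp: M_def elim!: oddE evenE)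
    then show "card R = k" "card S = k"
      using P rs fin rsm by (auto simp: R_def S_def card_Un_disjoint finite_mirror Mdisj card_mirror)
  qed
  have "spectral_pair m R S 1"
  proof (rule spectral_pair_oneI[OF l(1) m])
    show "R \<subseteq> {0<..<m}" "S \<subseteq> {..<m}"
      using Msub mirror_subset[OF rsm(1)] mirror_subset[OF rsm(2)] by (auto simp: R_def S_def)
    show "m - r \<in> R" if "r \<in> R" for r
      using that Msub mirror_closed[OF rsm(1)] by (auto simp: R_def)
    show "card R = card S" "R \<noteq> {}" using card k by auto
    fix w assume "root_of_unity w e l" and w: "w ^ m = 1" "w \<noteq> 1"
    then interpret root_of_unity w e l by simp
    define c where "c = hat M w + csum P w"
    have Minv: "hat M (inverse w) = hat M w"
    proof -
      have "inverse w ^ l = w ^ l" if "e = 1"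
      proof -
        have "w ^ l * w ^ l = 1" using w(1) em that by (simp add: mult_2 power_add)
        then show ?thesis by (metis inverse_unique power_inverse)
      qed
      then show ?thesis by (simp add: M_def hat_def)
    qed
    have w': "inverse w ^ m = 1" using w by (simp add: power_inverse)
    have hR: "hat R w = c + pair_sum r"
      using P rsm fin w by (simp add: R_def hat_Un finite_mirror Mdisj hat_mirror csum_insert[OF P(1)] c_def pair_sum_def)
    have hS: "hat S w = c + pair_sum s"
      using P rsm fin w by (simp add: S_def hat_Un finite_mirror Mdisj hat_mirror csum_insert[OF P(1)] c_def pair_sum_def)
    have hS': "hat S (inverse w) = c + pair_sum s"
      using P rsm fin w' by (simp add: S_def hat_Un finite_mirror Mdisj hat_mirror csum_insert[OF P(1)]
        c_def pair_sum_def Minv csum_inverse)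
    have cZ: "c \<in> Z" unfolding c_def hat_def by (intro zring_add csum_Z zring_sum zring_power zring_self)
    have "(c + pair_sum s)\<^sup>2 \<noteq> (c + pair_sum r)\<^sup>2"
    proof (cases "w ^ (2 ^ e) = 1")
      case False
      have "l - 2 + 2 = l" using l by simp
      have "odd (l - 2)" using l by presburger
      then have "gcd (l - 2) (l - 2 + 2) = 1" unfolding gcd_add2 by (simp flip: coprime_iff_gcd_eq_1)
      then have "coprime (l - 2) l" by (simp only: \<open>l - 2 + 2 = l\<close> coprime_iff_gcd_eq_1)
      then have "unit (pair_sum r + pair_sum s)" using False rs by (intro unit_pair_sum_add) auto
      then show ?thesis by (intro shifted_square_neq cZ pair_sum_Z) (simp add: add.commute)
    next
      case True
      then have "e = 1" using em w(2) by auto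
      \<comment> \<open>At -1 the terms of r and s are opposite, so the two squares differ by a
        nonzero multiple of c. Here c is -1 plus an element of the radical, hence nonzero.\<close>
      then have w1: "w = -1" using True w(2) by (simp add: power2_eq_1_iff)
      have ii: "inverse (-1 :: complex) = -1" by simp
      have "hat M w = -1" using \<open>e = 1\<close> l by (simp add: M_def hat_def w1)
      then have "c = csum P w - 1" by (simp add: c_def)
      then have "c \<noteq> 0" using csum_J[OF True, of P] one_notin_J by auto
      moreover have "pair_sum r = - pair_sum s" "pair_sum s \<noteq> 0" by (simp_all only: pair_sum_def) (simp_all add: w1 ii rs(1))
      ultimately show ?thesis by (auto simp: power2_eq_iff)
    qed
    then show "hat S w * hat S (inverse w) \<noteq> (hat R w)\<^sup>2" unfolding hR hS hS' by (simp add: power2_eq_square)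
  qed
  then show ?thesis using card by blast
qed

text \<open>R carries the offsets 1, -1 and S the offsets 0, l, and P must avoid both 1 and l. For e
  = 1 the residue l is m/2 and lies outside \<open>half m\<close> anyway; for larger e the stronger
  bound on k leaves room for two reserved residues.\<close>

lemma spectral_pair_even:
  assumes l: "odd l" and e: "e \<ge> 1" and m: "m = 2 ^ e * l"
    and k: "even k" "k \<ge> 2" "k + 2 \<le> m" "e = 1 \<or> k + 4 \<le> m"
  shows "\<exists>R S. spectral_pair m R S 1 \<and> card R = k \<and> card S = k"
proof -
  have em: "e = 1 \<and> m = 2 * l \<or> 4 * l \<le> m \<and> 4 dvd m"
  proof (cases "e = 1")
    case False
    then have "2 \<le> e" using e by simp
    then obtain i where "e = 2 + i" using le_Suc_ex by blast
    then show ?thesis by (simp add: m power_add)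
  qed (simp add: m)
  have evm: "even m" using e by (simp add: m)
  define F where "F = {1, l} \<inter> half m"
  have "(k - 2) div 2 + card F \<le> (m - 1) div 2"
  proof (cases "e = 1")
    case True
    then have "F \<subseteq> {1}" using em by (auto simp: F_def half_def m)
    then have "card F \<le> 1" using card_mono[of "{1}" F] by simp
    then show ?thesis using k evm by (auto elim!: evenE)
  next
    case False
    have "card F \<le> card {1, l}" unfolding F_def by (intro card_mono) auto
    also have "\<dots> \<le> 2" by (simp add: card_insert_if)
    finally show ?thesis using k evm False by (auto elim!: evenE)
  qed
  then obtain P where P: "P \<subseteq> half m" "P \<inter> F = {}" "card P = (k - 2) div 2"
    using exists_subset_half[of F] by (auto simp: F_def)
  have m4: "m \<ge> 4" using k by simp
  have lpos: "l > 0" using l by (cases l) auto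
  have l1: "1 \<in> half m" "1 \<notin> P" "l \<notin> P" using P m4 by (auto simp: F_def half_def)
  have "2 * l \<le> m" using em by auto
  then have lm: "l < m" "m - l \<notin> P" using lpos P by (auto simp: half_def)
  have rm: "insert 1 P \<subseteq> half m" using P l1 by auto
  have disj: "{0, l} \<inter> mirror m P = {}" using l1 lm P by (auto simp: mirror_iff half_def)
  have finP: "finite P" using P(1) finite_subset_half by blast
  define R S where "R = mirror m (insert 1 P)" and "S = {0, l} \<union> mirror m P"
  have card: "card R = k" "card S = k"
    using P k l1 finP rm disj lpos by (auto simp: R_def S_def card_mirror card_Un_disjoint finite_mirror elim!: evenE)
  have "spectral_pair m R S 1"
  proof (rule spectral_pair_oneI[OF l m])
    show "R \<subseteq> {0<..<m}" "S \<subseteq> {..<m}"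
      using mirror_subset[OF rm] mirror_subset[OF P(1)] lm m4 by (auto simp: R_def S_def)
    show "m - r \<in> R" if "r \<in> R" for r using that mirror_closed[OF rm] by (auto simp: R_def)
    show "card R = card S" "R \<noteq> {}" using card k by auto
    fix w assume "root_of_unity w e l" and w: "w ^ m = 1" "w \<noteq> 1"
    then interpret root_of_unity w e l by simp
    have w': "inverse w ^ m = 1" using w by (simp add: power_inverse)
    define c where "c = csum P w"
    have hR: "hat R w = c + pair_sum 1"
      using P rm w l1 by (simp add: R_def hat_mirror csum_insert[OF P(1)] c_def pair_sum_def)
    have hS: "hat S w = c + (1 + w ^ l)" "hat S (inverse w) = c + (1 + inverse w ^ l)"
      unfolding S_def using disj P w w' lpos
      by (simp_all add: hat_insert finite_mirror hat_mirror c_def csum_inverse)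
    have "(c + (1 + w ^ l)) * (c + (1 + inverse w ^ l)) \<noteq> (c + pair_sum 1)\<^sup>2"
    proof (cases "w = -1")
      case True
      \<comment> \<open>\<open>disc_two_neq\<close> excludes -1. There S contributes 1 + (-1)^l = 0
        and R contributes -2, so the claim compares c^2 with (c - 2)^2 and reduces to c being
        different from 1.\<close>
      then have "w ^ (2 ^ e) = 1" using e by simp
      then have "c \<noteq> 1" using csum_J[of P] one_notin_J unfolding c_def by auto
      moreover have "inverse (-1 :: complex) = -1" by simp
      moreover have "pair_sum 1 = -2" by (simp add: pair_sum_def) (simp add: True)
      ultimately show ?thesis using l True by (auto simp: power2_eq_square algebra_simps)
    next
      case False
      then show ?thesis
        using l w by (intro disc_two_neq) (auto simp: c_def csum_Z pair_sum_Z csum_J pair_sum_J intro!: unit_pair_sum pair_sum_1_factor[simplified])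
    qed
    then show "hat S w * hat S (inverse w) \<noteq> (hat R w)\<^sup>2" unfolding hR hS .
  qed
  then show ?thesis using card by blast
qed

text \<open>Settles k = m - 2 when 4 divides m. All residues together sum to 0 at w, so the sets act
  like minus their complements {0, m/2} and {0, 1}. Thus 2 + w + 1/w is compared with 4 or 0
  according to w^(m/2) = 1 or -1: the value 4 needs w = 1, and 0 needs w = -1, where w^(m/2) = 1
  because m/2 is even.\<close>

lemma spectral_pair_even_top:
  assumes m: "m = 2 ^ e * l" "odd l" "4 dvd m"
  shows "\<exists>R S. spectral_pair m R S 1 \<and> card R = m - 2 \<and> card S = m - 2"
proof -
  define h where "h = m div 2"
  have h: "m = 2 * h" "even h" using m(3) by (auto simp: h_def elim!: dvdE)
  have "m > 0" using m(1,2) by (cases l) auto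
  then have m4: "m \<ge> 4" using m(3) by (auto elim!: dvdE)
  define R S where "R = {0<..<m} - {h}" and "S = {2..<m}"
  have card: "card R = m - 2" "card S = m - 2" using h m4 by (auto simp: R_def S_def)
  have "spectral_pair m R S 1"
  proof (rule spectral_pair_oneI[OF m(2,1)])
    show "R \<subseteq> {0<..<m}" "S \<subseteq> {..<m}" by (auto simp: R_def S_def)
    show "m - r \<in> R" if "r \<in> R" for r using that h by (auto simp: R_def)
    show "card R = card S" "R \<noteq> {}" using card m4 by auto
    fix w assume "root_of_unity w e l" and w: "w ^ m = 1" "w \<noteq> 1"
    then interpret root_of_unity w e l by simp
    have all: "(\<Sum>i<m. v ^ i) = 0" if "v ^ m = 1" "v \<noteq> 1" for v :: complex
      using that by (simp add: geometric_sum)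
    have R: "{..<m} = insert 0 (insert h R)" "0 \<notin> insert h R" "h \<notin> R" "finite R"
      using h m4 by (auto simp: R_def)
    have S: "{..<m} = insert 0 (insert 1 S)" "0 \<notin> insert 1 S" "1 \<notin> S" "finite S"
      using m4 by (auto simp: S_def)
    have hR: "hat R w = - (1 + w ^ h)"
      using all[OF w] unfolding R(1) hat_def[symmetric] using R by (simp add: hat_def add_eq_0_iff algebra_simps)
    have hS: "hat S v = - (1 + v)" if "v ^ m = 1" "v \<noteq> 1" for v
      using all[OF that] unfolding S(1) using S by (simp add: hat_def add_eq_0_iff algebra_simps)
    have "(w ^ h)\<^sup>2 = 1" using w(1) h(1) by (simp add: power_mult[symmetric] mult.commute)
    then have hh: "w ^ h = 1 \<or> w ^ h = -1" by (simp add: power2_eq_1_iff)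
    have "(1 + w) * (1 + inverse w) \<noteq> (1 + w ^ h)\<^sup>2"
    proof
      assume *: "(1 + w) * (1 + inverse w) = (1 + w ^ h)\<^sup>2"
      show False
      proof (cases "w ^ h = 1")
        case True
        then have "(1 + w) * (w + 1) = 4 * w" using * w_nonzero by (simp add: field_simps)
        then have "(w - 1)\<^sup>2 = 0" by (simp add: power2_eq_square algebra_simps)
        then show False using w(2) by simp
      next
        case False
        then have "(1 + w) * (w + 1) = 0" using * hh w_nonzero by (simp add: field_simps)
        then have "w + 1 = 0" by (auto simp: add.commute)
        then have "w = -1" by (simp add: eq_neg_iff_add_eq_0)
        then show False using False h(2) by simp
      qed
    qed
    moreover have "inverse w ^ m = 1" "inverse w \<noteq> 1" using w by (auto simp: power_inverse)
    ultimately show "hat S w * hat S (inverse w) \<noteq> (hat R w)\<^sup>2"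
      unfolding hR hS[OF w] hS[OF \<open>inverse w ^ m = 1\<close> \<open>inverse w \<noteq> 1\<close>] by (simp add: minus_mult_minus power2_minus del: minus_add_distrib)
  qed
  then show ?thesis using card by blast
qed

text \<open>For l = 3 the construction of \<open>spectral_pair_symmetric\<close> would have s = 0,
  so m = 6, k = 3 is done by hand.\<close>

lemma spectral_pair_six: "spectral_pair 6 {1, 3, 5} {0, 1, 3} 1"
proof (rule spectral_pair_oneI[of 3 _ 1])
  fix w :: complex
  assume "root_of_unity w 1 3" and w: "w ^ 6 = 1" "w \<noteq> 1"
  then interpret root_of_unity w 1 3 by simp
  define v where "v = inverse w"
  have vw: "v * w = 1" using w_nonzero by (simp add: v_def)
  have v5: "w ^ 5 = v" unfolding v_def using inverse_root_of_unity[OF w(1)] by simp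
  have "(w ^ 3)\<^sup>2 = w ^ 6" by (simp flip: power_mult)
  then have w3: "w ^ 3 = 1 \<or> w ^ 3 = -1" using w(1) power2_eq_1_iff by metis
  then have v3: "v ^ 3 = w ^ 3" by (auto simp: v_def power_inverse)
  have hR: "hat {1, 3, 5} w = w + w ^ 3 + v" by (simp add: hat_def v5)
  have hS: "hat {0, 1, 3} w = 1 + w + w ^ 3" "hat {0, 1, 3} v = 1 + v + w ^ 3" by (simp_all add: hat_def v3)
  have "(1 + w + w ^ 3) * (1 + v + w ^ 3) \<noteq> (w + w ^ 3 + v)\<^sup>2"
  proof (cases "w ^ 3 = 1")
    case True
    have "(w - 1) * (w\<^sup>2 + w + 1) = 0" using True by (simp add: power2_eq_square power3_eq_cube algebra_simps)
    then have "w\<^sup>2 + w + 1 = 0" using w(2) by simp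
    moreover have "v * (w\<^sup>2 + w + 1) = (v * w) * w + v + v * w" by (simp add: power2_eq_square algebra_simps)
    ultimately have s: "w + v + 1 = 0" using vw by simp
    have "(2 + w) * (2 + v) = 2 * (w + v + 1) + 2 + v * w" by (simp add: algebra_simps)
    then have "(2 + w) * (2 + v) = 3" using s vw by simp
    moreover have "w + 1 + v = 0" using s by (simp add: algebra_simps)
    ultimately show ?thesis using True by simp
  next
    case False
    then have m1: "w ^ 3 = -1" using w3 by blast
    have "(w + 1) * (w\<^sup>2 - w + 1) = 0" using m1 by (simp add: power2_eq_square power3_eq_cube algebra_simps)
    then consider "w = -1" | "w\<^sup>2 - w + 1 = 0" by (metis mult_eq_0_iff eq_neg_iff_add_eq_0)
    then have "w + v = -2 \<or> w + v = 1"
    proof cases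
      case 1
      then show ?thesis by (simp add: v_def)
    next
      case 2
      then have "v * (w\<^sup>2 - w + 1) = 0" by simp
      moreover have "v * (w\<^sup>2 - w + 1) = (v * w) * w - v * w + v" by (simp add: power2_eq_square algebra_simps)
      ultimately show ?thesis using vw by (simp add: algebra_simps)
    qed
    then have "(w + v) - 1 = -3 \<or> (w + v) - 1 = 0" by (elim disjE) simp_all
    moreover have "w + w ^ 3 + v = (w + v) - 1" using m1 by simp
    ultimately have "w + w ^ 3 + v = -3 \<or> w + w ^ 3 + v = 0" by metis
    then have "(w + w ^ 3 + v)\<^sup>2 = 9 \<or> (w + w ^ 3 + v)\<^sup>2 = 0" by (elim disjE) simp_all
    moreover have "(1 + w + w ^ 3) * (1 + v + w ^ 3) = 1" using m1 vw by (simp add: mult.commute)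
    ultimately show ?thesis by auto
  qed
  then show "hat {0, 1, 3} w * hat {0, 1, 3} (inverse w) \<noteq> (hat {1, 3, 5} w)\<^sup>2"
    using hR hS by (simp add: v_def)
qed auto

text \<open>As k is odd and kappa = 1, R contains m/2 = 2l. Both sets are symmetric, so squares are
  compared; if w does not have 2-power order, the sum of the two bases is \<open>pair_sum 2\<close>
  modulo the radical, a unit. Otherwise w has order 2 or 4, and c in the radical rules out the
  critical values 1 and -1.\<close>

lemma spectral_pair_four_mod_eight:
  assumes l: "odd l" and m: "m = 4 * l" and k: "odd k" "k \<ge> 3" "k + 2 \<le> m"
  shows "\<exists>R S. spectral_pair m R S 1 \<and> card R = k \<and> card S = k"
proof -
  have l3: "l \<ge> 3" using l k m by (cases "l = 1") (auto elim!: oddE)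
  have "(k - 3) div 2 + card {2, l} \<le> (m - 1) div 2"
  proof -
    have "2 * ((k - 3) div 2) \<le> k - 3" by simp
    then have "(k - 3) div 2 + 2 \<le> (m - 1) div 2" using k by linarith
    moreover have "card {2, l} \<le> 2" by (simp add: card_insert_if)
    ultimately show ?thesis by linarith
  qed
  then obtain P where P: "P \<subseteq> half m" "P \<inter> {2, l} = {}" "card P = (k - 3) div 2"
    using exists_subset_half[of "{2, l}"] by blast
  have rsm: "insert 2 P \<subseteq> half m" "insert l P \<subseteq> half m" using P l3 m by (auto simp: half_def)
  have finP: "finite P" using P(1) finite_subset_half by blast
  have nin: "2 * l \<notin> mirror m (insert 2 P)" "0 \<notin> mirror m (insert l P)"
    using mirror_half_notin[OF rsm(1)] mirror_subset[OF rsm(2)] m by auto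
  define R S where "R = insert (2 * l) (mirror m (insert 2 P))" and "S = insert 0 (mirror m (insert l P))"
  have "2 * (card P + 1) + 1 = k" using P(3) k by (auto elim!: oddE)
  then have card: "card R = k" "card S = k"
    using P finP rsm nin by (auto simp: R_def S_def finite_mirror card_mirror)
  have em: "m = 2 ^ 2 * l" using m by simp
  have "spectral_pair m R S 1"
  proof (rule spectral_pair_oneI[OF l em])
    show "R \<subseteq> {0<..<m}" "S \<subseteq> {..<m}"
      using mirror_subset[OF rsm(1)] mirror_subset[OF rsm(2)] m l3 by (auto simp: R_def S_def)
    show "m - r \<in> R" if "r \<in> R" for r using that mirror_closed[OF rsm(1)] m by (auto simp: R_def)
    show "card R = card S" "R \<noteq> {}" using card k by auto
    fix w assume "root_of_unity w 2 l" and w: "w ^ m = 1" "w \<noteq> 1"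
    then interpret root_of_unity w 2 l by simp
    have w': "inverse w ^ m = 1" using w by (simp add: power_inverse)
    define c where "c = csum P w"
    define \<epsilon> where "\<epsilon> = w ^ (2 * l)"
    have hR: "hat R w = c + \<epsilon> + pair_sum 2"
      using P rsm nin finP w by (simp add: R_def hat_insert finite_mirror hat_mirror csum_insert[OF P(1)] c_def pair_sum_def \<epsilon>_def)
    have hS: "hat S w = c + 1 + pair_sum l" "hat S (inverse w) = c + 1 + pair_sum l"
      using P rsm nin finP w w'
      by (simp_all add: S_def hat_insert finite_mirror hat_mirror csum_insert[OF P(1)] c_def pair_sum_def csum_inverse)
    have cZ: "c \<in> Z" by (simp add: c_def csum_Z)
    have "(c + 1 + pair_sum l)\<^sup>2 \<noteq> (c + \<epsilon> + pair_sum 2)\<^sup>2"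
    proof (cases "w ^ (2 ^ 2) = 1")
      case False
      have "\<epsilon> ^ (2 ^ 2) = (w ^ m)\<^sup>2" by (simp add: \<epsilon>_def m power_mult[symmetric])
      then have eJ: "1 + \<epsilon> \<in> J" "\<epsilon> \<in> Z" unfolding \<epsilon>_def
        using w by (auto intro!: one_plus_two_power_rad2[of _ 2] zring_intros)
      have "(c + 1 + pair_sum l) + (c + \<epsilon> + pair_sum 2) - pair_sum 2 = c * 2 + (1 + \<epsilon>) + pair_sum l" by simp
      also have "\<dots> \<in> J" by (rule rad2_add[OF rad2_add[OF rad2_mult[OF cZ rad2_2] eJ(1)] pair_sum_l_J])
      finally have J: "(c + 1 + pair_sum l) + (c + \<epsilon> + pair_sum 2) - pair_sum 2 \<in> J" .
      have "coprime (2 ^ 2) l" using l by (subst coprime_power_left_iff) simp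
      then have "unit ((c + 1 + pair_sum l) + (c + \<epsilon> + pair_sum 2))"
        using False by (intro unit_mod_cong[OF unit_pair_sum[of 2] J]) auto
      then show ?thesis using cZ eJ by (intro square_neq) (auto intro!: zring_intros pair_sum_Z)
    next
      case True
      have cJ: "c \<in> J" using csum_J[OF True] by (simp add: c_def)
      then have c: "c \<noteq> 1" "c \<noteq> -1" using one_notin_J rad2_minus[OF cJ] by auto
      have "(w\<^sup>2)\<^sup>2 = w ^ (2 ^ 2)" by (simp flip: power_mult)
      then have "w\<^sup>2 = 1 \<or> w\<^sup>2 = -1" using True power2_eq_1_iff by metis
      then consider "w = -1" | "w\<^sup>2 = -1" using w(2) by (auto simp: power2_eq_1_iff)
      then show ?thesis
      proof cases
        case 1
        have "\<epsilon> = 1" using l by (simp add: \<epsilon>_def 1)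
        moreover have "pair_sum l = -2" "pair_sum 2 = 2" using l by (simp_all only: pair_sum_def) (simp_all add: 1)
        moreover have "(c + 1 + -2)\<^sup>2 - (c + 1 + 2)\<^sup>2 = - 8 * (c - -1)" by (simp add: power2_eq_square algebra_simps)
        moreover have "- 8 * (c - -1) \<noteq> 0" using c(2) by (simp only: mult_eq_0_iff right_minus_eq) simp
        ultimately show ?thesis by (metis right_minus_eq)
      next
        case 2
        then have "w * - w = 1" by (simp add: power2_eq_square)
        then have i: "inverse w = - w" by (rule inverse_unique)
        have "\<epsilon> = -1" using l by (simp add: \<epsilon>_def power_mult 2)
        moreover have "pair_sum l = 0" "pair_sum 2 = -2" using l by (simp_all add: pair_sum_def i 2)
        moreover have "(c + 1 + 0)\<^sup>2 - (c + -1 + -2)\<^sup>2 = 8 * (c - 1)" by (simp add: power2_eq_square algebra_simps)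
        moreover have "8 * (c - 1) \<noteq> 0" using c(1) by (simp only: mult_eq_0_iff right_minus_eq) simp
        ultimately show ?thesis by (metis right_minus_eq)
      qed
    qed
    then show "hat S w * hat S (inverse w) \<noteq> (hat R w)\<^sup>2" unfolding hR hS by (simp add: power2_eq_square)
  qed
  then show ?thesis using card by blast
qed

lemma spectral_pair_minus_oneI:
  assumes "odd l" "m = 2 ^ e * l" "e \<ge> 1"
    "R \<subseteq> {0<..<m}" "\<And>r. r \<in> R \<Longrightarrow> m - r \<in> R" "S \<subseteq> {..<m}"
    "hat R (-1) = hat S (-1)" "hat R (-1) \<noteq> 0"
    "\<And>w. root_of_unity w e l \<Longrightarrow> w ^ m = 1 \<Longrightarrow> w \<noteq> -1 \<Longrightarrow> hat S w * hat S (inverse w) \<noteq> (hat R w)\<^sup>2"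
  shows "spectral_pair m R S (-1)"
  using assms by (auto simp: spectral_pair_def root_of_unity_def)

text \<open>At -1 the offsets 2, -2, l, -l of R contribute 2 - 2 and the offsets 0, l of S
  contribute 1 - 1, so both sums reduce to \<open>csum P (-1)\<close>. It is nonzero since k mod 4 =
  1 makes \<open>card P\<close> odd.\<close>

lemma spectral_pair_one_mod_four:
  assumes l: "odd l" and m: "m = 2 ^ e * l" "e \<ge> 2" "m \<ge> 8" and k: "k mod 4 = 1" "k \<ge> 2" "k + 2 \<le> m"
  shows "\<exists>R S. spectral_pair m R S (-1) \<and> card R = k + 1 \<and> card S = k - 1"
proof -
  obtain i where "e = 2 + i" using m(2) le_Suc_ex by blast
  then have m4: "4 dvd m" "4 * l \<le> m" by (simp_all add: m(1) power_add)
  have lpos: "l > 0" using l by (cases l) auto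
  have "(k - 3) div 2 + card {2, l} \<le> (m - 1) div 2"
  proof -
    have "2 * ((k - 3) div 2) \<le> k - 3" by simp
    moreover have "k \<ge> 3" using k(1,2) by presburger
    ultimately have "(k - 3) div 2 + 2 \<le> (m - 1) div 2" using k(3) by linarith
    moreover have "card {2, l} \<le> 2" by (simp add: card_insert_if)
    ultimately show ?thesis by linarith
  qed
  then obtain P where P: "P \<subseteq> half m" "P \<inter> {2, l} = {}" "card P = (k - 3) div 2"
    using exists_subset_half[of "{2, l}"] by blast
  have "odd (card P)" using P(3) k by presburger
  have rsm: "insert 2 (insert l P) \<subseteq> half m" "insert l P \<subseteq> half m" using P lpos m(3) m4 by (auto simp: half_def)
  have finP: "finite P" using P(1) finite_subset_half by blast
  have "l \<notin> mirror m P" "0 \<notin> mirror m P"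
    using rsm P by (auto simp: mirror_iff half_def)
  note nin = this
  have l2: "l \<noteq> 2" using l by auto
  define R S where "R = mirror m (insert 2 (insert l P))" and "S = insert 0 (insert l (mirror m P))"
  have cR: "card R = k + 1" using P finP rsm l2 k by (auto simp: R_def card_mirror)presburger
  have cS: "card S = k - 1" using P finP nin lpos k by (auto simp: S_def card_mirror finite_mirror)presburger
  have hR: "hat R w = csum P w + ((w ^ 2 + inverse w ^ 2) + (w ^ l + inverse w ^ l))" if "w ^ m = 1" for w
    using P rsm l2 that by (simp add: R_def hat_mirror csum_insert[OF P(1)] csum_insert[OF rsm(2)])
  have hS: "hat S w = csum P w + (1 + w ^ l)" if "w ^ m = 1" for w
    using P nin lpos that by (simp add: S_def hat_insert finite_mirror hat_mirror)
  have "spectral_pair m R S (-1)"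
  proof (rule spectral_pair_minus_oneI[OF l m(1)])
    show "e \<ge> 1" using m(2) by simp
    show "R \<subseteq> {0<..<m}" "S \<subseteq> {..<m}"
      using mirror_subset[OF rsm(1)] mirror_subset[OF P(1)] rsm by (auto simp: R_def S_def half_def)
    show "m - r \<in> R" if "r \<in> R" for r using that mirror_closed[OF rsm(1)] by (auto simp: R_def)
    have mm: "(-1 :: complex) ^ m = 1" using m4 by (auto elim!: dvdE)
    have "inverse (-1 :: complex) = -1" by simp
    then have "hat R (-1) = csum P (-1)" "hat S (-1) = csum P (-1)" using l by (simp_all add: hR[OF mm] hS[OF mm])
    moreover obtain s :: int where "csum P (-1) = 2 * of_int s" "odd s"
      using csum_minus_one[OF finP] \<open>odd (card P)\<close> by blast
    ultimately show "hat R (-1) = hat S (-1)" "hat R (-1) \<noteq> 0" by auto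
    fix w assume "root_of_unity w e l" and w: "w ^ m = 1" "w \<noteq> -1"
    then interpret root_of_unity w e l by simp
    have w': "inverse w ^ m = 1" using w by (simp add: power_inverse)
    define c where "c = csum P w"
    have "(c + (1 + w ^ l)) * (c + (1 + inverse w ^ l)) \<noteq> (c + (pair_sum 2 + pair_sum l))\<^sup>2"
    proof (rule disc_two_neq)
      have "coprime (2 ^ 2) l" using l by (subst coprime_power_left_iff) simp
      then show "unit (pair_sum 2 + pair_sum l)" if "w ^ (2 ^ e) \<noteq> 1"
        using that by (intro unit_mod_cong[OF unit_pair_sum[of 2]]) (auto simp: pair_sum_l_J)
    qed (auto simp: c_def csum_Z pair_sum_Z csum_J pair_sum_J w intro: zring_add rad2_add pair_sum_2_l_factor)
    then show "hat S w * hat S (inverse w) \<noteq> (hat R w)\<^sup>2"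
      unfolding hR[OF w(1)] hS[OF w(1)] hS[OF w'] csum_inverse c_def pair_sum_def .
  qed
  then show ?thesis using cR cS by blast
qed

text \<open>For k mod 4 = 3 the sets of \<open>spectral_pair_one_mod_four\<close> would have even
  \<open>card P\<close>, and \<open>csum P (-1)\<close> could vanish. Here the offsets 1, -1 of R
  and 0, l, -l, 3l of S both contribute -2 at -1, and \<open>csum P (-1) - 2\<close> is nonzero for
  even \<open>card P\<close>. The residue 3l fits into \<open>half m\<close> because 8 divides
  m.\<close>

lemma spectral_pair_three_mod_four:
  assumes l: "odd l" and m: "m = 2 ^ e * l" "e \<ge> 3" and k: "k mod 4 = 3" "k + 2 \<le> m"
  shows "\<exists>R S. spectral_pair m R S (-1) \<and> card R = k - 1 \<and> card S = k + 1"
proof -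
  obtain i where "e = 3 + i" using m(2) le_Suc_ex by blast
  then have m8: "8 dvd m" "8 * l \<le> m" by (simp_all add: m(1) power_add)
  have lpos: "l > 0" using l by (cases l) auto
  define F where "F = {1, l, 3 * l}"
  have "(k - 3) div 2 + card F \<le> (m - 1) div 2"
  proof -
    have "k + 4 \<le> m" using m8(1) k by presburger
    moreover have "2 * ((k - 3) div 2) \<le> k - 3" by simp
    moreover have "k \<ge> 3" using k(1) by presburger
    ultimately have "(k - 3) div 2 + 3 \<le> (m - 1) div 2" by linarith
    moreover have "card F \<le> 3" by (simp add: card_insert_if F_def)
    ultimately show ?thesis by linarith
  qed
  then obtain P where P: "P \<subseteq> half m" "P \<inter> F = {}" "card P = (k - 3) div 2"
    using exists_subset_half[of F] by (auto simp: F_def)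
  have "even (card P)" using P(3) k by presburger
  have Fm: "F \<subseteq> half m" using m8 lpos by (auto simp: half_def F_def)
  then have rm: "insert 1 P \<subseteq> half m" using P by (auto simp: F_def)
  have finP: "finite P" using P(1) finite_subset_half by blast
  have nin: "0 \<notin> mirror m P" "l \<notin> mirror m P" "m - l \<notin> mirror m P" "3 * l \<notin> mirror m P"
    using Fm P m8 lpos by (auto simp: mirror_iff half_def F_def)
  have dist: "m - l \<noteq> 0" "m - l \<noteq> l" "m - l \<noteq> 3 * l" using m8 lpos by auto
  define R S where "R = mirror m (insert 1 P)" and "S = insert 0 (insert l (insert (m - l) (insert (3 * l) (mirror m P))))"
  have n1: "1 \<notin> P" using P by (auto simp: F_def)
  have q: "2 * ((k - 3) div 2) + 4 = k + 1" "2 * ((k - 3) div 2) + 2 = k - 1" using k by presburger+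
  have cR: "card R = k - 1" using P finP rm n1 q by (simp add: R_def card_mirror)
  have cS: "card S = k + 1" using P finP nin lpos dist q by (simp add: S_def card_mirror finite_mirror)
  have hR: "hat R w = csum P w + (w + inverse w)" if "w ^ m = 1" for w
    using P rm n1 that by (simp add: R_def hat_mirror csum_insert[OF P(1)])
  have hS: "hat S w = csum P w + (1 + w ^ l + inverse w ^ l + w ^ (3 * l))" if "w ^ m = 1" for w
  proof -
    have "m - l + l = m" using m8 lpos by simp
    then have "w ^ (m - l) * w ^ l = 1" using that by (metis power_add)
    then have "w ^ (m - l) = inverse w ^ l" by (metis inverse_unique mult.commute power_inverse)
    then show ?thesis using P nin lpos dist that
      by (simp add: S_def hat_insert finite_mirror hat_mirror)
  qed
  have "spectral_pair m R S (-1)"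
  proof (rule spectral_pair_minus_oneI[OF l m(1)])
    show "e \<ge> 1" using m(2) by simp
    show "R \<subseteq> {0<..<m}" "S \<subseteq> {..<m}"
      using mirror_subset[OF rm] mirror_subset[OF P(1)] m8 lpos by (auto simp: R_def S_def half_def)
    show "m - r \<in> R" if "r \<in> R" for r using that mirror_closed[OF rm] by (auto simp: R_def)
    have mm: "(-1 :: complex) ^ m = 1" using m8 by (auto elim!: dvdE)
    have "inverse (-1 :: complex) = -1" by simp
    then have "hat R (-1) = csum P (-1) - 2" "hat S (-1) = csum P (-1) - 2" using l by (simp_all add: hR[OF mm] hS[OF mm])
    moreover obtain s :: int where s: "csum P (-1) = 2 * of_int s" "even s"
      using csum_minus_one[OF finP] \<open>even (card P)\<close> by blast
    moreover have "(2 :: complex) * of_int s - 2 = of_int (2 * (s - 1))" by simp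
    moreover have "2 * (s - 1) \<noteq> 0" using s(2) by auto
    ultimately show "hat R (-1) = hat S (-1)" "hat R (-1) \<noteq> 0" by (simp_all only: of_int_eq_0_iff not_False_eq_True)
    fix w assume "root_of_unity w e l" and w: "w ^ m = 1" "w \<noteq> -1"
    then interpret root_of_unity w e l by simp
    have w': "inverse w ^ m = 1" using w by (simp add: power_inverse)
    show "hat S w * hat S (inverse w) \<noteq> (hat R w)\<^sup>2"
    proof (cases "w = 1")
      case True
      \<comment> \<open>\<open>disc_four_neq\<close> does not cover w = 1; there the hats are the
        sizes k - 1 and k + 1, whose squares differ.\<close>
      have "hat R 1 = of_nat (k - 1)" "hat S 1 = of_nat (k + 1)" by (simp_all only: hat_one cR cS)
      moreover have "(k + 1) * (k + 1) \<noteq> (k - 1)\<^sup>2" using k by (auto simp: power2_eq_square algebra_simps)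
      ultimately show ?thesis by (simp add: True flip: of_nat_mult of_nat_power del: of_nat_add of_nat_Suc)
    next
      case False
      have "hat R w = csum P w + pair_sum 1" unfolding hR[OF w(1)] by (simp add: pair_sum_def)
      moreover have "hat S (inverse w) = csum P w + (1 + inverse w ^ l + w ^ l + inverse w ^ (3 * l))"
        unfolding hS[OF w'] by (simp add: csum_inverse)
      ultimately show ?thesis using disc_four_neq[OF csum_Z False w(2) csum_J] hS[OF w(1)] by simp
    qed
  qed
  then show ?thesis using cR cS by blast
qed

theorem exists_spectral_pair:
  assumes k: "k \<ge> 2" "k + 2 \<le> m" "odd k \<Longrightarrow> even m"
  shows "\<exists>R S \<kappa>. spectral_pair m R S \<kappa> \<and> card R + card S = 2 * k"
proof -
  have "m \<noteq> 0" using k by simp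
  then obtain e l where m: "m = 2 ^ e * l" and l: "odd l"
    using multiplicity_decompose'[of m "2 :: nat"] by (metis mult.commute odd_one)
  have l1: "l \<ge> 1" using l by (cases l) auto
  have *: "?thesis" if "\<exists>R S. spectral_pair m R S 1 \<and> card R = k \<and> card S = k"
    using that by (metis mult_2)
  \<comment> \<open>Odd k forces e >= 1. Then e = 1 needs l >= 5 for the symmetric construction, e =
    2 still allows kappa = 1, and from e = 3 on the residue of k modulo 4 selects the sets with
    kappa = -1. For even k only k = m - 2 with 4 dividing m is set apart.\<close>
  consider "e = 0" | "e = 1" "even k" | "e \<ge> 2" "even k" "k + 4 \<le> m" | "e \<ge> 2" "even k" "m < k + 4"
    | "e = 1" "odd k" "l \<ge> 5" | "e = 1" "odd k" "l < 5" | "e = 2" "odd k" | "e \<ge> 3" "k mod 4 = 1" | "e \<ge> 3" "k mod 4 = 3"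
  proof -
    show ?thesis
    proof (cases "even k")
      case True
      have "e = 0 \<or> e = 1 \<or> e \<ge> 2" by linarith
      then show ?thesis using that(1-4) True by (cases "k + 4 \<le> m") auto
    next
      case False
      then have "k mod 4 = 1 \<or> k mod 4 = 3" by presburger
      moreover have "e = 0 \<or> e = 1 \<or> e = 2 \<or> e \<ge> 3" by linarith
      ultimately show ?thesis using that(1,5-9) False by (cases "l \<ge> 5") auto
    qed
  qed
  then show ?thesis
  proof cases
    case 1
    then have "even k" using k(3) m l by auto
    moreover have "l \<ge> 5" using 1 m k l by (cases "l = 4") auto
    ultimately show ?thesis using 1 l m k by (intro * spectral_pair_symmetric[of l e]) auto
  next
    case 2
    then show ?thesis using l m k by (intro * spectral_pair_even[of l e]) auto
  next
    case 3
    then show ?thesis using l m k by (intro * spectral_pair_even[of l e]) auto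
  next
    case 4
    then obtain i where "e = 2 + i" using le_Suc_ex by blast
    then have "4 dvd m" by (simp add: m power_add)
    then have "m - 2 = k" using 4 k by presburger
    then show ?thesis using * spectral_pair_even_top[OF m l \<open>4 dvd m\<close>] by simp
  next
    case 5
    then show ?thesis using l m k by (intro * spectral_pair_symmetric[of l e]) auto
  next
    case 6
    then have "m = 2 * l" using m by simp
    \<comment> \<open>l = 1 would give m = 2, too small for k; for l = 3 an odd k between 2 and 4 is
      3.\<close>
    with 6 have "l = 3" "k = 3" using l k l1 by presburger+
    then have "m = 6" using m 6 by simp
    have "card {1, 3, 5 :: nat} = k" "card {0, 1, 3 :: nat} = k" using \<open>k = 3\<close> by simp_all
    then show ?thesis using * spectral_pair_six \<open>m = 6\<close> by blast
  next
    case 7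
    have "k \<ge> 3" using 7 k by (cases "k = 2") auto
    with 7 show ?thesis using l m k by (intro * spectral_pair_four_mod_eight[of l]) auto
  next
    case 8
    have "(8 :: nat) \<le> 2 ^ e" using 8 power_increasing[of 3 e "2 :: nat"] by simp
    then have "m \<ge> 8" using l1 m mult_le_mono[of 8 "2 ^ e" 1 l] by simp
    then have "\<exists>R S. spectral_pair m R S (-1) \<and> card R = k + 1 \<and> card S = k - 1"
      using 8 k by (intro spectral_pair_one_mod_four[OF l m]) auto
    then obtain R S where "spectral_pair m R S (-1)" "card R = k + 1" "card S = k - 1" by blast
    then show ?thesis using k by (intro exI[of _ R] exI[of _ S] exI[of _ "-1"]) simp
  next
    case 9
    then have "\<exists>R S. spectral_pair m R S (-1) \<and> card R = k - 1 \<and> card S = k + 1"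
      using k by (intro spectral_pair_three_mod_four[OF l m]) auto
    then obtain R S where "spectral_pair m R S (-1)" "card R = k - 1" "card S = k + 1" by blast
    then show ?thesis using k by (intro exI[of _ R] exI[of _ S] exI[of _ "-1"]) simp
  qed
qed

section \<open>Simple zero eigenvalues of symmetric matrices\<close>

lemma sum_insert_index:
  fixes f :: "nat \<Rightarrow> 'a :: comm_monoid_add"
  assumes "i < Suc n"
  shows "(\<Sum>k<Suc n. f k) = f i + (\<Sum>b<n. f (insert_index i b))"
proof -
  have "(\<Sum>k<Suc n. f k) = f i + (\<Sum>k\<in>{0..<Suc n} - {i}. f k)"
    unfolding lessThan_atLeast0 using assms
    by (simp add: sum.remove[of "{0..<Suc n}" i] del: sum.op_ivl_Suc)
  also have "(\<Sum>k\<in>{0..<Suc n} - {i}. f k) = (\<Sum>b<n. f (insert_index i b))"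
    by (simp add: insert_index_image[OF assms, symmetric] sum.reindex insert_index_inj_on lessThan_atLeast0)
  finally show ?thesis .
qed

lemma mult_mat_vec_index:
  "A \<in> carrier_mat n n \<Longrightarrow> y \<in> carrier_vec n \<Longrightarrow> i < n \<Longrightarrow> (A *\<^sub>v y) $ i = (\<Sum>j<n. A $$ (i, j) * y $ j)"
  by (simp add: scalar_prod_def lessThan_atLeast0)

text \<open>The deleted column only meets the zero entry of y, so erasing it loses nothing.\<close>

lemma mat_delete_mult_vec:
  fixes A :: "'a :: comm_ring_1 mat"
  assumes A: "A \<in> carrier_mat (Suc n) (Suc n)" and y: "y \<in> carrier_vec (Suc n)" "y $ i = 0"
    and z: "z \<in> carrier_vec n" "\<And>b. b < n \<Longrightarrow> z $ b = y $ insert_index i b"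
    and i: "i < Suc n" and a: "a < n"
  shows "(mat_delete A i i *\<^sub>v z) $ a = (A *\<^sub>v y) $ insert_index i a"
proof -
  have ia: "insert_index i a < Suc n" using a by (simp add: insert_index_def)
  have M: "mat_delete A i i \<in> carrier_mat n n" using mat_delete_carrier[OF A, of i i] by simp
  have "(mat_delete A i i *\<^sub>v z) $ a = (\<Sum>b<n. A $$ (insert_index i a, insert_index i b) * y $ insert_index i b)"
    unfolding mult_mat_vec_index[OF M z(1) a]
    using A a z(2) by (intro sum.cong refl) (simp add: mat_delete_def insert_index_def)
  also have "\<dots> = (A *\<^sub>v y) $ insert_index i a"
    unfolding mult_mat_vec_index[OF A y(1) ia] sum_insert_index[OF i] by (simp add: y(2))
  finally show ?thesis .
qed

lemma poly_char_poly_zero: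
  fixes M :: "'a :: field mat"
  assumes M: "M \<in> carrier_mat n n"
  shows "poly (char_poly M) 0 = (-1) ^ n * det M"
proof -
  have "- char_matrix M 0 = (-1) \<cdot>\<^sub>m M"
    using M by (intro eq_matI) (auto simp: char_matrix_def)
  then show ?thesis using M by (simp add: char_poly_matrix[OF M] det_smult)
qed

locale symmetric_kernel =
  fixes A :: "real mat" and n :: nat and x :: "real vec"
  assumes A: "A \<in> carrier_mat (Suc n) (Suc n)"
    and sym: "\<And>i j. i < Suc n \<Longrightarrow> j < Suc n \<Longrightarrow> A $$ (i, j) = A $$ (j, i)"
    and x: "x \<in> carrier_vec (Suc n)" "A *\<^sub>v x = 0\<^sub>v (Suc n)" "\<And>i. i < Suc n \<Longrightarrow> x $ i \<noteq> 0"
begin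

text \<open>A null vector of the minor is extended by 0 at i, and restriction goes back. Only the
  equation of the deleted row is not automatic.\<close>

lemma det_minor_zero_iff:
  assumes i: "i < Suc n"
  shows "det (mat_delete A i i) = 0 \<longleftrightarrow>
    (\<exists>y \<in> carrier_vec (Suc n). y \<noteq> 0\<^sub>v (Suc n) \<and> y $ i = 0 \<and> A *\<^sub>v y = 0\<^sub>v (Suc n))"
proof -
  have M: "mat_delete A i i \<in> carrier_mat n n" using mat_delete_carrier[OF A, of i i] by simp
  show ?thesis unfolding det_0_iff_vec_prod_zero[OF M]
  proof
    assume "\<exists>v. v \<in> carrier_vec n \<and> v \<noteq> 0\<^sub>v n \<and> mat_delete A i i *\<^sub>v v = 0\<^sub>v n"
    then obtain z where z: "z \<in> carrier_vec n" "z \<noteq> 0\<^sub>v n" "mat_delete A i i *\<^sub>v z = 0\<^sub>v n" by blast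
    define y where "y = vec (Suc n) (\<lambda>j. if j = i then 0 else z $ delete_index i j)"
    have y: "y \<in> carrier_vec (Suc n)" "y $ i = 0" using i by (auto simp: y_def)
    have zy: "z $ b = y $ insert_index i b" if "b < n" for b
    proof -
      have "insert_index i b < Suc n" using that by (simp add: insert_index_def)
      then show ?thesis by (simp add: y_def)
    qed
    have off: "(A *\<^sub>v y) $ j = 0" if "j < Suc n" "j \<noteq> i" for j
    proof -
      have "j \<in> insert_index i ` {0..<n}" using that by (simp add: insert_index_image[OF i])
      then obtain a where a: "a < n" "j = insert_index i a" by auto
      then show ?thesis using mat_delete_mult_vec[OF A y z(1) zy i a(1)] z(3) by simp
    qed
    text \<open>Symmetry forces the deleted row to vanish too: pair it with the kernel vector \<open>x\<close>.\<close>
    have "(\<Sum>j<Suc n. x $ j * (A *\<^sub>v y) $ j) = (\<Sum>j<Suc n. \<Sum>k<Suc n. x $ j * (A $$ (j, k) * y $ k))"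
      by (intro sum.cong refl) (simp add: mult_mat_vec_index[OF A y(1)] sum_distrib_left del: sum.lessThan_Suc)
    also have "\<dots> = (\<Sum>k<Suc n. \<Sum>j<Suc n. x $ j * (A $$ (j, k) * y $ k))" by (rule sum.swap)
    also have "\<dots> = (\<Sum>k<Suc n. y $ k * (A *\<^sub>v x) $ k)"
      by (intro sum.cong refl) (auto simp: mult_mat_vec_index[OF A x(1)] sum_distrib_left sym mult_ac
        simp del: sum.lessThan_Suc intro!: sum.cong)
    also have "\<dots> = 0" by (simp add: x(2) del: sum.lessThan_Suc)
    finally have "(\<Sum>j<Suc n. x $ j * (A *\<^sub>v y) $ j) = 0" .
    moreover have "(\<Sum>j<Suc n. x $ j * (A *\<^sub>v y) $ j) = x $ i * (A *\<^sub>v y) $ i"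
      using off i by (subst sum.remove[of _ i]) (auto simp del: sum.lessThan_Suc)
    ultimately have "(A *\<^sub>v y) $ i = 0" using x(3)[OF i] by simp
    then have "(A *\<^sub>v y) $ j = 0" if "j < Suc n" for j using off that by (cases "j = i") auto
    then have Ay: "A *\<^sub>v y = 0\<^sub>v (Suc n)" using A by (intro eq_vecI) auto
    have "y \<noteq> 0\<^sub>v (Suc n)"
    proof
      assume "y = 0\<^sub>v (Suc n)"
      then have "z = 0\<^sub>v n" using z(1) zy by (intro eq_vecI) (auto simp: insert_index_def)
      then show False using z(2) by blast
    qed
    then show "\<exists>y \<in> carrier_vec (Suc n). y \<noteq> 0\<^sub>v (Suc n) \<and> y $ i = 0 \<and> A *\<^sub>v y = 0\<^sub>v (Suc n)"
      using y Ay by blast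
  next
    assume "\<exists>y \<in> carrier_vec (Suc n). y \<noteq> 0\<^sub>v (Suc n) \<and> y $ i = 0 \<and> A *\<^sub>v y = 0\<^sub>v (Suc n)"
    then obtain y where y: "y \<in> carrier_vec (Suc n)" "y \<noteq> 0\<^sub>v (Suc n)" "y $ i = 0" "A *\<^sub>v y = 0\<^sub>v (Suc n)" by blast
    define z where "z = vec n (\<lambda>b. y $ insert_index i b)"
    have z: "z \<in> carrier_vec n" "\<And>b. b < n \<Longrightarrow> z $ b = y $ insert_index i b" by (auto simp: z_def)
    have "mat_delete A i i *\<^sub>v z = 0\<^sub>v n"
      using M mat_delete_mult_vec[OF A y(1,3) z i] y(4)
      by (intro eq_vecI) (auto simp: insert_index_def)
    moreover have "z \<noteq> 0\<^sub>v n"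
    proof
      assume z0: "z = 0\<^sub>v n"
      have "y = 0\<^sub>v (Suc n)"
      proof (rule eq_vecI)
        fix j assume "j < dim_vec (0\<^sub>v (Suc n))"
        then have j: "j < Suc n" by simp
        show "y $ j = 0\<^sub>v (Suc n) $ j"
        proof (cases "j = i")
          case False
          then have "j \<in> insert_index i ` {0..<n}" using j by (simp add: insert_index_image[OF i])
          then obtain a where "a < n" "j = insert_index i a" by auto
          then show ?thesis using z(2)[of a] z0 j by simp
        qed (use y j in auto)
      qed (use y in auto)
      then show False using y(2) by blast
    qed
    ultimately show "\<exists>v. v \<in> carrier_vec n \<and> v \<noteq> 0\<^sub>v n \<and> mat_delete A i i *\<^sub>v v = 0\<^sub>v n" using z(1) by blast
  qed
qed

text \<open>The derivative of the characteristic polynomial at 0 is, up to sign, the sum of the principal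
  minors. If the kernel is a line, the adjugate is a nonzero multiple of \<open>x x\<^sup>T\<close>, so these minors
  all have the same sign and cannot cancel.\<close>

lemma order_eq_one_iff_sum_minors:
  "Polynomial.order 0 (char_poly A) = 1 \<longleftrightarrow> (\<Sum>i<Suc n. det (mat_delete A i i)) \<noteq> 0"
proof -
  define p where "p = char_poly A"
  have deg: "degree p = Suc n" "p \<noteq> 0" using degree_monic_char_poly[OF A] by (auto simp: p_def)
  have "eigenvalue A 0" unfolding eigenvalue_def eigenvector_def
    using A x by (intro exI[of _ x]) (auto, metis index_zero_vec(1) zero_less_Suc)
  then have p0: "poly p 0 = 0" using eigenvalue_root_char_poly[OF A] by (simp add: p_def)
  have pd: "pderiv p \<noteq> 0" using deg by (simp add: pderiv_eq_0_iff)
  have minor: "poly (char_poly (mat_delete A i i)) 0 = (-1) ^ n * det (mat_delete A i i)" for i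
    using poly_char_poly_zero mat_delete_carrier[OF A, of i i] by simp
  have "Polynomial.order 0 p = Suc (Polynomial.order 0 (pderiv p))" by (rule order_pderiv[OF deg(2) p0])
  then have "Polynomial.order 0 p = 1 \<longleftrightarrow> poly (pderiv p) 0 \<noteq> 0" using pd by (simp add: order_root)
  also have "poly (pderiv p) 0 = (\<Sum>i<Suc n. (-1) ^ n * det (mat_delete A i i))"
    unfolding p_def pderiv_char_poly[OF A] poly_sum minor ..
  also have "\<dots> = (-1) ^ n * (\<Sum>i<Suc n. det (mat_delete A i i))" by (simp only: sum_distrib_left)
  finally show ?thesis unfolding p_def by simp
qed

text \<open>Algebraic and geometric multiplicity are compared through minors, without
  diagonalization. If the kernel contains a second direction y, then y - c x can be made to vanish
  at any given i, so every principal minor is 0.\<close>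

lemma order_eq_one_iff:
  "Polynomial.order 0 (char_poly A) = 1 \<longleftrightarrow>
    (\<forall>y \<in> carrier_vec (Suc n). A *\<^sub>v y = 0\<^sub>v (Suc n) \<longrightarrow> (\<exists>c. y = c \<cdot>\<^sub>v x))"
proof
  assume ord: "Polynomial.order 0 (char_poly A) = 1"
  show "\<forall>y \<in> carrier_vec (Suc n). A *\<^sub>v y = 0\<^sub>v (Suc n) \<longrightarrow> (\<exists>c. y = c \<cdot>\<^sub>v x)"
  proof (intro ballI impI, rule ccontr)
    fix y assume y: "y \<in> carrier_vec (Suc n)" "A *\<^sub>v y = 0\<^sub>v (Suc n)" "\<nexists>c. y = c \<cdot>\<^sub>v x"
    have "det (mat_delete A i i) = 0" if i: "i < Suc n" for i
    proof -
      define c where "c = y $ i / x $ i"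
      define z where "z = y + (- c) \<cdot>\<^sub>v x"
      have z: "z \<in> carrier_vec (Suc n)" using x y by (simp add: z_def)
      moreover have "z $ i = 0" using x y i by (simp add: z_def c_def)
      moreover have "A *\<^sub>v z = 0\<^sub>v (Suc n)"
        unfolding z_def using A x y by (simp add: mult_add_distrib_mat_vec[OF A] mult_mat_vec[OF A x(1)]) auto
      moreover have "z \<noteq> 0\<^sub>v (Suc n)"
      proof
        assume "z = 0\<^sub>v (Suc n)"
        then have "z $ j = 0" if "j < Suc n" for j using that by simp
        then have "y = c \<cdot>\<^sub>v x" using x y by (intro eq_vecI) (auto simp: z_def)
        then show False using y(3) by blast
      qed
      ultimately show ?thesis unfolding det_minor_zero_iff[OF i] by blast
    qed
    then show False using ord unfolding order_eq_one_iff_sum_minors by simp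
  qed
next
  assume ker: "\<forall>y \<in> carrier_vec (Suc n). A *\<^sub>v y = 0\<^sub>v (Suc n) \<longrightarrow> (\<exists>c. y = c \<cdot>\<^sub>v x)"
  \<comment> \<open>With det A = 0 the adjugate satisfies A B = B A = 0, so its columns and, by
    symmetry of A, its rows lie on the line of x.\<close>
  define B where "B = adj_mat A"
  have B: "B \<in> carrier_mat (Suc n) (Suc n)" using adj_mat(1)[OF A] by (simp add: B_def)
  have det0: "det A = 0" unfolding det_0_iff_vec_prod_zero[OF A]
    using x by (intro exI[of _ x]) (auto, metis index_zero_vec(1) zero_less_Suc)
  have AB: "A * B = 0\<^sub>m (Suc n) (Suc n)" "B * A = 0\<^sub>m (Suc n) (Suc n)"
    using adj_mat(2,3)[OF A] by (simp_all add: B_def det0 smult_mat_def) auto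
  have col: "\<exists>c. \<forall>i<Suc n. B $$ (i, j) = c * x $ i" if j: "j < Suc n" for j
  proof -
    have "A *\<^sub>v col B j = col (A * B) j" using A B j by (simp add: col_mult2[OF A B j])
    also have "\<dots> = 0\<^sub>v (Suc n)" using j by (simp add: AB)
    finally obtain c where "col B j = c \<cdot>\<^sub>v x" using ker B j by (metis col_dim carrier_matD(1))
    then have "col B j $ i = c * x $ i" if "i < Suc n" for i using x that by simp
    then show ?thesis using B j by auto
  qed
  have row: "\<exists>c. \<forall>j<Suc n. B $$ (i, j) = c * x $ j" if i: "i < Suc n" for i
  proof -
    have "A *\<^sub>v row B i = 0\<^sub>v (Suc n)"
    proof (rule eq_vecI)
      fix k assume "k < dim_vec (0\<^sub>v (Suc n))"
      then have k: "k < Suc n" by simp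
      have "(A *\<^sub>v row B i) $ k = (\<Sum>j<Suc n. A $$ (k, j) * B $$ (i, j))"
        using B i k by (subst mult_mat_vec_index[OF A]) (auto simp del: sum.lessThan_Suc)
      also have "\<dots> = (\<Sum>j<Suc n. B $$ (i, j) * A $$ (j, k))" using k by (auto simp: sym mult.commute simp del: sum.lessThan_Suc intro!: sum.cong)
      also have "\<dots> = (B * A) $$ (i, k)"
        using A B i k by (simp add: scalar_prod_def lessThan_atLeast0 del: sum.lessThan_Suc sum.op_ivl_Suc)
      finally show "(A *\<^sub>v row B i) $ k = 0\<^sub>v (Suc n) $ k" using AB i k by simp
    qed (use A in auto)
    then obtain c where "row B i = c \<cdot>\<^sub>v x" using ker B i by (metis row_carrier carrier_matD(2))
    then have "row B i $ j = c * x $ j" if "j < Suc n" for j using x that by simp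
    then show ?thesis using B i by auto
  qed
  obtain c0 where c0: "\<And>i. i < Suc n \<Longrightarrow> B $$ (i, 0) = c0 * x $ i" using col[of 0] by auto
  have B_eq: "B $$ (i, i) = c0 / x $ 0 * (x $ i)\<^sup>2" if i: "i < Suc n" for i
  proof -
    obtain d where d: "\<And>j. j < Suc n \<Longrightarrow> B $$ (i, j) = d * x $ j" using row[OF i] by blast
    have "d * x $ 0 = c0 * x $ i" using c0[OF i] d[of 0] by simp
    then have "d = c0 / x $ 0 * x $ i" using x(3)[of 0] by (simp add: field_simps)
    then show ?thesis using d[OF i] by (simp add: power2_eq_square)
  qed
  have B_minor: "B $$ (i, i) = det (mat_delete A i i)" if "i < Suc n" for i
    using that A by (simp add: B_def adj_mat_def cofactor_def)
  \<comment> \<open>A kernel vector vanishing at 0 is a multiple of x with factor 0, so this minor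
    is nonzero, and with it the constant c0 / x 0.\<close>
  have "det (mat_delete A 0 0) \<noteq> 0"
  proof
    assume "det (mat_delete A 0 0) = 0"
    then obtain y where y: "y \<in> carrier_vec (Suc n)" "y \<noteq> 0\<^sub>v (Suc n)" "y $ 0 = 0" "A *\<^sub>v y = 0\<^sub>v (Suc n)"
      using det_minor_zero_iff[of 0] by auto
    then obtain c where c: "y = c \<cdot>\<^sub>v x" using ker by blast
    then have "c * x $ 0 = 0" using y(3) x(1) by simp
    then have "c = 0" using x(3)[of 0] by simp
    then have "y = 0\<^sub>v (Suc n)" using c x(1) by auto
    then show False using y(2) by blast
  qed
  then have c: "c0 / x $ 0 \<noteq> 0" using B_minor[of 0] B_eq[of 0] by auto
  have "(\<Sum>i<Suc n. det (mat_delete A i i)) = c0 / x $ 0 * (\<Sum>i<Suc n. (x $ i)\<^sup>2)"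
    unfolding sum_distrib_left by (intro sum.cong refl) (simp add: B_minor[symmetric] B_eq)
  moreover have "(\<Sum>i<Suc n. (x $ i)\<^sup>2) > 0" using x(3) by (intro sum_pos) auto
  ultimately show "Polynomial.order 0 (char_poly A) = 1"
    unfolding order_eq_one_iff_sum_minors using c by simp
qed

end

lemma order_zero_char_poly_eq_one_iff:
  fixes A :: "real mat"
  assumes "A \<in> carrier_mat n n" "n > 0" "\<And>i j. i < n \<Longrightarrow> j < n \<Longrightarrow> A $$ (i, j) = A $$ (j, i)"
    "x \<in> carrier_vec n" "A *\<^sub>v x = 0\<^sub>v n" "\<And>i. i < n \<Longrightarrow> x $ i \<noteq> 0"
  shows "Polynomial.order 0 (char_poly A) = 1 \<longleftrightarrow>
    (\<forall>y \<in> carrier_vec n. A *\<^sub>v y = 0\<^sub>v n \<longrightarrow> (\<exists>c. y = c \<cdot>\<^sub>v x))"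
proof -
  obtain n' where "n = Suc n'" using assms(2) gr0_implies_Suc by blast
  then interpret symmetric_kernel A n' x using assms by unfold_locales auto
  show ?thesis using order_eq_one_iff \<open>n = Suc n'\<close> by simp
qed

section \<open>Dihedral Cayley graphs\<close>

lemma adj_matrix_mult_index:
  assumes "y \<in> carrier_vec n" "i < n"
  shows "(adj_matrix n E *\<^sub>v y) $ i = (\<Sum>j<n. if E i j then y $ j else 0)"
proof -
  have "adj_matrix n E \<in> carrier_mat n n" by (simp add: adj_matrix_def)
  then show ?thesis using assms
    by (subst mult_mat_vec_index) (auto simp: adj_matrix_def intro!: sum.cong)
qed

lemma adj_matrix_kernel_iff:
  assumes "y \<in> carrier_vec n"
  shows "adj_matrix n E *\<^sub>v y = 0\<^sub>v n \<longleftrightarrow> (\<forall>i<n. (\<Sum>j<n. if E i j then y $ j else 0) = 0)"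
proof
  assume *: "adj_matrix n E *\<^sub>v y = 0\<^sub>v n"
  show "\<forall>i<n. (\<Sum>j<n. if E i j then y $ j else 0) = 0"
    using adj_matrix_mult_index[OF assms, of _ E] * by auto
next
  assume "\<forall>i<n. (\<Sum>j<n. if E i j then y $ j else 0) = 0"
  then show "adj_matrix n E *\<^sub>v y = 0\<^sub>v n"
    using adj_matrix_mult_index[OF assms, of _ E] by (intro eq_vecI) (auto simp: adj_matrix_def)
qed

text \<open>The working form for both directions of the classification: the characteristic
  polynomial is gone, and vectors are functions of which only the values below n count.\<close>

lemma nut_graph_iff:
  "nut_graph n E \<longleftrightarrow> simple_graph n E \<and> n \<ge> 2 \<and>
    (\<exists>x. (\<forall>i<n. x i \<noteq> (0 :: real)) \<and> (\<forall>i<n. (\<Sum>j<n. if E i j then x j else 0) = 0) \<and>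
      (\<forall>y. (\<forall>i<n. (\<Sum>j<n. if E i j then y j else 0) = 0) \<longrightarrow> (\<exists>c. \<forall>i<n. y i = c * x i)))"
    (is "?L \<longleftrightarrow> ?R")
proof -
  let ?A = "adj_matrix n E"
  have vec_sum: "(\<Sum>j<n. if E i j then vec n y $ j else 0) = (\<Sum>j<n. if E i j then y j else 0)"
    for i and y :: "nat \<Rightarrow> real" by (intro sum.cong) auto
  have A: "?A \<in> carrier_mat n n" by (simp add: adj_matrix_def)
  have key: "Polynomial.order 0 (char_poly ?A) = 1 \<longleftrightarrow>
      (\<forall>y \<in> carrier_vec n. ?A *\<^sub>v y = 0\<^sub>v n \<longrightarrow> (\<exists>c. y = c \<cdot>\<^sub>v x))"
    if "simple_graph n E" "n \<ge> 2" "x \<in> carrier_vec n" "?A *\<^sub>v x = 0\<^sub>v n" "\<forall>i<n. x $ i \<noteq> 0" for x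
    using that A by (intro order_zero_char_poly_eq_one_iff) (auto simp: adj_matrix_def simple_graph_def)
  show ?thesis
  proof
    assume L: ?L
    then obtain x where x: "x \<in> carrier_vec n" "?A *\<^sub>v x = 0\<^sub>v n" "\<forall>i<n. x $ i \<noteq> 0" by (auto simp: nut_graph_def)
    have "\<exists>c. \<forall>i<n. y i = c * x $ i" if "\<forall>i<n. (\<Sum>j<n. if E i j then y j else 0) = 0" for y
    proof -
      have "?A *\<^sub>v vec n y = 0\<^sub>v n" using that by (simp add: adj_matrix_kernel_iff vec_sum)
      then obtain c where "vec n y = c \<cdot>\<^sub>v x" using L key[OF _ _ x] by (auto simp: nut_graph_def)
      then have "vec n y $ i = c * x $ i" if "i < n" for i using x(1) that by simp
      then show ?thesis by auto
    qed
    then show ?R using L x adj_matrix_kernel_iff[OF x(1)] by (auto simp: nut_graph_def intro!: exI[of _ "\<lambda>i. x $ i"])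
  next
    assume R: ?R
    then obtain x where x: "\<forall>i<n. x i \<noteq> (0 :: real)" "\<forall>i<n. (\<Sum>j<n. if E i j then x j else 0) = 0"
      "\<And>y. (\<forall>i<n. (\<Sum>j<n. if E i j then y j else 0) = 0) \<Longrightarrow> (\<exists>c. \<forall>i<n. y i = c * x i)" by blast
    have vx: "vec n x \<in> carrier_vec n" "\<forall>i<n. vec n x $ i \<noteq> 0" using x(1) by auto
    have k: "?A *\<^sub>v vec n x = 0\<^sub>v n" using x(2) by (simp add: adj_matrix_kernel_iff vec_sum)
    have "\<exists>c. y = c \<cdot>\<^sub>v vec n x" if "y \<in> carrier_vec n" "?A *\<^sub>v y = 0\<^sub>v n" for y
    proof -
      have "\<forall>i<n. (\<Sum>j<n. if E i j then y $ j else 0) = 0" using that adj_matrix_kernel_iff by blast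
      then have "\<exists>c. \<forall>i<n. y $ i = c * x i" by (rule x(3))
      then obtain c where "\<forall>i<n. y $ i = c * x i" by blast
      then have "y = c \<cdot>\<^sub>v vec n x" using that by (intro eq_vecI) auto
      then show ?thesis by blast
    qed
    then show ?L using R key[OF _ _ vx(1) k vx(2)] vx k by (auto simp: nut_graph_def)
  qed
qed

text \<open>Vertices \<open>u < m\<close> are the rotations and \<open>m + u\<close> the reflections of a dihedral group.\<close>

definition dihedral_adj :: "nat \<Rightarrow> nat set \<Rightarrow> nat set \<Rightarrow> nat \<Rightarrow> nat \<Rightarrow> bool" where
  "dihedral_adj m R S u v \<longleftrightarrow>
    (if (u < m) = (v < m) then (v + (m - u mod m)) mod m \<in> R else (u + v) mod m \<in> S)"

section \<open>Character sums over residues\<close>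

lemma diff_mod_eq: "i < m \<Longrightarrow> v < m \<Longrightarrow> (v + (m - i)) mod m = (if i \<le> v then v - i else v + m - i)"
  for m :: nat
  by (auto simp: mod_if)

lemma sum_diff_mod:
  fixes w :: complex
  assumes "w ^ m = 1" "A \<subseteq> {..<m}" "v < m"
  shows "(\<Sum>i<m. if (v + (m - i)) mod m \<in> A then w ^ i else 0) = w ^ v * hat A (inverse w)"
proof -
  have w0: "w \<noteq> 0" using assms by (metis power_0_left less_nat_zero_code neq0_conv zero_neq_one)
  have pw: "w ^ ((v + (m - a)) mod m) = w ^ v * inverse w ^ a" if "a < m" for a
  proof -
    have "(w ^ v * w ^ (m - a)) * w ^ a = w ^ v * w ^ (m - a + a)" by (simp add: power_add mult.assoc)
    also have "\<dots> = w ^ v" using that assms(1) by simp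
    finally have "w ^ v * w ^ (m - a) = w ^ v * inverse w ^ a" using w0 by (simp add: field_simps)
    then show ?thesis by (simp add: power_mod_root[OF assms(1)] power_add)
  qed
  \<comment> \<open>Subtraction from v modulo m is its own inverse, so one map serves both
    directions of the reindexing.\<close>
  have involution: "(v + (m - (v + (m - a)) mod m)) mod m = a" if "a < m" for a
  proof -
    define b where "b = (v + (m - a)) mod m"
    have b: "b = (if a \<le> v then v - a else v + m - a)" "b < m"
      using diff_mod_eq[OF that assms(3)] assms(3) by (auto simp: b_def)
    then show ?thesis unfolding b_def[symmetric] diff_mod_eq[OF b(2) assms(3)] using that assms(3) by auto
  qed
  have lt: "(v + (m - a)) mod m < m" for a using assms(3) by simp
  have "(\<Sum>i<m. if (v + (m - i)) mod m \<in> A then w ^ i else 0) = (\<Sum>i\<in>{i\<in>{..<m}. (v + (m - i)) mod m \<in> A}. w ^ i)"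
    by (rule sum.inter_filter[symmetric]) simp
  also have "\<dots> = (\<Sum>a\<in>A. w ^ v * inverse w ^ a)"
  proof (rule sum.reindex_bij_witness[of _ "\<lambda>a. (v + (m - a)) mod m" "\<lambda>a. (v + (m - a)) mod m"])
    fix i assume i: "i \<in> {i \<in> {..<m}. (v + (m - i)) mod m \<in> A}"
    then have im: "i < m" "(v + (m - i)) mod m \<in> A" by blast+
    show "(v + (m - (v + (m - i)) mod m)) mod m = i" by (rule involution[OF im(1)])
    then show "w ^ v * inverse w ^ ((v + (m - i)) mod m) = w ^ i"
      using pw[OF lt[of i]] by (simp only:)
    show "(v + (m - i)) mod m \<in> A" by (rule im(2))
  next
    fix a assume a: "a \<in> A"
    then have am: "a < m" using assms(2) by blast
    show inv: "(v + (m - (v + (m - a)) mod m)) mod m = a" by (rule involution[OF am])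
    show "(v + (m - a)) mod m \<in> {i \<in> {..<m}. (v + (m - i)) mod m \<in> A}"
      using lt[of a] a by (simp only: mem_Collect_eq lessThan_iff inv)
  qed
  finally show ?thesis by (simp add: hat_def sum_distrib_left)
qed

lemma sum_add_mod:
  fixes w :: complex
  assumes "w ^ m = 1" "A \<subseteq> {..<m}" "v < m"
  shows "(\<Sum>i<m. if (i + v) mod m \<in> A then w ^ i else 0) = inverse w ^ v * hat A w"
proof -
  have w0: "w \<noteq> 0" using assms by (metis power_0_left less_nat_zero_code neq0_conv zero_neq_one)
  have pw: "w ^ i = inverse w ^ v * w ^ ((i + v) mod m)" for i
    using w0 by (simp add: power_mod_root[OF assms(1)] power_add field_simps)
  have "(\<Sum>i<m. if (i + v) mod m \<in> A then w ^ i else 0) = (\<Sum>i\<in>{i\<in>{..<m}. (i + v) mod m \<in> A}. w ^ i)"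
    by (rule sum.inter_filter[symmetric]) simp
  also have "\<dots> = (\<Sum>a\<in>A. inverse w ^ v * w ^ a)"
  proof (rule sum.reindex_bij_witness[of _ "\<lambda>a. (a + (m - v)) mod m" "\<lambda>i. (i + v) mod m"])
    fix i assume "i \<in> {i \<in> {..<m}. (i + v) mod m \<in> A}"
    then have i: "i < m" "(i + v) mod m \<in> A" by blast+
    have "((i + v) mod m + (m - v)) mod m = ((i + v) + (m - v)) mod m" by (rule mod_add_left_eq)
    also have "(i + v) + (m - v) = i + m" using assms(3) by simp
    finally show "((i + v) mod m + (m - v)) mod m = i" using i(1) by simp
    show "(i + v) mod m \<in> A" by (rule i(2))
    show "inverse w ^ v * w ^ ((i + v) mod m) = w ^ i" by (rule pw[symmetric])
  next
    fix a assume a: "a \<in> A"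
    then have "a < m" using assms(2) by blast
    have "((a + (m - v)) mod m + v) mod m = ((a + (m - v)) + v) mod m" by (rule mod_add_left_eq)
    also have "(a + (m - v)) + v = a + m" using assms(3) by simp
    finally show inv: "((a + (m - v)) mod m + v) mod m = a" using \<open>a < m\<close> by simp
    have "(a + (m - v)) mod m < m" using assms(3) by simp
    then show "(a + (m - v)) mod m \<in> {i \<in> {..<m}. (i + v) mod m \<in> A}"
      using a by (simp only: mem_Collect_eq lessThan_iff inv)
  qed
  finally show ?thesis by (simp add: hat_def sum_distrib_left)
qed

text \<open>Fourier inversion for a transform supported at a single real character.\<close>

lemma fourier_support_single:
  fixes y :: "nat \<Rightarrow> complex"
  assumes m: "m > 0" and \<kappa>: "\<kappa> = 1 \<or> \<kappa> = -1" "\<kappa> ^ m = 1"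
    and zero: "\<And>w. w ^ m = 1 \<Longrightarrow> w \<noteq> \<kappa> \<Longrightarrow> (\<Sum>v<m. y v * w ^ v) = 0"
  shows "\<exists>c. \<forall>v<m. y v = c * \<kappa> ^ v"
proof -
  have kk: "\<kappa> * \<kappa> = 1" using \<kappa>(1) by auto
  \<comment> \<open>The Fourier coefficient at kappa, without conjugation because kappa is
    real.\<close>
  define c where "c = (\<Sum>v<m. y v * \<kappa> ^ v) / of_nat m"
  define p where "p = (\<Sum>v<m. Polynomial.monom (y v - c * \<kappa> ^ v) v)"
  have cf: "Polynomial.coeff p v = (if v < m then y v - c * \<kappa> ^ v else 0)" for v
    by (simp add: p_def coeff_sum)
  have ev: "poly p w = (\<Sum>v<m. y v * w ^ v) - c * (\<Sum>v<m. (\<kappa> * w) ^ v)" for w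
    by (simp add: p_def poly_sum poly_monom algebra_simps sum_subtractf sum_distrib_left power_mult_distrib)
  text \<open>\<open>p\<close> has degree less than \<open>m\<close>, so it suffices that it vanishes at all \<open>m\<close>-th roots of unity.\<close>
  have "poly p w = 0" if w: "w ^ m = 1" for w
  proof (cases "w = \<kappa>")
    case True
    then show ?thesis using m by (simp add: ev kk c_def)
  next
    case False
    have "\<kappa> * w \<noteq> 1" using False kk by (metis mult.assoc mult.right_neutral mult_1)
    moreover have "(\<kappa> * w) ^ m = 1" using w \<kappa>(2) by (simp add: power_mult_distrib)
    ultimately have "(\<Sum>v<m. (\<kappa> * w) ^ v) = 0" by (simp add: geometric_sum)
    then show ?thesis using zero[OF w False] by (simp add: ev)
  qed
  then have "{w. w ^ m = 1} \<subseteq> {w. poly p w = 0}" by blast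
  moreover have "card {w :: complex. w ^ m = 1} = m" using m by (simp add: card_roots_unity_eq)
  moreover have "degree p < m" using m by (intro degree_lessI) (auto simp: cf)
  ultimately have "p = 0"
    using card_poly_roots_bound[of p] poly_roots_finite[of p] card_mono[of "{w. poly p w = 0}" "{w. w ^ m = 1}"]
    by (metis (no_types, lifting) leD le_trans)
  then show ?thesis using cf by (intro exI[of _ c]) (metis coeff_0 eq_iff_diff_eq_0)
qed

lemma sum_split_double: "(\<Sum>v<2 * m. f v) = (\<Sum>v<m. f v) + (\<Sum>v<m. f (m + v))"
  for m :: nat and f :: "nat \<Rightarrow> 'a :: comm_monoid_add"
proof -
  have "sum f {0..<2 * m} = sum f {0..<m} + sum f {m..<2 * m}" by (rule sum.atLeastLessThan_concat[symmetric]) auto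
  also have "sum f {m..<2 * m} = (\<Sum>v = 0..<m. f (v + m))"
    using sum.shift_bounds_nat_ivl[of f 0 m m] by (simp add: mult_2)
  finally show ?thesis by (simp add: lessThan_atLeast0 add.commute)
qed

section \<open>The dihedral graph of a spectral pair\<close>

locale dihedral =
  fixes m :: nat and R S :: "nat set" and \<kappa> :: complex
  assumes pair: "spectral_pair m R S \<kappa>"
begin

lemma R: "R \<subseteq> {0<..<m}" "\<And>r. r \<in> R \<Longrightarrow> m - r \<in> R" and S: "S \<subseteq> {..<m}"
  and \<kappa>: "\<kappa> = 1 \<or> \<kappa> = -1" "\<kappa> ^ m = 1" "hat R \<kappa> = hat S \<kappa>" "hat R \<kappa> \<noteq> 0"
  and disc: "\<And>w. w ^ m = 1 \<Longrightarrow> w \<noteq> \<kappa> \<Longrightarrow> hat S w * hat S (inverse w) \<noteq> (hat R w)\<^sup>2"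
  using pair by (auto simp: spectral_pair_def)

lemma R': "R \<subseteq> {..<m}" using R by auto

lemma m_pos: "m > 0"
proof -
  have "R \<noteq> {}" using \<kappa>(4) by (auto simp: hat_def)
  then show ?thesis using R by fastforce
qed

abbreviation adj where "adj \<equiv> dihedral_adj m R S"

lemma R_swap:
  assumes "i < m" "v < m"
  shows "(v + (m - i)) mod m \<in> R \<longleftrightarrow> (i + (m - v)) mod m \<in> R"
proof -
  have *: "(v + (m - i)) mod m \<in> R" if "(i + (m - v)) mod m \<in> R" "i < m" "v < m" for i v
  proof -
    have r: "(if v \<le> i then i - v else i + m - v) \<in> R" using that by (simp only: diff_mod_eq)
    then have r': "m - (if v \<le> i then i - v else i + m - v) \<in> R" by (rule R(2))
    have "v \<noteq> i" using r R(1) by auto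
    then have "m - (if v \<le> i then i - v else i + m - v) = (if i \<le> v then v - i else v + m - i)"
      using that by auto
    then show ?thesis using r' that by (simp only: diff_mod_eq)
  qed
  show ?thesis using * assms by blast
qed

lemma adj_simps:
  assumes "i < m" "v < m"
  shows "adj i v \<longleftrightarrow> (i + (m - v)) mod m \<in> R" "adj i (m + v) \<longleftrightarrow> (i + v) mod m \<in> S"
    "adj (m + i) v \<longleftrightarrow> (i + v) mod m \<in> S" "adj (m + i) (m + v) \<longleftrightarrow> (i + (m - v)) mod m \<in> R"
proof -
  have "(m + v + (m - i)) mod m = (v + (m - i)) mod m" by (metis add.assoc mod_add_self1)
  then show "adj i v \<longleftrightarrow> (i + (m - v)) mod m \<in> R" "adj i (m + v) \<longleftrightarrow> (i + v) mod m \<in> S"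
    "adj (m + i) v \<longleftrightarrow> (i + v) mod m \<in> S" "adj (m + i) (m + v) \<longleftrightarrow> (i + (m - v)) mod m \<in> R"
    using assms R_swap[OF assms] by (auto simp: dihedral_adj_def add.left_commute[of i m v] add.assoc)
qed

lemma hat_R_inverse: "w ^ m = 1 \<Longrightarrow> hat R (inverse w) = hat R w"
proof -
  assume w: "w ^ m = 1"
  have "w ^ (m - r) = inverse w ^ r" if "r \<in> R" for r
  proof -
    have "m - r + r = m" using R(1) that by auto
    then have "w ^ (m - r) * w ^ r = 1" using w by (metis power_add)
    then show ?thesis by (metis inverse_unique mult.commute power_inverse)
  qed
  then have "hat R (inverse w) = (\<Sum>r\<in>R. w ^ (m - r))" by (simp add: hat_def)
  also have "\<dots> = hat R w"
    unfolding hat_def using R by (intro sum.reindex_bij_witness[of _ "\<lambda>r. m - r" "\<lambda>r. m - r"]) auto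
  finally show ?thesis .
qed

lemma simple: "simple_graph (2 * m) adj"
proof -
  have "adj u v \<longleftrightarrow> adj v u" if "u < 2 * m" "v < 2 * m" for u v
  proof -
    have c: "i = i mod m \<and> i < m \<or> (i = m + i mod m \<and> i mod m < m)" if "i < 2 * m" for i
      using that m_pos by (auto simp: mod_if)
    have "i mod m < m" for i using m_pos by simp
    then show ?thesis using c[OF that(1)] c[OF that(2)]
      by (metis (no_types, opaque_lifting) R_swap add.commute adj_simps)
  qed
  moreover have "\<not> adj u u" if "u < 2 * m" for u
  proof -
    have "(u + (m - u mod m)) mod m = 0"
      using m_pos by (metis le_add_diff_inverse mod_add_left_eq mod_less_divisor mod_self less_imp_le)
    then show ?thesis using R(1) by (auto simp: dihedral_adj_def)
  qed
  ultimately show ?thesis by (auto simp: simple_graph_def)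
qed

text \<open>Edges within a side preserve the character w, edges across the sides invert it. Hence w
  on the rotations and 1/w on the reflections span an invariant plane, with block rows (hat R w, hat
  S (1/w)) and (hat S w, hat R w).\<close>

lemma row_sums:
  fixes w :: complex
  assumes "w ^ m = 1" "i < m"
  shows "(\<Sum>v<m. if adj i v then w ^ v else 0) = w ^ i * hat R w"
    "(\<Sum>v<m. if adj i (m + v) then w ^ v else 0) = inverse w ^ i * hat S w"
    "(\<Sum>v<m. if adj (m + i) v then w ^ v else 0) = inverse w ^ i * hat S w"
    "(\<Sum>v<m. if adj (m + i) (m + v) then w ^ v else 0) = w ^ i * hat R w"
proof -
  have R_sum: "(\<Sum>v<m. if (i + (m - v)) mod m \<in> R then w ^ v else 0) = w ^ i * hat R w"
    using sum_diff_mod[OF assms(1) R' assms(2)] assms by (simp only: hat_R_inverse)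
  have S_sum: "(\<Sum>v<m. if (i + v) mod m \<in> S then w ^ v else 0) = inverse w ^ i * hat S w"
    using sum_add_mod[OF assms(1) S assms(2)] by (simp only: add.commute)
  show "(\<Sum>v<m. if adj i v then w ^ v else 0) = w ^ i * hat R w"
    "(\<Sum>v<m. if adj (m + i) (m + v) then w ^ v else 0) = w ^ i * hat R w"
    unfolding R_sum[symmetric] by (intro sum.cong refl; simp add: adj_simps assms(2))+
  show "(\<Sum>v<m. if adj i (m + v) then w ^ v else 0) = inverse w ^ i * hat S w"
    "(\<Sum>v<m. if adj (m + i) v then w ^ v else 0) = inverse w ^ i * hat S w"
    unfolding S_sum[symmetric] by (intro sum.cong refl; simp add: adj_simps assms(2))+
qed

lemma regular: "regular_graph (2 * m) adj (card R + card S)"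
  unfolding regular_graph_def
proof (intro allI impI)
  fix u assume u: "u < 2 * m"
  \<comment> \<open>The number of neighbours is the row sum at w = 1, computed in the complex
    numbers.\<close>
  have rows: "(\<Sum>v<2 * m. if adj u v then 1 else 0) = (of_nat (card R + card S) :: complex)"
  proof (cases "u < m")
    case True
    then show ?thesis using row_sums(1,2)[of 1 u] by (simp add: sum_split_double hat_one cong: if_cong)
  next
    case False
    then have "u = m + (u - m)" "u - m < m" using u by auto
    then show ?thesis using row_sums(3,4)[of 1 "u - m"] by (simp add: sum_split_double hat_one cong: if_cong)
  qed
  have "(\<Sum>v<2 * m. if adj u v then 1 else 0) = (of_nat (card {v. v < 2 * m \<and> adj u v}) :: complex)"
    by (simp add: sum.inter_filter[symmetric] conj_commute)
  then show "card {v. v < 2 * m \<and> adj u v} = card R + card S" using rows by (metis of_nat_eq_iff)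
qed

text \<open>The kernel vector (1, -1) of the singular block, spread out by the character
  kappa.\<close>

definition sgn_vec :: "nat \<Rightarrow> real" where
  "sgn_vec v = (if v < m then Re \<kappa> ^ v else - (Re \<kappa> ^ (v - m)))"

lemma of_real_Re_\<kappa>: "complex_of_real (Re \<kappa>) = \<kappa>" "inverse \<kappa> = \<kappa>"
  using \<kappa>(1) by auto

lemma sgn_vec_simps: "v < m \<Longrightarrow> complex_of_real (sgn_vec v) = \<kappa> ^ v"
  "complex_of_real (sgn_vec (m + v)) = - (\<kappa> ^ v)"
  by (simp_all add: sgn_vec_def of_real_Re_\<kappa>)

lemma sgn_vec_kernel:
  assumes "u < 2 * m"
  shows "(\<Sum>v<2 * m. if adj u v then sgn_vec v else 0) = 0"
proof -
  have neg: "(\<Sum>v<m. if P v then - (\<kappa> ^ v) else 0) = - (\<Sum>v<m. if P v then \<kappa> ^ v else 0)" for P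
    by (auto simp: sum_negf[symmetric] intro!: sum.cong)
  have "complex_of_real (\<Sum>v<2 * m. if adj u v then sgn_vec v else 0)
      = (\<Sum>v<2 * m. if adj u v then complex_of_real (sgn_vec v) else 0)"
    by (auto intro!: sum.cong)
  also have "\<dots> = (\<Sum>v<m. if adj u v then \<kappa> ^ v else 0) - (\<Sum>v<m. if adj u (m + v) then \<kappa> ^ v else 0)"
    unfolding sum_split_double
  proof -
    have "(\<Sum>v<m. if adj u v then complex_of_real (sgn_vec v) else 0) = (\<Sum>v<m. if adj u v then \<kappa> ^ v else 0)"
      by (intro sum.cong) (auto simp: sgn_vec_simps)
    then show "(\<Sum>v<m. if adj u v then complex_of_real (sgn_vec v) else 0)
        + (\<Sum>v<m. if adj u (m + v) then complex_of_real (sgn_vec (m + v)) else 0)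
      = (\<Sum>v<m. if adj u v then \<kappa> ^ v else 0) - (\<Sum>v<m. if adj u (m + v) then \<kappa> ^ v else 0)"
      by (simp add: sgn_vec_simps neg cong: if_cong)
  qed
  also have "\<dots> = 0"
  proof (cases "u < m")
    case True
    then show ?thesis by (simp add: row_sums[OF \<kappa>(2)] \<kappa>(3) of_real_Re_\<kappa>(2))
  next
    case False
    then have "u = m + (u - m)" "u - m < m" using assms by auto
    then show ?thesis using row_sums(3,4)[OF \<kappa>(2), of "u - m"] by (simp add: \<kappa>(3) of_real_Re_\<kappa>(2))
  qed
  finally show ?thesis by (simp only: of_real_eq_0_iff)
qed

lemma kernel_sgn_vec:
  assumes ker: "\<And>u. u < 2 * m \<Longrightarrow> (\<Sum>v<2 * m. if adj u v then y v else 0) = (0 :: real)"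
  shows "\<exists>c. \<forall>v<2 * m. y v = c * sgn_vec v"
proof -
  define y0 y1 where "y0 v = complex_of_real (y v)" and "y1 v = complex_of_real (y (m + v))" for v
  define Y0 Y1 where "Y0 w = (\<Sum>v<m. y0 v * w ^ v)" and "Y1 w = (\<Sum>v<m. y1 v * w ^ v)" for w
  have ker': "(\<Sum>v<m. if adj u v then y0 v else 0) + (\<Sum>v<m. if adj u (m + v) then y1 v else 0) = 0"
    if "u < 2 * m" for u
  proof -
    have "complex_of_real (\<Sum>v<2 * m. if adj u v then y v else 0) = 0" using ker[OF that] by simp
    then show ?thesis unfolding sum_split_double of_real_add of_real_sum y0_def y1_def
      by (simp add: if_distrib[of complex_of_real] cong: if_cong)
  qed
  \<comment> \<open>Swapping the sums moves the adjacency from the kernel vector onto the character,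
    where \<open>row_sums\<close> evaluates it; this uses the symmetry of
    \<open>adj\<close>.\<close>
  have transform: "(\<Sum>i<m. w ^ i * (\<Sum>v<m. if adj (a + i) (b + v) then f v else 0))
      = (\<Sum>v<m. f v * (\<Sum>i<m. if adj (b + v) (a + i) then w ^ i else 0))"
    if "a \<in> {0, m}" "b \<in> {0, m}" for a b w and f :: "nat \<Rightarrow> complex"
  proof -
    have sym: "adj (a + i) (b + v) = adj (b + v) (a + i)" if "i < m" "v < m" for i v
      using simple that \<open>a \<in> {0, m}\<close> \<open>b \<in> {0, m}\<close> unfolding simple_graph_def by auto
    have "(\<Sum>i<m. w ^ i * (\<Sum>v<m. if adj (a + i) (b + v) then f v else 0))
        = (\<Sum>i<m. \<Sum>v<m. if adj (b + v) (a + i) then f v * w ^ i else 0)"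
      by (auto simp: sum_distrib_left sym intro!: sum.cong)
    also have "\<dots> = (\<Sum>v<m. \<Sum>i<m. if adj (b + v) (a + i) then f v * w ^ i else 0)" by (rule sum.swap)
    also have "\<dots> = (\<Sum>v<m. f v * (\<Sum>i<m. if adj (b + v) (a + i) then w ^ i else 0))"
      by (auto simp: sum_distrib_left intro!: sum.cong)
    finally show ?thesis .
  qed
  have eq0: "hat R w * Y0 w + hat S w * Y1 (inverse w) = 0"
    and eq1: "hat R w * Y1 w + hat S w * Y0 (inverse w) = 0" if w: "w ^ m = 1" for w
  proof -
    have "0 = (\<Sum>i<m. w ^ i * ((\<Sum>v<m. if adj i v then y0 v else 0) + (\<Sum>v<m. if adj i (m + v) then y1 v else 0)))"
      using ker' by simp
    also have "\<dots> = (\<Sum>v<m. y0 v * (w ^ v * hat R w)) + (\<Sum>v<m. y1 v * (inverse w ^ v * hat S w))"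
      using transform[of 0 0 w y0] transform[of 0 m w y1]
      by (simp add: distrib_left sum.distrib) (simp add: row_sums[OF w])
    finally show "hat R w * Y0 w + hat S w * Y1 (inverse w) = 0"
      by (simp add: Y0_def Y1_def sum_distrib_left mult_ac)
    have "0 = (\<Sum>i<m. w ^ i * ((\<Sum>v<m. if adj (m + i) v then y0 v else 0) + (\<Sum>v<m. if adj (m + i) (m + v) then y1 v else 0)))"
      using ker' by simp
    also have "\<dots> = (\<Sum>v<m. y0 v * (inverse w ^ v * hat S w)) + (\<Sum>v<m. y1 v * (w ^ v * hat R w))"
      using transform[of m 0 w y0] transform[of m m w y1]
      by (simp add: distrib_left sum.distrib) (simp add: row_sums[OF w])
    finally show "hat R w * Y1 w + hat S w * Y0 (inverse w) = 0"
      by (simp add: Y0_def Y1_def sum_distrib_left mult_ac add.commute)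
  qed
  have zero: "Y0 w = 0 \<and> Y1 (inverse w) = 0" if w: "w ^ m = 1" "w \<noteq> \<kappa>" for w
  proof -
    have w': "inverse w ^ m = 1" using w(1) by (simp add: power_inverse)
    define r s s' where "r = hat R w" and "s = hat S w" and "s' = hat S (inverse w)"
    have a: "r * Y0 w + s * Y1 (inverse w) = 0" using eq0[OF w(1)] by (simp add: r_def s_def)
    have b: "r * Y1 (inverse w) + s' * Y0 w = 0"
      using eq1[OF w'] by (simp add: r_def s'_def hat_R_inverse[OF w(1)])
    \<comment> \<open>Cramer's rule for the block that couples Y0 at w with Y1 at 1/w.\<close>
    have "(s * s' - r\<^sup>2) * Y0 w = s * (r * Y1 (inverse w) + s' * Y0 w) - r * (r * Y0 w + s * Y1 (inverse w))"
      "(s * s' - r\<^sup>2) * Y1 (inverse w) = s' * (r * Y0 w + s * Y1 (inverse w)) - r * (r * Y1 (inverse w) + s' * Y0 w)"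
      by (simp_all add: power2_eq_square algebra_simps)
    then have "(s * s' - r\<^sup>2) * Y0 w = 0" "(s * s' - r\<^sup>2) * Y1 (inverse w) = 0" using a b by simp_all
    then show ?thesis using disc[OF w] by (simp add: r_def s_def s'_def)
  qed
  obtain c0 where c0: "\<And>v. v < m \<Longrightarrow> y0 v = c0 * \<kappa> ^ v"
    using fourier_support_single[OF m_pos \<kappa>(1,2), of y0] zero unfolding Y0_def by blast
  have "Y1 w = 0" if "w ^ m = 1" "w \<noteq> \<kappa>" for w
  proof -
    have "inverse w ^ m = 1" using that by (simp add: power_inverse)
    moreover have "inverse w \<noteq> \<kappa>" using that of_real_Re_\<kappa>(2) by (metis inverse_inverse_eq)
    ultimately show ?thesis using zero[of "inverse w"] by simp
  qed
  then obtain c1 where c1: "\<And>v. v < m \<Longrightarrow> y1 v = c1 * \<kappa> ^ v"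
    using fourier_support_single[OF m_pos \<kappa>(1,2), of y1] unfolding Y1_def by blast
  have kk: "\<kappa> ^ v * \<kappa> ^ v = 1" for v using \<kappa>(1) by (auto simp flip: power_mult_distrib)
  have "Y0 \<kappa> = of_nat m * c0" "Y1 \<kappa> = of_nat m * c1"
    by (simp_all add: Y0_def Y1_def c0 c1 mult.assoc kk)
  \<comment> \<open>The singular block yields only one relation between c0 and c1, which leaves a
    line.\<close>
  then have "hat R \<kappa> * of_nat m * (c0 + c1) = 0"
    using eq0[OF \<kappa>(2)] by (simp add: of_real_Re_\<kappa>(2) \<kappa>(3) algebra_simps)
  then have c: "c1 = - c0" using \<kappa>(4) m_pos by (simp add: add_eq_0_iff2 add_eq_0_iff)
  have c0r: "c0 = complex_of_real (y 0)" using c0[of 0] m_pos by (simp add: y0_def)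
  have "y v = y 0 * sgn_vec v" if "v < 2 * m" for v
  proof -
    have "complex_of_real (y v) = complex_of_real (y 0 * sgn_vec v)"
    proof (cases "v < m")
      case True
      then show ?thesis using c0[of v] by (simp add: y0_def sgn_vec_simps c0r)
    next
      case False
      then have "v = m + (v - m)" "v - m < m" using that by auto
      then show ?thesis using c1[of "v - m"] sgn_vec_simps(2)[of "v - m"] by (simp add: y1_def c c0r)
    qed
    then show ?thesis by (simp only: of_real_eq_iff)
  qed
  then show ?thesis by blast
qed

lemma nut: "nut_graph (2 * m) adj"
proof -
  have "sgn_vec v \<noteq> 0" for v using \<kappa>(1) by (auto simp: sgn_vec_def)
  then show ?thesis unfolding nut_graph_iff
    using simple m_pos sgn_vec_kernel kernel_sgn_vec by (auto intro!: exI[of _ sgn_vec])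
qed

end

section \<open>The dihedral group on natural numbers\<close>

definition dihedral_mult :: "nat \<Rightarrow> nat \<Rightarrow> nat \<Rightarrow> nat" where
  "dihedral_mult m u v =
    (if u < m then (if v < m then (u + v) mod m else m + (u + v) mod m)
     else (if v < m then m + (u + (m - v)) mod m else (u + (m - v mod m)) mod m))"

definition dihedral_group :: "nat \<Rightarrow> nat monoid" where
  "dihedral_group m = \<lparr>carrier = {..<2 * m}, mult = dihedral_mult m, one = 0\<rparr>"

definition orientation :: "nat \<Rightarrow> nat \<Rightarrow> int" where
  "orientation m u = (if u < m then 1 else -1)"

lemma dihedral_mult_less: "m > 0 \<Longrightarrow> dihedral_mult m u v < 2 * m"
  by (auto simp: dihedral_mult_def intro: less_le_trans[OF mod_less_divisor])

lemma dihedral_mult_side: "m > 0 \<Longrightarrow> dihedral_mult m u v < m \<longleftrightarrow> (u < m) = (v < m)"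
  by (simp add: dihedral_mult_def)

lemma orientation_mult: "m > 0 \<Longrightarrow> orientation m (dihedral_mult m u v) = orientation m u * orientation m v"
  by (simp add: orientation_def dihedral_mult_side)

text \<open>The product law of the semidirect product of the residues with a sign. Residue and
  orientation together determine an element, so associativity becomes distributivity of the
  integers.\<close>

lemma dihedral_mult_cong:
  assumes "m > 0"
  shows "[int (dihedral_mult m u v) = int u + orientation m u * int v] (mod int m)"
proof -
  have sub: "[int (u + (m - w)) = int u - int v] (mod int m)" if "w \<le> m" "[int w = int v] (mod int m)" for w
  proof -
    have "int (u + (m - w)) = int u - int w + int m" using that(1) by (simp add: of_nat_diff)
    also have "[int u - int w + int m = int u - int v + 0] (mod int m)"
      by (intro cong_add cong_diff that cong_refl) (simp add: cong_def)
    finally show ?thesis by simp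
  qed
  have "[int (u + v) = int u + int v] (mod int m)" by simp
  moreover have "[int (u + (m - v)) = int u - int v] (mod int m)" if "v < m" using that by (intro sub) auto
  moreover have "[int (u + (m - v mod m)) = int u - int v] (mod int m)"
    using assms by (intro sub) (auto simp: cong_def zmod_int intro: less_imp_le)
  ultimately show ?thesis
    by (auto simp: dihedral_mult_def orientation_def cong_def zmod_int)
qed

lemma dihedral_eqI:
  assumes "a < 2 * m" "b < 2 * m" "(a < m) = (b < m)" "[int a = int b] (mod int m)"
  shows "a = b"
proof -
  have "[a = b] (mod m)" using assms(4) by (simp only: cong_int_iff)
  then have "a mod m = b mod m" by (simp only: cong_def)
  moreover have "x mod m = (if x < m then x else x - m)" if "x < 2 * m" for x
    using that by (auto simp: mod_if)
  ultimately show ?thesis using assms(1-3) by (auto split: if_splits)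
qed

lemma dihedral_mult_assoc:
  assumes "m > 0"
  shows "dihedral_mult m (dihedral_mult m u v) w = dihedral_mult m u (dihedral_mult m v w)"
proof (rule dihedral_eqI[of _ m])
  have "[int (dihedral_mult m (dihedral_mult m u v) w)
      = int (dihedral_mult m u v) + orientation m (dihedral_mult m u v) * int w] (mod int m)"
    by (rule dihedral_mult_cong[OF assms])
  also have "[int (dihedral_mult m u v) + orientation m (dihedral_mult m u v) * int w
      = int u + orientation m u * int v + orientation m u * orientation m v * int w] (mod int m)"
    unfolding orientation_mult[OF assms] by (intro cong_add cong_refl dihedral_mult_cong[OF assms])
  also have "int u + orientation m u * int v + orientation m u * orientation m v * int w
      = int u + orientation m u * (int v + orientation m v * int w)" by (simp add: algebra_simps)
  also have "[int u + orientation m u * (int v + orientation m v * int w)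
      = int u + orientation m u * int (dihedral_mult m v w)] (mod int m)"
    by (intro cong_add cong_mult cong_refl cong_sym[OF dihedral_mult_cong[OF assms]])
  also have "[int u + orientation m u * int (dihedral_mult m v w)
      = int (dihedral_mult m u (dihedral_mult m v w))] (mod int m)"
    by (rule cong_sym[OF dihedral_mult_cong[OF assms]])
  finally show "[int (dihedral_mult m (dihedral_mult m u v) w) = int (dihedral_mult m u (dihedral_mult m v w))] (mod int m)" .
qed (use assms in \<open>auto simp: dihedral_mult_less dihedral_mult_side\<close>)

definition dihedral_inv :: "nat \<Rightarrow> nat \<Rightarrow> nat" where
  "dihedral_inv m u = (if u < m then (m - u) mod m else u)"

lemma dihedral_inv_mult:
  assumes "m > 0" "u < 2 * m"
  shows "dihedral_mult m (dihedral_inv m u) u = 0"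
proof (cases "u < m")
  case True
  have "((m - u) mod m + u) mod m = (m - u + u) mod m" by (rule mod_add_left_eq)
  then show ?thesis using True assms(1) by (simp add: dihedral_mult_def dihedral_inv_def)
next
  case False
  then have "u mod m = u - m" using assms(2) by (auto simp: mod_if)
  then have "u + (m - u mod m) = 2 * m" using False assms(2) by simp
  then show ?thesis using False by (simp add: dihedral_mult_def dihedral_inv_def)
qed

lemma group_dihedral_group: "m > 0 \<Longrightarrow> group (dihedral_group m)"
proof (rule groupI)
  fix x assume m: "m > 0" and x: "x \<in> carrier (dihedral_group m)"
  have "dihedral_inv m x \<in> carrier (dihedral_group m)"
    using x m by (auto simp: dihedral_group_def dihedral_inv_def intro: less_le_trans[OF mod_less_divisor])
  then show "\<exists>y\<in>carrier (dihedral_group m). y \<otimes>\<^bsub>dihedral_group m\<^esub> x = \<one>\<^bsub>dihedral_group m\<^esub>"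
    using dihedral_inv_mult[OF m] x by (auto simp: dihedral_group_def)
  have "x mod m = x - m" if "\<not> x < m" using x that by (auto simp: dihedral_group_def mod_if)
  then show "\<one>\<^bsub>dihedral_group m\<^esub> \<otimes>\<^bsub>dihedral_group m\<^esub> x = x"
    using m by (auto simp: dihedral_group_def dihedral_mult_def)
qed (auto simp: dihedral_group_def dihedral_mult_less dihedral_mult_assoc)

lemma inv_dihedral_group:
  assumes "m > 0" "u < 2 * m"
  shows "inv\<^bsub>dihedral_group m\<^esub> u = dihedral_inv m u"
proof -
  interpret group "dihedral_group m" by (rule group_dihedral_group[OF assms(1)])
  have "dihedral_inv m u \<in> carrier (dihedral_group m)"
    using assms by (auto simp: dihedral_group_def dihedral_inv_def intro: less_le_trans[OF mod_less_divisor])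
  then show ?thesis
    using dihedral_inv_mult[OF assms] assms by (intro inv_equality) (auto simp: dihedral_group_def)
qed

context dihedral
begin

lemma cayley: "cayley_graph (2 * m) adj"
proof -
  let ?G = "dihedral_group m"
  \<comment> \<open>The reflections m + s are involutions, so closure under inverses only concerns
    R.\<close>
  define C where "C = R \<union> (\<lambda>s. m + s) ` S"
  have C_iff: "x \<in> C \<longleftrightarrow> (if x < m then x \<in> R else x - m \<in> S)" for x
    using R' S by (auto simp: C_def image_iff) (metis le_add_diff_inverse not_less)
  have carrier: "carrier ?G = {..<2 * m}" "\<one>\<^bsub>?G\<^esub> = 0" by (simp_all add: dihedral_group_def)
  have "C \<subseteq> carrier ?G - {\<one>\<^bsub>?G\<^esub>}" using R S m_pos by (auto simp: C_def carrier)
  moreover have "inv\<^bsub>?G\<^esub> c \<in> C" if "c \<in> C" for c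
  proof (cases "c < m")
    case True
    then have "c \<in> R" using that by (simp add: C_iff)
    then have "m - c \<in> R" "m - c < m" using R by auto
    then show ?thesis using True m_pos by (simp add: inv_dihedral_group dihedral_inv_def C_iff)
  next
    case False
    moreover have "c < 2 * m" using that R' S by (auto simp: C_def)
    ultimately show ?thesis using that m_pos by (simp add: inv_dihedral_group dihedral_inv_def)
  qed
  moreover have "adj u v \<longleftrightarrow> v \<otimes>\<^bsub>?G\<^esub> inv\<^bsub>?G\<^esub> u \<in> C" if "u < 2 * m" "v < 2 * m" for u v
  proof -
    have mult: "v \<otimes>\<^bsub>?G\<^esub> inv\<^bsub>?G\<^esub> u = dihedral_mult m v (dihedral_inv m u)"
      using m_pos that by (simp add: inv_dihedral_group) (simp add: dihedral_group_def)
    show ?thesis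
    proof (cases "u < m")
      case u: True
      show ?thesis
      proof (cases "v < m")
        case True
        have "(v + (m - u) mod m) mod m = (v + (m - u)) mod m" by (rule mod_add_right_eq)
        then show ?thesis using u True m_pos
          by (simp add: mult dihedral_mult_def dihedral_inv_def C_iff dihedral_adj_def)
      next
        case False
        \<comment> \<open>For u = 0 the inner remainder is 0 and the difference is m, so the outer
          \<open>mod\<close> matters.\<close>
        have "(m - (m - u) mod m) mod m = u mod m"
          using u by (cases "u = 0") auto
        then have "(v + (m - (m - u) mod m)) mod m = (v + u) mod m" by (metis mod_add_right_eq)
        then show ?thesis using u False m_pos
          by (simp add: mult dihedral_mult_def dihedral_inv_def C_iff dihedral_adj_def add.commute)
      qed
    next
      case u: False
      then show ?thesis using m_pos
        by (cases "v < m") (simp_all add: mult dihedral_mult_def dihedral_inv_def C_iff dihedral_adj_def add.commute)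
    qed
  qed
  ultimately show ?thesis
    unfolding cayley_graph_def
    using group_dihedral_group[OF m_pos]
    by (intro exI[of _ ?G] exI[of _ C] exI[of _ id]) (auto simp: carrier lessThan_atLeast0)
qed

lemma mem_NCay: "2 * m \<in> NCay (card R + card S)"
  unfolding NCay_def using simple regular cayley nut m_pos by auto

end

section \<open>Vertex-transitive nut graphs\<close>

text \<open>Adjacency depends on v u^(-1), which right translations leave unchanged; translation by
  u^(-1) v takes u to v.\<close>

lemma cayley_imp_vertex_transitive:
  assumes "cayley_graph n E"
  shows "vertex_transitive n E"
proof -
  obtain \<Gamma> :: "nat monoid" and C f where G: "group \<Gamma>" and C: "C \<subseteq> carrier \<Gamma> - {\<one>\<^bsub>\<Gamma>\<^esub>}"
    and f: "bij_betw f (carrier \<Gamma>) {0..<n}"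
    and E: "\<And>u v. u \<in> carrier \<Gamma> \<Longrightarrow> v \<in> carrier \<Gamma> \<Longrightarrow> E (f u) (f v) \<longleftrightarrow> v \<otimes>\<^bsub>\<Gamma>\<^esub> inv\<^bsub>\<Gamma>\<^esub> u \<in> C"
    using assms unfolding cayley_graph_def by blast
  interpret group \<Gamma> by (rule G)
  define h where "h = inv_into (carrier \<Gamma>) f"
  have h: "bij_betw h {0..<n} (carrier \<Gamma>)" unfolding h_def by (rule bij_betw_inv_into[OF f])
  have hc: "h x \<in> carrier \<Gamma>" if "x < n" for x using h that by (auto simp: bij_betw_def)
  have fh: "f (h x) = x" if "x < n" for x unfolding h_def using f that by (simp add: bij_betw_inv_into_right)
  show ?thesis unfolding vertex_transitive_def
  proof (intro allI impI)
    fix u v assume uv: "u < n" "v < n"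
    define g where "g = inv\<^bsub>\<Gamma>\<^esub> h u \<otimes>\<^bsub>\<Gamma>\<^esub> h v"
    have g: "g \<in> carrier \<Gamma>" using hc uv by (simp add: g_def)
    define \<sigma> where "\<sigma> x = f (h x \<otimes>\<^bsub>\<Gamma>\<^esub> g)" for x
    have "bij_betw (\<lambda>x. x \<otimes>\<^bsub>\<Gamma>\<^esub> g) (carrier \<Gamma>) (carrier \<Gamma>)"
      using g by (intro bij_betw_byWitness[where f' = "\<lambda>x. x \<otimes>\<^bsub>\<Gamma>\<^esub> inv\<^bsub>\<Gamma>\<^esub> g"]) (auto simp: m_assoc)
    then have "bij_betw (f \<circ> (\<lambda>x. x \<otimes>\<^bsub>\<Gamma>\<^esub> g) \<circ> h) {0..<n} {0..<n}"
      using f h bij_betw_trans by blast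
    moreover have "f \<circ> (\<lambda>x. x \<otimes>\<^bsub>\<Gamma>\<^esub> g) \<circ> h = \<sigma>" by (auto simp: \<sigma>_def)
    ultimately have "bij_betw \<sigma> {0..<n} {0..<n}" by simp
    moreover have "E x y \<longleftrightarrow> E (\<sigma> x) (\<sigma> y)" if "x < n" "y < n" for x y
    proof -
      have "(h y \<otimes>\<^bsub>\<Gamma>\<^esub> g) \<otimes>\<^bsub>\<Gamma>\<^esub> inv\<^bsub>\<Gamma>\<^esub> (h x \<otimes>\<^bsub>\<Gamma>\<^esub> g) = h y \<otimes>\<^bsub>\<Gamma>\<^esub> (g \<otimes>\<^bsub>\<Gamma>\<^esub> (inv\<^bsub>\<Gamma>\<^esub> g \<otimes>\<^bsub>\<Gamma>\<^esub> inv\<^bsub>\<Gamma>\<^esub> h x))"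
        using hc[OF that(1)] hc[OF that(2)] g by (simp add: inv_mult_group m_assoc)
      also have "g \<otimes>\<^bsub>\<Gamma>\<^esub> (inv\<^bsub>\<Gamma>\<^esub> g \<otimes>\<^bsub>\<Gamma>\<^esub> inv\<^bsub>\<Gamma>\<^esub> h x) = inv\<^bsub>\<Gamma>\<^esub> h x"
        using hc[OF that(1)] g by (simp flip: m_assoc)
      finally have "E (\<sigma> x) (\<sigma> y) \<longleftrightarrow> h y \<otimes>\<^bsub>\<Gamma>\<^esub> inv\<^bsub>\<Gamma>\<^esub> h x \<in> C"
        unfolding \<sigma>_def using E hc that g by simp
      then show ?thesis using E[OF hc[OF that(1)] hc[OF that(2)]] fh that by simp
    qed
    moreover have "\<sigma> u = v"
    proof -
      have "h u \<otimes>\<^bsub>\<Gamma>\<^esub> g = h v" using hc uv by (simp add: g_def m_assoc[symmetric])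
      then show ?thesis using fh uv by (simp add: \<sigma>_def)
    qed
    ultimately show "\<exists>\<sigma>. bij_betw \<sigma> {0..<n} {0..<n} \<and> (\<forall>x<n. \<forall>y<n. E x y \<longleftrightarrow> E (\<sigma> x) (\<sigma> y)) \<and> \<sigma> u = v"
      by blast
  qed
qed

text \<open>The handshake lemma: swapping matches the adjacent pairs with i < j to those with j <
  i.\<close>

lemma even_card_symmetric_irreflexive:
  fixes V :: "nat set"
  assumes "finite V" "\<And>i j. i \<in> V \<Longrightarrow> j \<in> V \<Longrightarrow> E i j = E j i" "\<And>i. i \<in> V \<Longrightarrow> \<not> E i i"
  shows "even (\<Sum>i\<in>V. card {j \<in> V. E i j})"
proof -
  define A B where "A = {(i, j) \<in> V \<times> V. E i j \<and> i < j}" and "B = {(i, j) \<in> V \<times> V. E i j \<and> j < i}"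
  have "A \<subseteq> V \<times> V" "B \<subseteq> V \<times> V" by (auto simp: A_def B_def)
  then have fin: "finite A" "finite B"
    using finite_subset[OF _ finite_cartesian_product[OF assms(1,1)]] by blast+
  have "(\<Sum>i\<in>V. card {j \<in> V. E i j}) = card (SIGMA i:V. {j \<in> V. E i j})"
    using assms(1) by simp
  also have "(SIGMA i:V. {j \<in> V. E i j}) = A \<union> B"
    using assms(3) by (auto simp: A_def B_def) (metis nat_neq_iff)
  also have "card (A \<union> B) = card A + card B" using fin by (intro card_Un_disjoint) (auto simp: A_def B_def)
  also have "card A = card B"
    using assms(2) by (intro bij_betw_same_card[of prod.swap] bij_betw_byWitness[where f' = prod.swap]) (auto simp: A_def B_def)
  finally show ?thesis by simp
qed

lemma card_eq_double_pos:
  fixes t :: "nat \<Rightarrow> real"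
  assumes "finite A" "\<And>j. j \<in> A \<Longrightarrow> t j = 1 \<or> t j = -1" "sum t A = 0"
  shows "card A = 2 * card {j \<in> A. t j = 1}"
proof -
  define P M where "P = {j \<in> A. t j = 1}" and "M = {j \<in> A. t j = -1}"
  have A: "A = P \<union> M" "P \<inter> M = {}" "finite P" "finite M" using assms(1,2) by (auto simp: P_def M_def)
  have "sum t A = real (card P) - real (card M)"
    unfolding A(1) using A by (subst sum.union_disjoint) (auto simp: P_def M_def)
  then have "card P = card M" using assms(3) by simp
  moreover have "card A = card P + card M" using A by (metis card_Un_disjoint)
  ultimately show ?thesis by (simp add: P_def)
qed

section \<open>Necessary conditions on order and degree\<close>

locale vt_nut =
  fixes n d :: nat and E :: "nat \<Rightarrow> nat \<Rightarrow> bool"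
  assumes simple: "simple_graph n E" and regular: "regular_graph n E d"
    and transitive: "vertex_transitive n E" and nut: "nut_graph n E"
begin

definition N where "N i = {v. v < n \<and> E i v}"

lemma finite_N [simp]: "finite (N i)" by (simp add: N_def)

lemma card_N: "i < n \<Longrightarrow> card (N i) = d"
  using regular by (simp add: regular_graph_def N_def)

lemma sym: "i < n \<Longrightarrow> j < n \<Longrightarrow> E i j \<longleftrightarrow> E j i" and irrefl: "i < n \<Longrightarrow> \<not> E i i"
  using simple by (auto simp: simple_graph_def)

lemma n_ge_2: "n \<ge> 2" using nut by (simp add: nut_graph_def)

lemma sum_N: "(\<Sum>j<n. if E i j then f j else 0) = (\<Sum>j\<in>N i. f j)" for f :: "nat \<Rightarrow> real"
proof -
  have N: "N i = {j \<in> {..<n}. E i j}" by (auto simp: N_def)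
  show ?thesis unfolding N by (rule sum.inter_filter[symmetric]) simp
qed

definition kernel_fun where "kernel_fun y \<longleftrightarrow> (\<forall>i<n. (\<Sum>j\<in>N i. y j) = (0 :: real))"

lemma sign_vector_exists:
  "\<exists>t :: nat \<Rightarrow> real. (\<forall>i<n. t i = 1 \<or> t i = -1) \<and> kernel_fun t \<and>
    (\<forall>y. kernel_fun y \<longrightarrow> (\<exists>c. \<forall>i<n. y i = c * t i))"
proof -
  obtain x where x: "\<And>i. i < n \<Longrightarrow> x i \<noteq> 0" "kernel_fun x" "\<And>y. kernel_fun y \<Longrightarrow> \<exists>c. \<forall>i<n. y i = c * x i"
    using nut unfolding nut_graph_iff sum_N kernel_fun_def by blast
  have abs: "\<bar>x i\<bar> = \<bar>x 0\<bar>" if i: "i < n" for i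
  proof -
    obtain \<sigma> where \<sigma>: "bij_betw \<sigma> {0..<n} {0..<n}" "\<And>a b. a < n \<Longrightarrow> b < n \<Longrightarrow> E a b \<longleftrightarrow> E (\<sigma> a) (\<sigma> b)" "\<sigma> 0 = i"
      using transitive i n_ge_2 unfolding vertex_transitive_def by (metis le_trans less_le_trans zero_less_numeral)
    have \<sigma>n: "\<sigma> a < n" if "a < n" for a using \<sigma>(1) that by (auto simp: bij_betw_def)
    have "(\<Sum>j\<in>N a. x (\<sigma> j)) = 0" if a: "a < n" for a
    proof -
      have "bij_betw \<sigma> (N a) (N (\<sigma> a))"
        unfolding bij_betw_def
      proof
        show "inj_on \<sigma> (N a)" using \<sigma>(1) by (rule inj_on_subset[OF bij_betw_imp_inj_on]) (auto simp: N_def)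
        show "\<sigma> ` N a = N (\<sigma> a)"
        proof
          show "\<sigma> ` N a \<subseteq> N (\<sigma> a)" using \<sigma>(2) \<sigma>n a by (auto simp: N_def)
          show "N (\<sigma> a) \<subseteq> \<sigma> ` N a"
          proof
            fix v assume v: "v \<in> N (\<sigma> a)"
            then have "v \<in> \<sigma> ` {0..<n}" using \<sigma>(1) by (auto simp: bij_betw_def N_def)
            then obtain b where "b < n" "v = \<sigma> b" by auto
            then show "v \<in> \<sigma> ` N a" using v \<sigma>(2)[OF a] by (auto simp: N_def)
          qed
        qed
      qed
      then have "(\<Sum>j\<in>N a. x (\<sigma> j)) = (\<Sum>j\<in>N (\<sigma> a). x j)" by (rule sum.reindex_bij_betw)
      then show ?thesis using x(2) \<sigma>n[OF a] by (simp add: kernel_fun_def)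
    qed
    then obtain c where c: "\<And>a. a < n \<Longrightarrow> x (\<sigma> a) = c * x a" using x(3)[of "x \<circ> \<sigma>"] by (auto simp: kernel_fun_def)
    \<comment> \<open>A permutation preserves the sum of squares, so the factor c by which the
      automorphism scales x has square 1.\<close>
    have "(\<Sum>a=0..<n. (x (\<sigma> a))\<^sup>2) = (\<Sum>a=0..<n. (x a)\<^sup>2)" by (rule sum.reindex_bij_betw[OF \<sigma>(1)])
    then have "c\<^sup>2 * (\<Sum>a=0..<n. (x a)\<^sup>2) = (\<Sum>a=0..<n. (x a)\<^sup>2)"
      by (simp add: c power_mult_distrib sum_distrib_left)
    moreover have "(\<Sum>a=0..<n. (x a)\<^sup>2) > 0" using x(1) n_ge_2 by (intro sum_pos) auto
    ultimately have "c\<^sup>2 = 1" by simp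
    then have "\<bar>c\<bar> = 1" by (simp add: power2_eq_1_iff abs_if split: if_splits) auto
    then show ?thesis using c[of 0] \<sigma>(3) n_ge_2 by (simp add: abs_mult)
  qed
  define a where "a = \<bar>x 0\<bar>"
  have a: "a > 0" using x(1)[of 0] n_ge_2 by (simp add: a_def)
  define t where "t i = x i / a" for i
  have "t i = 1 \<or> t i = -1" if "i < n" for i
  proof -
    have "x i = a \<or> x i = - a" using abs[OF that] unfolding a_def[symmetric] by linarith
    then show ?thesis using a by (auto simp: t_def)
  qed
  moreover have "kernel_fun t" using x(2) by (simp add: kernel_fun_def t_def flip: sum_divide_distrib)
  moreover have "\<exists>c. \<forall>i<n. y i = c * t i" if y: "kernel_fun y" for y
  proof -
    obtain c where "\<forall>i<n. y i = c * x i" using x(3)[OF y] by blast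
    then have "\<forall>i<n. y i = (c * a) * t i" using a by (simp add: t_def)
    then show ?thesis by blast
  qed
  ultimately show ?thesis by (intro exI[of _ t] conjI allI impI) simp_all
qed

definition sign_vector :: "nat \<Rightarrow> real" where
  "sign_vector = (SOME t. (\<forall>i<n. t i = 1 \<or> t i = -1) \<and> kernel_fun t \<and>
    (\<forall>y. kernel_fun y \<longrightarrow> (\<exists>c. \<forall>i<n. y i = c * t i)))"

lemma sign_vector:
  "i < n \<Longrightarrow> sign_vector i = 1 \<or> sign_vector i = -1" "kernel_fun sign_vector"
  "kernel_fun y \<Longrightarrow> \<exists>c. \<forall>i<n. y i = c * sign_vector i"
  using someI_ex[OF sign_vector_exists] unfolding sign_vector_def[symmetric] by simp_all

text \<open>Without edges every function is in the kernel, for instance the indicator of 0, which is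
  no multiple of a vector without zeros as n >= 2. Positivity lets d be cancelled in
  \<open>half_order\<close>.\<close>

lemma degree_pos: "d > 0"
proof (rule ccontr)
  assume "\<not> d > 0"
  then have N: "N i = {}" if "i < n" for i using card_N[OF that] by simp
  define t where "t = sign_vector"
  note t = sign_vector[folded t_def]
  have "kernel_fun (\<lambda>i. if i = 0 then 1 else 0)" using N by (simp add: kernel_fun_def)
  then obtain c where "\<forall>i<n. (if i = 0 then 1 else 0) = c * t i" using t(3) by blast
  then have c: "(if i = 0 then 1 else 0) = c * t i" if "i < n" for i using that by blast
  have "c * t 0 = 1" "c * t 1 = 0" using c[of 0] c[of 1] n_ge_2 by auto
  then show False using t(1)[of 1] n_ge_2 by auto
qed

lemma half_degree:
  assumes "\<And>i. i < n \<Longrightarrow> t i = 1 \<or> t i = -1" "kernel_fun t" "i < n"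
  shows "d = 2 * card {j \<in> N i. t j = 1}"
proof -
  have "card (N i) = 2 * card {j \<in> N i. t j = 1}"
  proof (rule card_eq_double_pos)
    show "t j = 1 \<or> t j = -1" if "j \<in> N i" for j using assms(1)[of j] that by (simp add: N_def)
    show "sum t (N i) = 0" using assms(2,3) by (simp add: kernel_fun_def)
  qed simp
  then show ?thesis using card_N[OF assms(3)] by simp
qed

text \<open>Adding up all neighbourhood sums counts each value of t exactly d times, so d times the
  total of t is 0.\<close>

lemma half_order:
  assumes t: "\<And>i. i < n \<Longrightarrow> t i = 1 \<or> t i = -1" "kernel_fun t"
  shows "n = 2 * card {j \<in> {..<n}. t j = 1}"
proof -
  have "0 = (\<Sum>i<n. \<Sum>j<n. if E i j then t j else 0)" using t(2) by (simp add: kernel_fun_def sum_N)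
  also have "\<dots> = (\<Sum>j<n. \<Sum>i<n. if E i j then t j else 0)" by (rule sum.swap)
  also have "\<dots> = (\<Sum>j<n. \<Sum>i<n. if E j i then t j else 0)" using sym by (intro sum.cong refl) auto
  also have "\<dots> = (\<Sum>j<n. real d * t j)" by (intro sum.cong refl) (simp add: sum_N card_N)
  also have "\<dots> = real d * (\<Sum>j<n. t j)" by (simp add: sum_distrib_left)
  finally have "(\<Sum>j<n. t j) = 0" using degree_pos by simp
  then show ?thesis using card_eq_double_pos[of "{..<n}" t] t(1) by auto
qed

lemma even_degree: "even d"
proof -
  define t where "t = sign_vector"
  note t = sign_vector[folded t_def]
  show ?thesis using half_degree[OF t(1,2), of 0] n_ge_2 by simp
qed

lemma even_order: "even n"
proof -
  define t where "t = sign_vector"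
  note t = sign_vector[folded t_def]
  show ?thesis using half_order[OF t(1,2)] by (metis dvd_triv_left)
qed

lemma four_dvd_order:
  assumes "\<not> 4 dvd d"
  shows "4 dvd n"
proof -
  define t where "t = sign_vector"
  note t = sign_vector[folded t_def]
  define V where "V = {j \<in> {..<n}. t j = 1}"
  define p where "p = d div 2"
  have p: "card {j \<in> V. E i j} = p" if "i \<in> V" for i
  proof -
    have "{j \<in> V. E i j} = {j \<in> N i. t j = 1}" by (auto simp: V_def N_def)
    then show ?thesis using half_degree[OF t(1,2)] that by (auto simp: V_def p_def)
  qed
  have "even (\<Sum>i\<in>V. card {j \<in> V. E i j})"
    using sym irrefl by (intro even_card_symmetric_irreflexive) (auto simp: V_def)
  then have "even (card V * p)" using p by simp
  moreover have "odd p" using assms even_degree unfolding p_def by presburger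
  ultimately have "even (card V)" by simp
  then show ?thesis using half_order[OF t(1,2)] by (auto simp: V_def elim!: evenE)
qed

lemma order_neq_degree_plus_two: "n \<noteq> d + 2"
proof
  assume n: "n = d + 2"
  have c: "card ({..<n} - N i - {i}) = 1" if "i < n" for i
  proof -
    have "i \<notin> N i" using irrefl[OF that] by (simp add: N_def)
    moreover have "N i \<subseteq> {..<n}" by (auto simp: N_def)
    ultimately have "card ({..<n} - N i - {i}) = n - d - 1"
      using card_N[OF that] that by (simp add: card_Diff_subset)
    then show ?thesis by (simp only: n)
  qed
  have n0: "0 < n" using n by simp
  obtain w where w: "{..<n} - N 0 - {0} = {w}" using c[OF n0] by (rule card_1_singletonE)
  have "w \<in> {..<n} - N 0 - {0}" unfolding w by simp
  then have w': "w < n" "w \<noteq> 0" "\<not> E 0 w" by (simp_all add: N_def)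
  then have "0 \<in> {..<n} - N w - {w}" using sym[OF n0 w'(1)] n0 by (simp add: N_def)
  \<comment> \<open>w is the only non-neighbour of 0 apart from 0 itself; by the same count 0 is the
    only one of w, so both have the same neighbours.\<close>
  moreover obtain w2 where w2: "{..<n} - N w - {w} = {w2}" using c[OF w'(1)] by (rule card_1_singletonE)
  ultimately have ww: "{..<n} - N w - {w} = {0}" by simp
  have twin: "E i 0 \<longleftrightarrow> E i w" if "i < n" for i
  proof -
    have "i \<in> {..<n} - N 0 - {0} \<longleftrightarrow> i = w" "i \<in> {..<n} - N w - {w} \<longleftrightarrow> i = 0"
      unfolding w ww by simp_all
    then have "E 0 i \<longleftrightarrow> i \<noteq> 0 \<and> i \<noteq> w" "E w i \<longleftrightarrow> i \<noteq> 0 \<and> i \<noteq> w"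
      using that irrefl[OF n0] irrefl[OF w'(1)] by (auto simp: N_def)
    then show ?thesis using sym[OF that n0] sym[OF that w'(1)] by simp
  qed
  \<comment> \<open>The difference of the indicators of the twins is in the kernel but vanishes on
    every neighbour of 0, so it is no nonzero multiple of the sign vector.\<close>
  define y :: "nat \<Rightarrow> real" where "y j = (if j = 0 then 1 else if j = w then -1 else 0)" for j
  have "(\<Sum>j\<in>N i. y j) = 0" if i: "i < n" for i
  proof -
    have "(\<Sum>j\<in>N i. y j) = (\<Sum>j\<in>N i. (if j = 0 then 1 else 0) - (if j = w then 1 else 0))"
      using w' by (intro sum.cong) (auto simp: y_def)
    also have "\<dots> = (if 0 \<in> N i then 1 else 0) - (if w \<in> N i then 1 else 0)"
      by (simp add: sum_subtractf)
    also have "\<dots> = 0" using twin[OF i] n0 w' by (simp add: N_def)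
    finally show ?thesis .
  qed
  then have y: "kernel_fun y" by (simp add: kernel_fun_def)
  define t where "t = sign_vector"
  note t = sign_vector[folded t_def]
  obtain c where c: "\<forall>i<n. y i = c * t i" using t(3)[OF y] by blast
  have "N 0 \<noteq> {}" using card_N[OF n0] degree_pos by auto
  then obtain j where j: "j < n" "E 0 j" by (auto simp: N_def)
  then have "j \<noteq> 0" "j \<noteq> w" using irrefl[OF n0] w'(3) by metis+
  then have "y j = 0" by (simp add: y_def)
  moreover have "y j = c * t j" "y 0 = c * t 0" using c j(1) n0 by blast+
  ultimately have "y 0 = 0" using t(1)[OF j(1)] by auto
  then show False by (simp add: y_def)
qed

lemma order_ge: "n \<ge> d + 4"
proof -
  have n0: "0 < n" using n_ge_2 by simp
  have "N 0 \<subseteq> {..<n} - {0}" using irrefl n0 by (auto simp: N_def)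
  then have "card (N 0) \<le> card ({..<n} - {0})" by (intro card_mono) auto
  then have "d \<le> n - 1" using card_N n0 by simp
  then have "n \<ge> d + 1" using n0 by simp
  moreover have "n \<noteq> d + 1" "n \<noteq> d + 3" using even_degree even_order by presburger+
  ultimately show ?thesis using order_neq_degree_plus_two by simp
qed

text \<open>In a 2-regular graph the edges joining equal signs and those joining opposite signs are two
  perfect matchings, i.e. involutions \<open>a\<close> and \<open>b\<close>. The kernel vector restricted to an orbit of
  \<open>\<tau> = b \<circ> a\<close> stays in the kernel, so there is only one orbit; as \<open>a\<close> inverts \<open>\<tau>\<close> and preserves signs
  while \<open>\<tau>\<close> flips them, \<open>a\<close> would have a fixed point.\<close>

lemma degree_neq_two: "d \<noteq> 2"
proof
  assume d: "d = 2"
  define t where "t = sign_vector"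
  note t = sign_vector[folded t_def]
  have ex: "\<exists>a b. N v = {a, b} \<and> a \<noteq> b \<and> t a = t v \<and> t b = - t v" if v: "v < n" for v
  proof -
    obtain a b where ab: "N v = {a, b}" "a \<noteq> b" using card_N[OF v] d by (auto simp: card_2_iff)
    then have "a < n" "b < n" by (auto simp: N_def)
    moreover have "t a + t b = 0" using t(2) v ab by (auto simp: kernel_fun_def)
    ultimately have "t a = t v \<and> t b = - t v \<or> t b = t v \<and> t a = - t v" using t(1)[of a] t(1)[of b] t(1)[OF v] by auto
    then show ?thesis using ab by (metis insert_commute)
  qed
  then obtain a b where ab: "\<And>v. v < n \<Longrightarrow> N v = {a v, b v} \<and> a v \<noteq> b v \<and> t (a v) = t v \<and> t (b v) = - t v"
    by metis
  have lt: "a v < n" "b v < n" "E v (a v)" "E v (b v)" if "v < n" for v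
    using ab[OF that] by (auto simp: N_def)
  have tnz: "t v \<noteq> - t v" if "v < n" for v using t(1)[OF that] by auto
  have a_a: "a (a v) = v" if v: "v < n" for v
  proof -
    have "v \<in> N (a v)" using v lt[OF v] sym by (auto simp: N_def)
    moreover have "v \<noteq> b (a v)" using ab[OF v] ab[OF lt(1)[OF v]] tnz[OF v] by metis
    ultimately show ?thesis using ab[OF lt(1)[OF v]] by auto
  qed
  have b_b: "b (b v) = v" if v: "v < n" for v
  proof -
    have "v \<in> N (b v)" using v lt[OF v] sym by (auto simp: N_def)
    moreover have "v \<noteq> a (b v)" using ab[OF v] ab[OF lt(2)[OF v]] tnz[OF v] by metis
    ultimately show ?thesis using ab[OF lt(2)[OF v]] by auto
  qed
  define \<tau> where "\<tau> = b \<circ> a"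
  have \<tau>n: "\<tau> v < n" if "v < n" for v using lt that by (simp add: \<tau>_def)
  have \<tau>kn: "(\<tau> ^^ k) v < n" if "v < n" for k v using that \<tau>n by (induction k) auto
  have \<tau>inj: "v = v'" if "\<tau> v = \<tau> v'" "v < n" "v' < n" for v v'
    using that a_a b_b lt unfolding \<tau>_def by (metis comp_apply)
  have \<tau>kinj: "v = v'" if "(\<tau> ^^ k) v = (\<tau> ^^ k) v'" "v < n" "v' < n" for v v' k
    using that by (induction k) (auto dest: \<tau>inj simp: \<tau>kn)
  have \<tau>t: "t ((\<tau> ^^ k) v) = (-1) ^ k * t v" if "v < n" for k v
  proof (induction k)
    case (Suc k)
    have "t (\<tau> ((\<tau> ^^ k) v)) = - t ((\<tau> ^^ k) v)" using ab lt \<tau>kn[OF that, of k] by (simp add: \<tau>_def)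
    then show ?case using Suc by simp
  qed simp
  define Orb where "Orb = range (\<lambda>k. (\<tau> ^^ k) 0)"
  have n0: "0 < n" using n_ge_2 by simp
  have On: "Orb \<subseteq> {..<n}" using \<tau>kn[OF n0] by (auto simp: Orb_def)
  have Orb\<tau>: "\<tau> ` Orb \<subseteq> Orb"
  proof
    fix z assume "z \<in> \<tau> ` Orb"
    then obtain k where "z = \<tau> ((\<tau> ^^ k) 0)" by (auto simp: Orb_def)
    then have "z = (\<tau> ^^ Suc k) 0" by simp
    then show "z \<in> Orb" unfolding Orb_def by blast
  qed
  have "inj_on \<tau> Orb" using \<tau>inj On by (auto intro!: inj_onI)
  then have Orb_eq: "\<tau> ` Orb = Orb" using endo_inj_surj[OF finite_subset[OF On] Orb\<tau>] by simp
  \<comment> \<open>b v is tau (a v) and tau permutes the orbit, so the two neighbours of v, of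
    opposite signs, are both inside or both outside; the truncated vector y stays balanced.\<close>
  have abO: "a v \<in> Orb \<longleftrightarrow> b v \<in> Orb" if v: "v < n" for v
  proof -
    have bv: "\<tau> (a v) = b v" using a_a[OF v] by (simp add: \<tau>_def)
    show ?thesis
    proof
      assume "b v \<in> Orb"
      then obtain z where "z \<in> Orb" "\<tau> z = \<tau> (a v)" using Orb_eq bv by (metis imageE)
      then have "z = a v" using \<tau>inj lt(1)[OF v] On by auto
      then show "a v \<in> Orb" using \<open>z \<in> Orb\<close> by simp
    qed (use bv Orb\<tau> in force)
  qed
  define y where "y j = (if j \<in> Orb then t j else 0)" for j
  have "(\<Sum>j\<in>N v. y j) = 0" if v: "v < n" for v
    using ab[OF v] abO[OF v] by (auto simp: y_def)
  then have "kernel_fun y" by (simp add: kernel_fun_def)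
  then obtain c where c: "\<And>i. i < n \<Longrightarrow> y i = c * t i" using t(3) by blast
  have "0 \<in> Orb" unfolding Orb_def by (rule range_eqI[of _ _ 0]) simp
  then have "c = 1" using c[OF n0] t(1)[OF n0] by (auto simp: y_def)
  then have "a 0 \<in> Orb" using c[OF lt(1)[OF n0]] t(1)[OF lt(1)[OF n0]] by (auto simp: y_def split: if_splits)
  then obtain k where k: "a 0 = (\<tau> ^^ k) 0" by (auto simp: Orb_def)
  have "(-1) ^ k * t 0 = t 0" using \<tau>t[OF n0, of k] ab[OF n0] k by simp
  then have "even k" using tnz[OF n0] by (cases "even k") auto
  then obtain j where j: "k = j + j" by (auto elim: evenE simp: mult_2)
  \<comment> \<open>Conjugation by a inverts tau. With k = 2 j, the identity a 0 = tau^k 0 makes u =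
    tau^j 0 a fixed point of a, that is, a vertex with a loop.\<close>
  have inv: "(\<tau> ^^ j) (a ((\<tau> ^^ j) z)) = a z" if "z < n" for j z
    using that
  proof (induction j arbitrary: z)
    case (Suc j)
    have step: "\<tau> (a (\<tau> z)) = a z" if "z < n" for z
      using that a_a b_b lt by (simp add: \<tau>_def)
    have "(\<tau> ^^ Suc j) (a ((\<tau> ^^ Suc j) z)) = (\<tau> ^^ j) (\<tau> (a (\<tau> ((\<tau> ^^ j) z))))" by (simp add: funpow_swap1)
    also have "\<dots> = (\<tau> ^^ j) (a ((\<tau> ^^ j) z))" using step[OF \<tau>kn[OF Suc.prems]] by simp
    finally show ?case using Suc by simp
  qed simp
  define u where "u = (\<tau> ^^ j) 0"
  have un: "u < n" using \<tau>kn[OF n0] by (simp add: u_def)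
  have "(\<tau> ^^ j) (a u) = (\<tau> ^^ j) u" using inv[OF n0, of j] k j by (simp add: u_def funpow_add)
  then have "a u = u" using \<tau>kinj lt(1)[OF un] un by blast
  then show False using lt(3)[OF un] irrefl[OF un] by simp
qed

lemma degree_ge: "d \<ge> 4"
proof -
  have "d \<noteq> 0" "d \<noteq> 1" "d \<noteq> 3" using degree_pos even_degree by auto
  then show ?thesis using degree_neq_two by linarith
qed

end

section \<open>The sets of orders\<close>

lemma NCay_subset_NVT: "NCay d \<subseteq> NVT d"
  using cayley_imp_vertex_transitive by (auto simp: NCay_def NVT_def)

lemma NVT_necessary:
  assumes "n \<in> NVT d"
  shows "d \<ge> 4" "even d" "even n" "n \<ge> d + 4" "\<not> 4 dvd d \<Longrightarrow> 4 dvd n"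
proof -
  obtain E where "vt_nut n d E" using assms by (auto simp: NVT_def vt_nut_def)
  then interpret vt_nut n d E .
  show "d \<ge> 4" "even d" "even n" "n \<ge> d + 4" "\<not> 4 dvd d \<Longrightarrow> 4 dvd n"
    by (rule degree_ge even_degree even_order order_ge four_dvd_order; assumption?)+
qed

lemma NCay_sufficient:
  assumes "k \<ge> 2" "k + 2 \<le> m" "odd k \<Longrightarrow> even m"
  shows "2 * m \<in> NCay (2 * k)"
proof -
  obtain R S \<kappa> where "spectral_pair m R S \<kappa>" "card R + card S = 2 * k"
    using exists_spectral_pair[OF assms] by blast
  then show ?thesis using dihedral.mem_NCay[of m R S \<kappa>] by (simp add: dihedral_def)
qed

theorem mainTheorem1:
  fixes d :: nat
  shows "NVT d = NCay d \<and>
         NVT d = (if odd d \<or> d < 4 then {}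
                  else if 4 dvd d then {n. n \<ge> 1 \<and> even n \<and> n \<ge> d + 4}
                  else {n. n \<ge> 1 \<and> 4 dvd n \<and> n \<ge> d + 6})"
proof -
  define T where "T = (if odd d \<or> d < 4 then {}
                  else if 4 dvd d then {n. n \<ge> 1 \<and> even n \<and> n \<ge> d + 4}
                  else {n. n \<ge> 1 \<and> 4 dvd n \<and> n \<ge> d + 6})"
  have "n \<in> T" if "n \<in> NVT d" for n
  proof -
    note nec = NVT_necessary[OF that]
    \<comment> \<open>Here d + 4 is 2 modulo 4, so a multiple of 4 that is at least d + 4 is at
      least d + 6.\<close>
    have "n \<ge> d + 6" if "\<not> 4 dvd d" using nec(2,4) nec(5)[OF that] that by presburger
    then show ?thesis using nec by (auto simp: T_def)
  qed
  moreover have "n \<in> NCay d" if "n \<in> T" for n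
  proof -
    have d: "even d" "d \<ge> 4" and n: "even n" "n \<ge> d + 4" "4 dvd d \<or> 4 dvd n"
      using that by (auto simp: T_def split: if_splits)
    obtain k where k: "d = 2 * k" using d(1) by (rule evenE)
    obtain m where m: "n = 2 * m" using n(1) by (rule evenE)
    \<comment> \<open>If k and m were both odd, neither d nor n would be divisible by 4.\<close>
    have "even k \<or> even m" using n(3) unfolding k m by presburger
    then have "2 * m \<in> NCay (2 * k)" using d n k m by (intro NCay_sufficient) auto
    then show ?thesis by (simp add: k m)
  qed
  ultimately have "NVT d = T" "NCay d = T" using NCay_subset_NVT[of d] by blast+
  then show ?thesis by (simp add: T_def)
qed

end
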